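(* Let $U,X$ be Hilbert spaces and let $S=\begin{bmatrix}A\&B\\ C\&D\end{bmatrix}$ be an impedance passive system node on the spaces $(U,X,U)$. Consider the LQ optimal control problem of minimizing $J(x_0,u)=\int_0^\infty \|u(t)\|_U^2+\|y(t)\|_U^2\,\mathrm{d}t$ subject to $\begin{bmatrix}\dot x(t)\\ y(t)\end{bmatrix}=S\begin{bmatrix}x(t)\\ u(t)\end{bmatrix}$, $t\ge 0$, $x(0)=x_0$. Then the finite cost condition is satisfied and the optimal cost operator $\Pi$ satisfies $\Pi\le I$, i.e. $\langle x_0,\Pi x_0\rangle_X\le \|x_0\|_X^2$ for all $x_0\in X$. If in addition $S$ is impedance energy preserving and the semigroup $\mathbb{T}^K$ (generated by the operator $A^K$ associated with the feedback $u=-y$) is strongly stable, then the unique stabilizing optimal control is $u(t)=-y(t)$, $t\ge 0$, and the associated optimal cost operator is $\Pi=I$. In this case $\Pi$ satisfies the operator node Riccati equation for $S$ with $E\&F:D(S)\to U$, $E\&F\begin{bmatrix}x\\ u\end{bmatrix}=C\&D\begin{bmatrix}x\\ u\end{bmatrix}+u$.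
   Context: System node: a closed operator $S=\begin{bmatrix}A\&B\\ C\&D\end{bmatrix}:D(S)\subset X\times U\to X\times Y$ ($U,X,Y$ Hilbert spaces) is a system node on $(U,X,Y)$ if: (i) the operator $Ax:=A\&B\begin{bmatrix}x\\ 0\end{bmatrix}$ with $D(A)=\{x\in X: (x,0)^\top\in D(S)\}$ generates a strongly continuous semigroup on $X$ ($A$ is called the semigroup generator of $S$); (ii) $A\&B$ extends to an operator $[A,\ B]\in\mathcal{L}(X\times U,X_{-1})$, where $X_{-1}$ is the completion of $X$ in the norm $\|(\lambda_0-A)^{-1}\cdot\|_X$ for a fixed $\lambda_0\in\rho(A)$, and $A$ also denotes its extension in $\mathcal{L}(X,X_{-1})$; (iii) $D(S)=\{(x,u)^\top\in X\times U: Ax+Bu\in X\}$. Solutions: $(x,u,y)$ is a classical solution on $[0,\infty)$ if $x\in C^1([0,\infty);X)$, $u\in C([0,\infty);U)$, $y\in C([0,\infty);Y)$, $(x(t),u(t))^\top\in D(S)$ and $(\dot x(t),y(t))^\top=S(x(t),u(t))^\top$ for all $t\ge0$. $(x,u,y)$ is a generalized solution if $x\in C([0,\infty);X)$, $u\in L^2_{\mathrm{loc}}(0,\infty;U)$, $y\in L^2_{\mathrm{loc}}(0,\infty;Y)$ and there are classical solutions $(x_k,u_k,y_k)$ with $x_k\to x$ in $C([0,\infty);X)$ (uniformly on bounded intervals) and $u_k\to u$, $y_k\to y$ in $L^2$ on every interval $[0,\tau]$. The cost $J(x_0,u)$ is evaluated along generalized solutions with $x(0)=x_0$. Impedance passive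 (here $Y=U$): $\mathrm{Re}\,\langle A\&B\begin{bmatrix}x\\ u\end{bmatrix},x\rangle_X\le \mathrm{Re}\,\langle C\&D\begin{bmatrix}x\\ u\end{bmatrix},u\rangle_U$ for all $(x,u)^\top\in D(S)$; impedance energy preserving: equality holds for all $(x,u)^\top\in D(S)$. Closed-loop semigroup: for an impedance passive $S$, the negative output feedback $u=-y+v$ yields a (well-posed, scattering passive) system node $S^K$, whose semigroup generator is $D(A^K)=\{x\in X : \exists v\in U \text{ s.t. } Ax-Bv\in X,\ v=C\&D\begin{bmatrix}x\\ -v\end{bmatrix}\}$, $A^Kx=Ax-Bv(x)$, where $v(x)$ is the element $v$ in the definition of $D(A^K)$. $\mathbb{T}^K$ denotes the semigroup generated by $A^K$. A semigroup $\mathbb{T}$ is strongly stable if $\|\mathbb{T}_tx_0\|\to0$ as $t\to\infty$ for every $x_0\in X$. Finite cost condition: for every $x_0\in X$ there is at least one input $u$ with $J(x_0,u)<\infty$. Optimal cost operator: the operator $\Pi=\Pi^*\in\mathcal{L}(X)$ with $\langle x_0,\Pi x_0\rangle_X=\inf_{u\in L^2(0,\infty;U)}J(x_0,u)$ for all $x_0\in X$. A control is stabilizing if the corresponding state trajectory satisfies $\lim_{t\to\infty}\|x(t)\|_X=0$. Operator node Riccati equation for $S$ (unknowns $\Pi=\Pi^*\in\mathcal{L}(X)$ and $E\&F:D(S)\to U$): for all $(x,u)^\top\in D(S)$, $\langle A\&B\begin{bmatrix}x\\ u\end{bmatrix},\Pi x\rangle_X+\langle \Pi x,A\&B\begin{bmatrix}x\\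 u\end{bmatrix}\rangle_X+\|C\&D\begin{bmatrix}x\\ u\end{bmatrix}\|_Y^2+\|u\|_U^2=\|E\&F\begin{bmatrix}x\\ u\end{bmatrix}\|_U^2$. *)

theory Defs
  imports "HOL-Analysis.Analysis"
begin

section \<open>Complex Hilbert spaces\<close>

text \<open>
  The library has only real inner product spaces. A complex Hilbert space is a complete real
  inner product space with a compatible complex scalar multiplication and a sesquilinear form
  (linear in the first argument) whose real part is the real inner product; in particular
  \<open>norm\<close> is the norm induced by \<open>cinner\<close>. No separability is assumed.
\<close>

class chilbert_space = real_inner + complete_space +
  fixes scaleC :: "complex \<Rightarrow> 'a \<Rightarrow> 'a" (infixr "*\<^sub>C" 75)
    and cinner :: "'a \<Rightarrow> 'a \<Rightarrow> complex"
  assumes scaleC_add_right: "c *\<^sub>C (x + y) = c *\<^sub>C x + c *\<^sub>C y"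
    and scaleC_add_left: "(c + d) *\<^sub>C x = c *\<^sub>C x + d *\<^sub>C x"
    and scaleC_scaleC: "c *\<^sub>C d *\<^sub>C x = (c * d) *\<^sub>C x"
    and scaleC_of_real: "complex_of_real r *\<^sub>C x = r *\<^sub>R x"
    and cinner_add_left: "cinner (x + y) z = cinner x z + cinner y z"
    and cinner_scaleC_left: "cinner (c *\<^sub>C x) y = c * cinner x y"
    and cinner_commute: "cinner y x = cnj (cinner x y)"
    and Re_cinner: "Re (cinner x y) = inner x y"

instantiation prod :: (chilbert_space, chilbert_space) chilbert_space
begin

definition scaleC_prod :: "complex \<Rightarrow> 'a \<times> 'b \<Rightarrow> 'a \<times> 'b"
  where "scaleC_prod c w = (c *\<^sub>C fst w, c *\<^sub>C snd w)"

definition cinner_prod :: "'a \<times> 'b \<Rightarrow> 'a \<times> 'b \<Rightarrow> complex"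
  where "cinner_prod v w = cinner (fst v) (fst w) + cinner (snd v) (snd w)"

instance
proof
  fix c d :: complex and r :: real and x y z :: "'a \<times> 'b"
  show "c *\<^sub>C (x + y) = c *\<^sub>C x + c *\<^sub>C y"
    by (simp add: scaleC_prod_def scaleC_add_right)
  show "(c + d) *\<^sub>C x = c *\<^sub>C x + d *\<^sub>C x"
    by (simp add: scaleC_prod_def scaleC_add_left)
  show "c *\<^sub>C d *\<^sub>C x = (c * d) *\<^sub>C x"
    by (simp add: scaleC_prod_def scaleC_scaleC)
  show "complex_of_real r *\<^sub>C x = r *\<^sub>R x"
    by (simp add: scaleC_prod_def scaleC_of_real scaleR_prod_def)
  show "cinner (x + y) z = cinner x z + cinner y z"
    by (simp add: cinner_prod_def cinner_add_left)
  show "cinner (c *\<^sub>C x) y = c * cinner x y"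
    by (simp add: cinner_prod_def scaleC_prod_def cinner_scaleC_left distrib_left)
  show "cinner y x = cnj (cinner x y)"
    by (simp add: cinner_prod_def cinner_commute[of "fst y"] cinner_commute[of "snd y"])
  show "Re (cinner x y) = inner x y"
    by (simp add: cinner_prod_def inner_prod_def Re_cinner)
qed

end

definition bounded_clinear :: "('a::chilbert_space \<Rightarrow> 'b::chilbert_space) \<Rightarrow> bool"
  where "bounded_clinear f \<longleftrightarrow> bounded_linear f \<and> (\<forall>c x. f (c *\<^sub>C x) = c *\<^sub>C f x)"

definition self_adjoint :: "('a::chilbert_space \<Rightarrow> 'a) \<Rightarrow> bool"
  where "self_adjoint P \<longleftrightarrow> bounded_clinear P \<and> (\<forall>x y. cinner (P x) y = cinner x (P y))"


section \<open>Partially defined operators and semigroups\<close>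

text \<open>The values of \<open>app\<close> outside \<open>Dom\<close> are irrelevant.\<close>

record ('a, 'b) partial_op =
  Dom :: "'a set"
  app :: "'a \<Rightarrow> 'b"

definition clinear_on :: "'a::chilbert_space set \<Rightarrow> ('a \<Rightarrow> 'b::chilbert_space) \<Rightarrow> bool"
  where "clinear_on D f \<longleftrightarrow>
    0 \<in> D \<and>
    (\<forall>x\<in>D. \<forall>y\<in>D. x + y \<in> D \<and> f (x + y) = f x + f y) \<and>
    (\<forall>c. \<forall>x\<in>D. c *\<^sub>C x \<in> D \<and> f (c *\<^sub>C x) = c *\<^sub>C f x)"

definition closed_op :: "('a::chilbert_space, 'b::chilbert_space) partial_op \<Rightarrow> bool"
  where "closed_op S \<longleftrightarrow> closed {(w, app S w) | w. w \<in> Dom S}"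

definition c0_semigroup :: "(real \<Rightarrow> 'x::chilbert_space \<Rightarrow> 'x) \<Rightarrow> bool"
  where "c0_semigroup T \<longleftrightarrow>
    (\<forall>t\<ge>0. bounded_clinear (T t)) \<and>
    T 0 = id \<and>
    (\<forall>s\<ge>0. \<forall>t\<ge>0. T (s + t) = T s \<circ> T t) \<and>
    (\<forall>x. ((\<lambda>t. T t x) \<longlongrightarrow> x) (at_right 0))"

definition generates ::
  "('x::chilbert_space, 'x) partial_op \<Rightarrow> (real \<Rightarrow> 'x \<Rightarrow> 'x) \<Rightarrow> bool"
  where "generates A T \<longleftrightarrow>
    c0_semigroup T \<and>
    (\<forall>x. x \<in> Dom A \<longleftrightarrow> (\<exists>z. ((\<lambda>h. (T h x - x) /\<^sub>R h) \<longlongrightarrow> z) (at_right 0))) \<and>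
    (\<forall>x\<in>Dom A. ((\<lambda>h. (T h x - x) /\<^sub>R h) \<longlongrightarrow> app A x) (at_right 0))"

definition strongly_stable :: "(real \<Rightarrow> 'x::chilbert_space \<Rightarrow> 'x) \<Rightarrow> bool"
  where "strongly_stable T \<longleftrightarrow> (\<forall>x. ((\<lambda>t. norm (T t x)) \<longlongrightarrow> 0) at_top)"

definition resolvent ::
  "('x::chilbert_space, 'x) partial_op \<Rightarrow> complex \<Rightarrow> 'x \<Rightarrow> 'x"
  where "resolvent A l = inv_into (Dom A) (\<lambda>x. l *\<^sub>C x - app A x)"

definition resolvent_set :: "('x::chilbert_space, 'x) partial_op \<Rightarrow> complex set"
  where "resolvent_set A =
    {l. bij_betw (\<lambda>x. l *\<^sub>C x - app A x) (Dom A) UNIV \<and> bounded_clinear (resolvent A l)}"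


section \<open>System nodes\<close>

text \<open>
  \<open>emb\<close> embeds \<open>X\<close> into a completion \<open>X\<^sub>-\<^sub>1\<close> of \<open>X\<close> in the norm \<open>\<parallel>(l - A)\<^sup>-\<^sup>1 x\<parallel>\<close>, so that
  \<open>z \<in> X\<close> for \<open>z \<in> X\<^sub>-\<^sub>1\<close> reads \<open>z \<in> range emb\<close>. The space \<open>X\<^sub>-\<^sub>1\<close> is represented by an arbitrary
  type carrying such an embedding, since a completion that depends on the operator \<open>A\<close> cannot
  be a type. As that norm is induced by an inner product, every completion is a Hilbert space.
  A realization always exists: for the generator \<open>A\<close> of a semigroup one may take the type of
  \<open>X\<close> itself and \<open>emb = resolvent A l\<close>.
\<close>

definition extrapolation_space ::
  "('x::chilbert_space, 'x) partial_op \<Rightarrow> complex \<Rightarrow> ('x \<Rightarrow> 'z::chilbert_space) \<Rightarrow> bool"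
  where "extrapolation_space A l emb \<longleftrightarrow>
    l \<in> resolvent_set A \<and>
    clinear_on UNIV emb \<and>
    (\<forall>x. norm (emb x) = norm (resolvent A l x)) \<and>
    closure (range emb) = UNIV"

abbreviation AB :: "('x \<times> 'u, 'x \<times> 'y) partial_op \<Rightarrow> 'x \<times> 'u \<Rightarrow> 'x"
  where "AB S w \<equiv> fst (app S w)"

abbreviation CD :: "('x \<times> 'u, 'x \<times> 'y) partial_op \<Rightarrow> 'x \<times> 'u \<Rightarrow> 'y"
  where "CD S w \<equiv> snd (app S w)"

definition semigroup_generator ::
  "('x::chilbert_space \<times> 'u::chilbert_space, 'x \<times> 'y) partial_op \<Rightarrow> ('x, 'x) partial_op"
  where "semigroup_generator S = \<lparr>Dom = {x. (x, 0) \<in> Dom S}, app = (\<lambda>x. AB S (x, 0))\<rparr>"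

text \<open>
  \<open>Ae\<close> is the extension of the generator to an operator from \<open>X\<close> to \<open>X\<^sub>-\<^sub>1\<close>, and \<open>B\<close> is the
  control operator; both are uniquely determined by \<open>S\<close> and \<open>emb\<close>.
\<close>

definition system_node ::
  "('x::chilbert_space \<times> 'u::chilbert_space, 'x \<times> 'y::chilbert_space) partial_op \<Rightarrow>
    complex \<Rightarrow> ('x \<Rightarrow> 'z::chilbert_space) \<Rightarrow> ('x \<Rightarrow> 'z) \<Rightarrow> ('u \<Rightarrow> 'z) \<Rightarrow> bool"
  where "system_node S l emb Ae B \<longleftrightarrow>
    clinear_on (Dom S) (app S) \<and>
    closed_op S \<and>
    (\<exists>T. generates (semigroup_generator S) T) \<and>
    extrapolation_space (semigroup_generator S) l emb \<and>
    bounded_clinear Ae \<and> bounded_clinear B \<and>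
    (\<forall>(x, u)\<in>Dom S. Ae x + B u = emb (AB S (x, u))) \<and>
    Dom S = {(x, u). Ae x + B u \<in> range emb}"

definition impedance_passive ::
  "('x::chilbert_space \<times> 'u::chilbert_space, 'x \<times> 'u) partial_op \<Rightarrow> bool"
  where "impedance_passive S \<longleftrightarrow>
    (\<forall>(x, u)\<in>Dom S. Re (cinner (AB S (x, u)) x) \<le> Re (cinner (CD S (x, u)) u))"

definition impedance_energy_preserving ::
  "('x::chilbert_space \<times> 'u::chilbert_space, 'x \<times> 'u) partial_op \<Rightarrow> bool"
  where "impedance_energy_preserving S \<longleftrightarrow>
    (\<forall>(x, u)\<in>Dom S. Re (cinner (AB S (x, u)) x) = Re (cinner (CD S (x, u)) u))"

text \<open>
  The semigroup generator of the closed-loop system under \<open>u = -y + v\<close>. The element \<open>v\<close> is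
  unique if \<open>S\<close> is impedance passive.
\<close>

definition closed_loop_generator ::
  "('x::chilbert_space \<times> 'u::chilbert_space, 'x \<times> 'u) partial_op \<Rightarrow>
    ('x \<Rightarrow> 'z::chilbert_space) \<Rightarrow> ('x \<Rightarrow> 'z) \<Rightarrow> ('u \<Rightarrow> 'z) \<Rightarrow> ('x, 'x) partial_op"
  where "closed_loop_generator S emb Ae B =
    (let fb = (\<lambda>x v. Ae x - B v \<in> range emb \<and> v = CD S (x, - v)) in
      \<lparr>Dom = {x. \<exists>v. fb x v},
       app = (\<lambda>x. inv emb (Ae x - B (THE v. fb x v)))\<rparr>)"


section \<open>Square-integrable functions on the half-line\<close>

text \<open>
  Since the Hilbert spaces may be non-separable, measurability is strong (Bochner)
  measurability. The spaces consist of functions; equality of their elements is equality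
  almost everywhere on \<open>{0..}\<close>, and values at negative times are irrelevant.
\<close>

definition strongly_measurable :: "(real \<Rightarrow> 'a::chilbert_space) \<Rightarrow> bool"
  where "strongly_measurable f \<longleftrightarrow>
    (\<exists>s. (\<forall>n. simple_function (lebesgue_on {0..}) (s n)) \<and>
      (AE t in lebesgue_on {0..}. (\<lambda>n. s n t) \<longlonglongrightarrow> f t))"

definition L2_loc :: "(real \<Rightarrow> 'a::chilbert_space) set"
  where "L2_loc = {f. strongly_measurable f \<and>
    (\<forall>\<tau>\<ge>0. (\<integral>\<^sup>+t\<in>{0..\<tau>}. ennreal ((norm (f t))\<^sup>2) \<partial>lebesgue) < \<infinity>)}"

definition L2 :: "(real \<Rightarrow> 'a::chilbert_space) set"
  where "L2 = {f. strongly_measurable f \<and>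
    (\<integral>\<^sup>+t\<in>{0..}. ennreal ((norm (f t))\<^sup>2) \<partial>lebesgue) < \<infinity>}"

definition L2_loc_converges ::
  "(nat \<Rightarrow> real \<Rightarrow> 'a::chilbert_space) \<Rightarrow> (real \<Rightarrow> 'a) \<Rightarrow> bool"
  where "L2_loc_converges f g \<longleftrightarrow>
    (\<forall>\<tau>\<ge>0. (\<lambda>k. \<integral>\<^sup>+t\<in>{0..\<tau>}. ennreal ((norm (f k t - g t))\<^sup>2) \<partial>lebesgue) \<longlonglongrightarrow> 0)"


section \<open>Solutions and the optimal control problem\<close>

definition classical_solution ::
  "('x::chilbert_space \<times> 'u::chilbert_space, 'x \<times> 'y::chilbert_space) partial_op \<Rightarrow>
    (real \<Rightarrow> 'x) \<Rightarrow> (real \<Rightarrow> 'u) \<Rightarrow> (real \<Rightarrow> 'y) \<Rightarrow> bool"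
  where "classical_solution S x u y \<longleftrightarrow>
    continuous_on {0..} u \<and> continuous_on {0..} y \<and>
    (\<exists>x'. continuous_on {0..} x' \<and>
      (\<forall>t\<ge>0. (x has_vector_derivative x' t) (at t within {0..}) \<and>
        (x t, u t) \<in> Dom S \<and> (x' t, y t) = app S (x t, u t)))"

definition generalized_solution ::
  "('x::chilbert_space \<times> 'u::chilbert_space, 'x \<times> 'y::chilbert_space) partial_op \<Rightarrow>
    (real \<Rightarrow> 'x) \<Rightarrow> (real \<Rightarrow> 'u) \<Rightarrow> (real \<Rightarrow> 'y) \<Rightarrow> bool"
  where "generalized_solution S x u y \<longleftrightarrow>
    continuous_on {0..} x \<and> u \<in> L2_loc \<and> y \<in> L2_loc \<and>
    (\<exists>xs us ys. (\<forall>k. classical_solution S (xs k) (us k) (ys k)) \<and>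
      (\<forall>\<tau>\<ge>0. uniform_limit {0..\<tau>} xs x sequentially) \<and>
      L2_loc_converges us u \<and> L2_loc_converges ys y)"

text \<open>
  The initial state and the input determine the state on \<open>{0..}\<close> and (almost everywhere) the
  output of a generalized solution of a system node \<open>S\<close>, because \<open>S\<close> is closed and its
  semigroup generator generates a semigroup. Hence the infimum below ranges over
  at most one value; it is \<open>\<infinity>\<close> if there is no generalized solution for \<open>x0\<close> and \<open>u\<close>.
\<close>

definition cost ::
  "('x::chilbert_space \<times> 'u::chilbert_space, 'x \<times> 'y::chilbert_space) partial_op \<Rightarrow>
    'x \<Rightarrow> (real \<Rightarrow> 'u) \<Rightarrow> ennreal"
  where "cost S x0 u =
    (INF (x, y)\<in>{(x, y). generalized_solution S x u y \<and> x 0 = x0}.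
      \<integral>\<^sup>+t\<in>{0..}. ennreal ((norm (u t))\<^sup>2 + (norm (y t))\<^sup>2) \<partial>lebesgue)"

definition optimal_cost ::
  "('x::chilbert_space \<times> 'u::chilbert_space, 'x \<times> 'y::chilbert_space) partial_op \<Rightarrow>
    'x \<Rightarrow> ennreal"
  where "optimal_cost S x0 = (INF u\<in>L2. cost S x0 u)"

definition finite_cost_condition ::
  "('x::chilbert_space \<times> 'u::chilbert_space, 'x \<times> 'y::chilbert_space) partial_op \<Rightarrow> bool"
  where "finite_cost_condition S \<longleftrightarrow> (\<forall>x0. \<exists>u. cost S x0 u < \<infinity>)"

text \<open>
  The comparison is made in \<open>ereal\<close> because \<open>ennreal\<close> would truncate negative values. The
  form is real-valued as \<open>P\<close> is self-adjoint.
\<close>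

definition optimal_cost_operator ::
  "('x::chilbert_space \<times> 'u::chilbert_space, 'x \<times> 'y::chilbert_space) partial_op \<Rightarrow>
    ('x \<Rightarrow> 'x) \<Rightarrow> bool"
  where "optimal_cost_operator S P \<longleftrightarrow>
    self_adjoint P \<and> (\<forall>x0. ereal (Re (cinner x0 (P x0))) = enn2ereal (optimal_cost S x0))"

definition optimal_control ::
  "('x::chilbert_space \<times> 'u::chilbert_space, 'x \<times> 'y::chilbert_space) partial_op \<Rightarrow>
    'x \<Rightarrow> (real \<Rightarrow> 'u) \<Rightarrow> bool"
  where "optimal_control S x0 u \<longleftrightarrow> u \<in> L2 \<and> cost S x0 u = optimal_cost S x0"

definition stabilizing_control ::
  "('x::chilbert_space \<times> 'u::chilbert_space, 'x \<times> 'y::chilbert_space) partial_op \<Rightarrow>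
    'x \<Rightarrow> (real \<Rightarrow> 'u) \<Rightarrow> bool"
  where "stabilizing_control S x0 u \<longleftrightarrow>
    (\<exists>x y. generalized_solution S x u y \<and> x 0 = x0 \<and> ((\<lambda>t. norm (x t)) \<longlongrightarrow> 0) at_top)"

definition riccati_solution ::
  "('x::chilbert_space \<times> 'u::chilbert_space, 'x \<times> 'y::chilbert_space) partial_op \<Rightarrow>
    ('x \<Rightarrow> 'x) \<Rightarrow> ('x \<times> 'u \<Rightarrow> 'u) \<Rightarrow> bool"
  where "riccati_solution S P EF \<longleftrightarrow>
    self_adjoint P \<and> clinear_on (Dom S) EF \<and>
    (\<forall>(x, u)\<in>Dom S.
      cinner (AB S (x, u)) (P x) + cinner (P x) (AB S (x, u))
        + complex_of_real ((norm (CD S (x, u)))\<^sup>2) + complex_of_real ((norm u)\<^sup>2)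
      = complex_of_real ((norm (EF (x, u)))\<^sup>2))"

end

theory Submission
  imports Defs
begin

text \<open>
  The feedback \<open>u = -y\<close> turns the passivity inequality into \<open>Re \<langle>A\<^sup>K x, x\<rangle> \<le> - \<parallel>y\<parallel>\<^sup>2\<close>, so \<open>A\<^sup>K\<close> is
  dissipative; it is maximal dissipative because \<open>I + G(\<lambda>)\<close>, with the transfer function
  \<open>G(\<lambda>)\<close>, is closed and coercive, hence onto. Yosida approximation then gives classical
  closed-loop trajectories from a dense set of initial states. Integrating the dissipation
  inequality bounds their cost by \<open>\<parallel>x(0)\<parallel>\<^sup>2\<close>, and this estimate for differences yields a closed-loop
  generalized solution from every initial state. The optimal cost satisfies the parallelogram law,
  so it is a quadratic form (Jordan and von Neumann) and is represented by an operator (Riesz).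

  In the energy preserving case \<open>\<parallel>x(t)\<parallel>\<^sup>2 + \<integral>\<^sub>0\<^sup>t (\<parallel>u\<parallel>\<^sup>2 + \<parallel>y\<parallel>\<^sup>2) = \<parallel>x(0)\<parallel>\<^sup>2 + \<integral>\<^sub>0\<^sup>t \<parallel>u + y\<parallel>\<^sup>2\<close> along every
  generalized solution. Subtracting this identity for \<open>x - x\<^sub>K\<close> from that for \<open>x\<close>, where \<open>x\<^sub>K\<close> is the
  closed-loop state with the same initial value, and using \<open>x\<^sub>K(t) \<rightarrow> 0\<close>, shows that every control
  with finite cost \<open>J\<close> satisfies \<open>\<parallel>x(0)\<parallel>\<^sup>2 + \<parallel>u - u\<^sub>K\<parallel>\<^sup>2 \<le> J\<close> in \<open>L\<^sup>2\<close>.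
\<close>

section \<open>Hilbert space geometry\<close>

text \<open>Trajectories are built without a generation theorem for \<open>K\<close>: only initial
  states with both \<open>x\<close> and \<open>K x\<close> in the domain are evolved, where Yosida
  flows converge together with their velocities; contraction and density give the rest. The
  semigroup \<open>TK\<close> of the statement enters afterwards: dissipativity makes classical
  trajectories unique, so they are orbits of \<open>TK\<close>. The obstacle is the output. It is
  not a bounded function of the state, so neither its continuity nor its convergence follows from
  that of \<open>x\<close>; the dissipation inequality supplies both, as the squared norm of
  \<open>fb x\<close> is at most \<open>- inner (K x) x\<close>. Limits of outputs are limits in L^2
  of functions with values in a possibly nonseparable space, so strong measurability is secured by
  an almost everywhere convergent sequence of continuous functions. The extrapolation space leaves
  two traces: every input value occurs in \<open>Dom S\<close> together with some state, and
  \<open>closed_loop_generator\<close> is \<open>K\<close> on \<open>K_dom\<close>. The transfer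
  function is never formed as an operator; its graph inside \<open>Dom S\<close> does the
  work.\<close>

text \<open>The nearest point \<open>p\<close> of \<open>M\<close> to \<open>x\<close> exists
  because a minimizing sequence is Cauchy by the parallelogram law; \<open>z = x - p\<close> is then
  orthogonal to \<open>M\<close>, since no move along \<open>M\<close> shortens it.\<close>

lemma orthogonal_to_closed_subspace_exists:
  fixes M :: "'a::{real_inner,complete_space} set"
  assumes M: "subspace M" "closed M" and x: "x \<notin> M"
  obtains z where "z \<noteq> 0" "\<And>m. m \<in> M \<Longrightarrow> inner z m = 0"
proof -
  define d where "d = infdist x M"
  have ne: "M \<noteq> {}" using M(1) subspace_0 by blast
  have d0: "0 \<le> d" by (simp add: d_def infdist_nonneg)
  have le: "d \<le> norm (x - m)" if "m \<in> M" for m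
    using infdist_le[OF that, of x] by (simp add: d_def dist_norm)
  have "\<exists>m\<in>M. norm (x - m) < d + 1 / Suc n" for n
  proof (rule ccontr)
    assume "\<not> ?thesis"
    then have "d + 1 / Suc n \<le> dist x m" if "m \<in> M" for m
      using that by (force simp: dist_norm not_less)
    then have "d + 1 / Suc n \<le> infdist x M"
      using ne by (simp add: infdist_def cINF_greatest)
    then show False by (simp add: d_def)
  qed
  then obtain m where m: "\<And>n. m n \<in> M" "\<And>n. norm (x - m n) < d + 1 / Suc n" by metis
  \<comment> \<open>Twice the two squared distances, each at most
    \<open>d^2 + (2 d + 1) / Suc n\<close>, minus four times that of the midpoint, which lies in
    \<open>M\<close> and so is at least \<open>d\<close> away: the \<open>d^2\<close> terms cancel
    and \<open>(8 d + 4) / Suc n\<close> remains.\<close>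
  have close: "(norm (m i - m j))\<^sup>2 \<le> (8 * d + 4) / Suc n" if "n \<le> i" "n \<le> j" for i j n
  proof -
    have e: "(norm (x - m k))\<^sup>2 \<le> d\<^sup>2 + (2 * d + 1) / Suc n" if "n \<le> k" for k
    proof -
      have "1 / real (Suc k) \<le> 1 / Suc n" using that by (simp add: frac_le)
      then have "norm (x - m k) \<le> d + 1 / Suc n" using m(2)[of k] by linarith
      then have "(norm (x - m k))\<^sup>2 \<le> (d + 1 / Suc n)\<^sup>2" by (simp add: power_mono)
      also have "\<dots> = d\<^sup>2 + 2 * d / Suc n + (1 / Suc n)\<^sup>2" by (simp add: power2_sum)
      also have "(1 / real (Suc n))\<^sup>2 \<le> 1 / Suc n"
        by (simp add: power2_eq_square divide_simps)
      finally show ?thesis by (simp add: add_divide_distrib)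
    qed
    have "(1/2) *\<^sub>R (m i + m j) \<in> M" using M(1) m(1) subspace_add subspace_scale by blast
    from le[OF this] have "d\<^sup>2 \<le> (norm (x - (1/2) *\<^sub>R (m i + m j)))\<^sup>2"
      using d0 by (rule power_mono)
    moreover have "(norm (m i - m j))\<^sup>2 = 2 * (norm (x - m i))\<^sup>2 + 2 * (norm (x - m j))\<^sup>2
        - 4 * (norm (x - (1/2) *\<^sub>R (m i + m j)))\<^sup>2"
      by (simp add: power2_norm_eq_inner inner_diff_left inner_diff_right inner_add_left
          inner_add_right inner_commute algebra_simps)
    ultimately show ?thesis using e[OF that(1)] e[OF that(2)] by (simp add: add_divide_distrib)
  qed
  have "Cauchy m"
  proof (rule metric_CauchyI)
    fix e :: real assume e: "e > 0"
    obtain n where n: "(8 * d + 4) / e\<^sup>2 < real n" using reals_Archimedean2 by blast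
    have "dist (m i) (m j) < e" if "i \<ge> n" "j \<ge> n" for i j
    proof -
      have "(8 * d + 4) / Suc n < e\<^sup>2"
        using n e by (simp add: field_simps) (smt (verit) e zero_less_power)
      with close[OF that] have "(norm (m i - m j))\<^sup>2 < e\<^sup>2" by linarith
      then show ?thesis using e by (simp add: dist_norm power2_less_imp_less)
    qed
    then show "\<exists>N. \<forall>i\<ge>N. \<forall>j\<ge>N. dist (m i) (m j) < e" by blast
  qed
  then obtain p where p: "m \<longlonglongrightarrow> p" using Cauchy_convergent convergent_def by blast
  have pM: "p \<in> M" using M(2) m(1) p closed_sequentially by blast
  have "norm (x - p) \<le> d"
  proof (rule LIMSEQ_le)
    show "(\<lambda>n. norm (x - m n)) \<longlonglongrightarrow> norm (x - p)" by (intro tendsto_intros p)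
    show "(\<lambda>n. d + 1 / Suc n) \<longlonglongrightarrow> d"
      using LIMSEQ_inverse_real_of_nat_add[of d] by (simp add: inverse_eq_divide)
    show "\<exists>N. \<forall>n\<ge>N. norm (x - m n) \<le> d + 1 / real (Suc n)" using m(2) less_imp_le by blast
  qed
  define z where "z = x - p"
  have min: "norm z \<le> norm (z - y)" if "y \<in> M" for y
    using le[of "p + y"] subspace_add[OF M(1) pM that] \<open>norm (x - p) \<le> d\<close>
    by (simp add: z_def diff_diff_eq)
  have "inner z y = 0" if "y \<in> M" for y
  proof (cases "y = 0")
    case False
    \<comment> \<open>The minimizer of \<open>norm (z - t y)\<close>; for it the minimality of
      \<open>z\<close> becomes \<open>(inner z y)^2 / inner y y \<le> 0\<close>.\<close>
    define t where "t = inner z y / inner y y"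
    have "(norm z)\<^sup>2 \<le> (norm (z - t *\<^sub>R y))\<^sup>2"
      using min[of "t *\<^sub>R y"] subspace_scale[OF M(1) that] by (simp add: power_mono)
    also have "\<dots> = (norm z)\<^sup>2 - 2 * t * inner z y + t * (t * inner y y)"
      by (simp add: power2_norm_eq_inner inner_diff_left inner_diff_right inner_commute)
    also have "t * inner y y = inner z y" using False by (simp add: t_def)
    finally have "t * inner z y \<le> 0" by simp
    then have "(inner z y)\<^sup>2 \<le> 0" using False
      by (simp add: t_def power2_eq_square divide_le_0_iff) (smt (verit) inner_gt_zero_iff)
    then show ?thesis by simp
  qed simp
  moreover have "z \<noteq> 0" using x pM by (auto simp: z_def)
  ultimately show ?thesis using that by blast
qed

lemma subspace_closure:
  fixes M :: "'a::real_normed_vector set"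
  assumes "subspace M"
  shows "subspace (closure M)"
proof (rule subspaceI)
  show "0 \<in> closure M" using subspace_0[OF assms] closure_subset by blast
  fix x y c assume "x \<in> closure M"
  then obtain f where f: "\<And>n. f n \<in> M" "f \<longlonglongrightarrow> x" unfolding closure_sequential by blast
  show "c *\<^sub>R x \<in> closure M"
    unfolding closure_sequential
    by (rule exI[of _ "\<lambda>n. c *\<^sub>R f n"]) (use f assms in \<open>auto intro: tendsto_intros subspace_scale\<close>)
  assume "y \<in> closure M"
  then obtain g where g: "\<And>n. g n \<in> M" "g \<longlonglongrightarrow> y" unfolding closure_sequential by blast
  show "x + y \<in> closure M"
    unfolding closure_sequential
    by (rule exI[of _ "\<lambda>n. f n + g n"]) (use f g assms in \<open>auto intro: tendsto_intros subspace_add\<close>)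
qed

lemma dense_subspaceI:
  fixes M :: "'a::{real_inner,complete_space} set"
  assumes M: "subspace M" and orth: "\<And>z. (\<And>m. m \<in> M \<Longrightarrow> inner z m = 0) \<Longrightarrow> z = 0"
  shows "closure M = UNIV"
proof (rule ccontr)
  assume "closure M \<noteq> UNIV"
  then obtain x where "x \<notin> closure M" by blast
  then obtain z where "z \<noteq> 0" "\<And>m. m \<in> closure M \<Longrightarrow> inner z m = 0"
    using orthogonal_to_closed_subspace_exists[of "closure M"] subspace_closure[OF M]
    by (metis closed_closure)
  then show False using orth closure_subset by blast
qed

text \<open>For \<open>z\<close> orthogonal to the kernel, \<open>f z x - f x z\<close> lies in the
  kernel for every \<open>x\<close>; its inner product with \<open>z\<close> isolates
  \<open>f x\<close>.\<close>

lemma riesz_representation: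
  fixes f :: "'a::{real_inner,complete_space} \<Rightarrow> real"
  assumes "bounded_linear f"
  obtains p where "\<And>x. f x = inner p x"
proof (cases "\<forall>x. f x = 0")
  case True
  then show ?thesis using that[of 0] by simp
next
  case False
  interpret f: bounded_linear f by fact
  let ?K = "{x. f x = 0}"
  have "subspace ?K" by (simp add: subspace_def f.add f.scaleR f.zero)
  moreover have "closed ?K"
    by (rule closed_Collect_eq) (simp_all add: f.continuous_on)
  moreover obtain y where "y \<notin> ?K" using False by blast
  ultimately obtain z where z: "z \<noteq> 0" "\<And>m. m \<in> ?K \<Longrightarrow> inner z m = 0"
    using orthogonal_to_closed_subspace_exists by blast
  have "f x = inner ((f z / inner z z) *\<^sub>R z) x" for x
  proof -
    have "f (f z *\<^sub>R x - f x *\<^sub>R z) = 0" by (simp add: f.diff f.scaleR)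
    then have "inner z (f z *\<^sub>R x - f x *\<^sub>R z) = 0" by (simp add: z(2))
    then show ?thesis using z(1) by (simp add: inner_diff_right field_simps)
  qed
  then show ?thesis using that by blast
qed

section \<open>Linear evolution equations\<close>

text \<open>Serves the exponential series and the limit of the Yosida flows. The general theorem on
  sequences yields some differentiable limit \<open>H\<close>; pointwise convergence identifies it
  with \<open>F\<close>.\<close>

lemma has_vector_derivative_uniform_limit:
  fixes f :: "nat \<Rightarrow> real \<Rightarrow> 'a::banach"
  assumes "convex S"
    and f: "\<And>n t. t \<in> S \<Longrightarrow> (f n has_vector_derivative g n t) (at t within S)"
    and g: "uniform_limit S g G sequentially"
    and F: "\<And>t. t \<in> S \<Longrightarrow> (\<lambda>n. f n t) \<longlonglongrightarrow> F t"
    and "t \<in> S"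
  shows "(F has_vector_derivative G t) (at t within S)"
proof -
  have "\<exists>H. \<forall>t\<in>S. (\<lambda>n. f n t) \<longlonglongrightarrow> H t \<and> (H has_derivative (\<lambda>h. h *\<^sub>R G t)) (at t within S)"
  proof (rule has_derivative_sequence[OF \<open>convex S\<close>, where f'="\<lambda>n t h. h *\<^sub>R g n t"])
    show "(f n has_derivative (\<lambda>h. h *\<^sub>R g n t)) (at t within S)" if "t \<in> S" for n t
      using f[OF that] by (simp add: has_vector_derivative_def)
    show "t \<in> S" "(\<lambda>n. f n t) \<longlonglongrightarrow> F t" using \<open>t \<in> S\<close> F by auto
    fix e :: real assume "e > 0"
    from uniform_limitD[OF g this]
    show "\<forall>\<^sub>F n in sequentially. \<forall>t\<in>S. \<forall>h. norm (h *\<^sub>R g n t - h *\<^sub>R G t) \<le> e * norm h"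
    proof eventually_elim
      case (elim n)
      show ?case
      proof (intro ballI allI)
        fix t h assume "t \<in> S"
        then have "norm (g n t - G t) \<le> e" using elim by (simp add: dist_norm less_imp_le)
        then have "\<bar>h\<bar> * norm (g n t - G t) \<le> \<bar>h\<bar> * e" by (simp add: mult_left_mono)
        then show "norm (h *\<^sub>R g n t - h *\<^sub>R G t) \<le> e * norm h"
          by (simp flip: scaleR_diff_right add: mult.commute)
      qed
    qed
  qed
  then obtain H where H: "\<And>t. t \<in> S \<Longrightarrow> (\<lambda>n. f n t) \<longlonglongrightarrow> H t"
    "\<And>t. t \<in> S \<Longrightarrow> (H has_vector_derivative G t) (at t within S)"
    by (auto simp: has_vector_derivative_def)
  have "F s = H s" if "s \<in> S" for s using F H(1) that LIMSEQ_unique by blast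
  then show ?thesis using H(2)[OF \<open>t \<in> S\<close>] \<open>t \<in> S\<close> has_vector_derivative_transform by blast
qed

text \<open>The solution is the exponential series \<open>exp (t L) x\<close>, differentiated term
  by term.\<close>

lemma bounded_linear_evolution_exists:
  fixes L :: "'a::banach \<Rightarrow> 'a"
  assumes "bounded_linear L"
  obtains u where "u 0 = x" "\<And>t. (u has_vector_derivative L (u t)) (at t)"
proof -
  interpret L: bounded_linear L by fact
  obtain K where K: "0 < K" "\<And>x. norm (L x) \<le> norm x * K" using L.pos_bounded by blast
  define c where "c n t = (t ^ n / fact n) *\<^sub>R (L ^^ n) x" for n and t :: real
  have Ln: "norm ((L ^^ n) x) \<le> norm x * K ^ n" for n
  proof (induction n)
    case (Suc n)
    have "norm ((L ^^ Suc n) x) \<le> norm ((L ^^ n) x) * K" using K(2) by simp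
    also have "\<dots> \<le> norm x * K ^ n * K" using Suc K(1) by (simp add: mult_right_mono)
    finally show ?case by (simp add: ac_simps)
  qed simp
  define u where "u t = (\<Sum>n. c n t)" for t
  have unif: "uniform_limit {-R..R} (\<lambda>N t. \<Sum>n<N. c n t) u sequentially" for R
    unfolding u_def
  proof (rule Weierstrass_m_test)
    show "summable (\<lambda>n. norm x * (inverse (fact n) *\<^sub>R (R * K) ^ n))"
      by (rule summable_mult) (rule summable_exp_generic)
    fix n t assume t: "t \<in> {-R..R}"
    have "\<bar>t\<bar> ^ n \<le> R ^ n" using t by (intro power_mono) auto
    then have "\<bar>t\<bar> ^ n * norm ((L ^^ n) x) \<le> R ^ n * (norm x * K ^ n)"
      using Ln t by (intro mult_mono) auto
    then have "\<bar>t\<bar> ^ n * norm ((L ^^ n) x) / fact n \<le> R ^ n * (norm x * K ^ n) / fact n"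
      by (simp add: divide_right_mono)
    then show "norm (c n t) \<le> norm x * (inverse (fact n) *\<^sub>R (R * K) ^ n)"
      by (simp add: c_def power_abs power_mult_distrib field_simps)
  qed
  \<comment> \<open>The constant term drops out under differentiation, which shifts the index: hence
    \<open>Suc N\<close> terms on the left and \<open>N\<close> on the right.\<close>
  have deriv: "((\<lambda>t. \<Sum>n<Suc N. c n t) has_vector_derivative L (\<Sum>n<N. c n t)) (at t within S)" for N t S
  proof -
    have "(c (Suc n) has_vector_derivative L (c n t)) (at t within S)" for n
    proof -
      have "((\<lambda>t. t ^ Suc n / fact (Suc n)) has_real_derivative
          (real (Suc n) * t ^ (Suc n - Suc 0)) / fact (Suc n)) (at t within S)"
        by (rule DERIV_cdivide) (rule DERIV_pow)
      also have "(real (Suc n) * t ^ (Suc n - Suc 0)) / fact (Suc n) = t ^ n / fact n"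
        by (simp add: fact_Suc del: of_nat_Suc)
      finally show ?thesis
        unfolding c_def L.scaleR funpow.simps comp_def has_real_derivative_iff_has_vector_derivative
        by (rule bounded_linear.has_vector_derivative[OF bounded_linear_scaleR_left])
    qed
    moreover have "c 0 = (\<lambda>_. x)" by (simp add: c_def fun_eq_iff)
    then have "(c 0 has_vector_derivative 0) (at t within S)" by simp
    ultimately show ?thesis
      unfolding sum.lessThan_Suc_shift L.sum
      by (auto intro!: derivative_eq_intros has_vector_derivative_sum)
  qed
  have "(u has_vector_derivative L (u t)) (at t)" for t
  proof -
    define R where "R = \<bar>t\<bar> + 1"
    have Rt: "t \<in> {-R<..<R}" by (auto simp: R_def)
    have "(u has_vector_derivative L (u t)) (at t within {-R..R})"
    proof (rule has_vector_derivative_uniform_limit)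
      show "uniform_limit {-R..R} (\<lambda>N t. L (\<Sum>n<N. c n t)) (\<lambda>t. L (u t)) sequentially"
        by (rule L.uniform_limit[OF unif])
      show "((\<lambda>t. \<Sum>n<Suc N. c n t) has_vector_derivative L (\<Sum>n<N. c n t)) (at t within {-R..R})"
        for N t by (rule deriv)
      show "(\<lambda>N. \<Sum>n<Suc N. c n s) \<longlonglongrightarrow> u s" if "s \<in> {-R..R}" for s
        using tendsto_uniform_limitI[OF unif that] by (rule LIMSEQ_Suc)
    qed (use Rt in auto)
    then show ?thesis using Rt at_within_interior[of t "{-R..R}"] by (simp add: interior_atLeastAtMost_real)
  qed
  moreover have "u 0 = x"
  proof -
    have "u 0 = (\<Sum>n\<in>{0}. c n 0)"
      unfolding u_def by (rule suminf_finite) (auto simp: c_def)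
    then show ?thesis by (simp add: c_def)
  qed
  ultimately show ?thesis using that by blast
qed

lemma at_within_atLeastAtMost_eq:
  fixes t :: real
  assumes "t < R"
  shows "at t within {a..R} = at t within {a..}"
  by (rule at_within_nhd[of t "{..<R}"]) (use assms in auto)

text \<open>The derivative of the squared norm is \<open>2 inner (q t) (p t)\<close>, so the squared
  norm minus \<open>2 c t\<close> is nonincreasing. The case \<open>c = 0\<close> expresses
  contraction by a dissipative flow.\<close>

lemma norm_growth_bound:
  fixes p :: "real \<Rightarrow> 'a::real_inner"
  assumes deriv: "\<And>t. t \<ge> 0 \<Longrightarrow> (p has_vector_derivative q t) (at t within {0..})"
    and le: "\<And>t. t \<ge> 0 \<Longrightarrow> inner (q t) (p t) \<le> c" and "t \<ge> 0"
  shows "(norm (p t))\<^sup>2 \<le> (norm (p 0))\<^sup>2 + 2 * c * t"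
proof -
  let ?\<phi> = "\<lambda>t. inner (p t) (p t) - 2 * c * t"
  have d: "(?\<phi> has_vector_derivative 2 * inner (q t) (p t) - 2 * c) (at t within {0..})" if "t \<ge> 0" for t
    by (rule derivative_eq_intros bounded_bilinear.has_vector_derivative[OF bounded_bilinear_inner]
        deriv[OF that] | simp add: inner_commute)+
  have "?\<phi> t \<le> ?\<phi> 0"
  proof (rule DERIV_nonpos_imp_decreasing_open[OF \<open>t \<ge> 0\<close>])
    fix s assume s: "0 < s" "s < t"
    then have "at s within {0..} = at s" by (intro at_within_interior) auto
    then have "(?\<phi> has_real_derivative 2 * inner (q s) (p s) - 2 * c) (at s)"
      using d[of s] s by (simp add: has_real_derivative_iff_has_vector_derivative)
    moreover have "2 * inner (q s) (p s) - 2 * c \<le> 0" using le[of s] s by simp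
    ultimately show "\<exists>y. (?\<phi> has_real_derivative y) (at s) \<and> y \<le> 0" by blast
  next
    have "continuous_on {0..} ?\<phi>"
      using d by (auto simp: continuous_on_eq_continuous_within intro!: has_vector_derivative_continuous)
    then show "continuous_on {0..t} ?\<phi>" by (rule continuous_on_subset) auto
  qed
  then show ?thesis by (simp add: power2_norm_eq_inner)
qed

text \<open>The hypothesis has the shape that comparing two Yosida flows produces. Initial values
  are only Cauchy, because the velocities of these flows start from varying points.\<close>

lemma uniform_limit_of_growth_bound:
  fixes f :: "nat \<Rightarrow> real \<Rightarrow> 'a::banach"
  assumes bound: "\<And>m n t. t \<ge> 0 \<Longrightarrow> (norm (f m t - f n t))\<^sup>2 \<le>
      (norm (f m 0 - f n 0))\<^sup>2 + K * t * (1 / Suc m + 1 / Suc n)"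
    and "Cauchy (\<lambda>n. f n 0)" and "K \<ge> 0"
  obtains F where "\<And>R. uniform_limit {0..R} f F sequentially"
proof -
  have "uniformly_Cauchy_on {0..R} f" for R
  proof (rule uniformly_Cauchy_onI)
    fix e :: real assume e: "e > 0"
    obtain M where M: "\<And>m n. m \<ge> M \<Longrightarrow> n \<ge> M \<Longrightarrow> norm (f m 0 - f n 0) < e / 2"
      using CauchyD[OF \<open>Cauchy (\<lambda>n. f n 0)\<close>, of "e / 2"] e by auto
    \<comment> \<open>The allowance \<open>e^2\<close> is split: a quarter for the initial
      difference, half for the growth term, which is at most \<open>2 K R / Suc N\<close>.\<close>
    obtain N where N: "2 * K * R / e\<^sup>2 * 2 < real N" using reals_Archimedean2 by blast
    have "dist (f m t) (f n t) < e" if t: "t \<in> {0..R}" and mn: "m \<ge> max M N" "n \<ge> max M N" for t m n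
    proof -
      have "(norm (f m 0 - f n 0))\<^sup>2 < (e / 2)\<^sup>2"
        using M[of m n] mn by (intro power_strict_mono) auto
      moreover have "K * t * (1 / Suc m + 1 / Suc n) \<le> e\<^sup>2 / 2"
      proof -
        have "1 / real (Suc m) \<le> 1 / Suc N" "1 / real (Suc n) \<le> 1 / Suc N"
          using mn by (auto simp: frac_le)
        then have "1 / real (Suc m) + 1 / Suc n \<le> 2 / Suc N" by simp
        moreover have "K * t \<le> K * R" using t \<open>K \<ge> 0\<close> by (simp add: mult_left_mono)
        moreover have "0 \<le> K * R" using t \<open>K \<ge> 0\<close> by simp
        ultimately have "K * t * (1 / Suc m + 1 / Suc n) \<le> K * R * (2 / Suc N)"
          using t \<open>K \<ge> 0\<close> by (intro mult_mono) auto
        also have "\<dots> \<le> e\<^sup>2 / 2"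
        proof -
          have "4 * (K * R) < real N * e\<^sup>2" using N e by (simp add: field_simps)
          also have "\<dots> \<le> real (Suc N) * e\<^sup>2" by (simp add: mult_right_mono)
          finally show ?thesis by (simp add: field_simps)
        qed
        finally show ?thesis .
      qed
      ultimately have "(norm (f m t - f n t))\<^sup>2 < e\<^sup>2"
        using bound[of t m n] t e by (simp add: power_divide) (smt (verit) zero_less_power)
      then show ?thesis using e by (simp add: dist_norm power2_less_imp_less)
    qed
    then show "\<exists>M. \<forall>x\<in>{0..R}. \<forall>m\<ge>M. \<forall>n\<ge>M. dist (f m x) (f n x) < e" by blast
  qed
  then have "uniform_limit {0..R} f (\<lambda>t. lim (\<lambda>n. f n t)) sequentially" for R
    using Cauchy_uniformly_convergent uniformly_convergent_uniform_limit_iff by blast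
  then show ?thesis using that by blast
qed

section \<open>Maximal dissipative operators\<close>

text \<open>An operator given by a domain and a total function, with real scalars. Surjectivity is
  required for large \<open>lam\<close>, which is what is available for the closed loop; the sign of
  \<open>lam0\<close> is open, whence \<open>max lam0 0\<close> below.\<close>

locale maximal_dissipative =
  fixes D :: "'a::{real_inner,banach} set" and A :: "'a \<Rightarrow> 'a" and lam0 :: real
  assumes subspace_D: "subspace D"
    and add: "x \<in> D \<Longrightarrow> y \<in> D \<Longrightarrow> A (x + y) = A x + A y"
    and scale: "x \<in> D \<Longrightarrow> A (r *\<^sub>R x) = r *\<^sub>R A x"
    and dissipative: "x \<in> D \<Longrightarrow> inner (A x) x \<le> 0"
    and range_eq: "lam > lam0 \<Longrightarrow> \<exists>x\<in>D. lam *\<^sub>R x - A x = y"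
begin

lemma diff: "x \<in> D \<Longrightarrow> y \<in> D \<Longrightarrow> A (x - y) = A x - A y"
  using add[of x "(-1) *\<^sub>R y"] scale[of y "-1"] subspace_scale[OF subspace_D, of y "-1"] by simp

lemma norm_le_resolvent:
  assumes "x \<in> D" "lam > 0"
  shows "lam * norm x \<le> norm (lam *\<^sub>R x - A x)"
proof (cases "x = 0")
  case False
  have "lam * (norm x * norm x) \<le> inner (lam *\<^sub>R x - A x) x"
    using dissipative[OF assms(1)] by (simp add: inner_diff_left norm_eq_sqrt_inner)
  also have "\<dots> \<le> norm (lam *\<^sub>R x - A x) * norm x" by (rule norm_cauchy_schwarz)
  finally show ?thesis using False by (simp flip: mult.assoc)
qed simp

text \<open>Solve the resolvent equation for the limit of the right-hand sides: the resolvent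
  estimate forces \<open>xs\<close> to converge to that solution, which must then be
  \<open>x\<close>.\<close>

lemma closed_graph:
  assumes xs: "\<And>n. xs n \<in> D" "xs \<longlonglongrightarrow> x" "(\<lambda>n. A (xs n)) \<longlonglongrightarrow> y"
  shows "x \<in> D" "A x = y"
proof -
  define lam where "lam = max lam0 0 + 1"
  have lam: "lam > lam0" "lam > 0" by (auto simp: lam_def)
  obtain z where z: "z \<in> D" "lam *\<^sub>R z - A z = lam *\<^sub>R x - y" using range_eq[OF lam(1)] by blast
  have "(\<lambda>n. (lam *\<^sub>R xs n - A (xs n)) - (lam *\<^sub>R x - y)) \<longlonglongrightarrow> (lam *\<^sub>R x - y) - (lam *\<^sub>R x - y)"
    by (intro tendsto_intros xs)
  then have "(\<lambda>n. norm ((lam *\<^sub>R xs n - A (xs n)) - (lam *\<^sub>R x - y)) / lam) \<longlonglongrightarrow> 0"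
    by (intro tendsto_divide_zero tendsto_norm_zero) simp
  moreover have "norm (xs n - z) \<le> norm ((lam *\<^sub>R xs n - A (xs n)) - (lam *\<^sub>R x - y)) / lam" for n
    using norm_le_resolvent[of "xs n - z" lam] lam xs(1)[of n] z subspace_diff[OF subspace_D]
    by (simp add: diff field_simps flip: z(2))
  ultimately have "(\<lambda>n. xs n - z) \<longlonglongrightarrow> 0"
    by (rule Lim_null_comparison[OF always_eventually[OF allI], rotated])
  then have "xs \<longlonglongrightarrow> z" by (simp add: LIM_zero_iff)
  then have "z = x" using xs(2) LIMSEQ_unique by blast
  with z show "x \<in> D" "A x = y" by auto
qed

text \<open>This is \<open>lam (lam - A)^-1\<close>, scaled so as to be a contraction that tends to
  the identity on \<open>D\<close>.\<close>

definition J :: "real \<Rightarrow> 'a \<Rightarrow> 'a"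
  where "J lam y = (SOME x. x \<in> D \<and> lam *\<^sub>R x - A x = lam *\<^sub>R y)"

text \<open>The Yosida approximation, written without \<open>A\<close> so that boundedness is
  immediate; \<open>yosida_eq\<close> identifies it with \<open>A (J lam y)\<close>.\<close>

definition yosida :: "real \<Rightarrow> 'a \<Rightarrow> 'a"
  where "yosida lam y = lam *\<^sub>R (J lam y - y)"

context
  fixes lam :: real
  assumes lam: "lam > lam0" "lam > 0"
begin

lemma J_resolvent: "J lam y \<in> D \<and> lam *\<^sub>R J lam y - A (J lam y) = lam *\<^sub>R y"
  unfolding J_def by (rule someI_ex) (use range_eq[OF lam(1)] in blast)

lemma J_in_D: "J lam y \<in> D" and J_eq: "lam *\<^sub>R J lam y - A (J lam y) = lam *\<^sub>R y"
  using J_resolvent by auto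

lemma yosida_eq: "yosida lam y = A (J lam y)"
  using J_eq[of y] by (simp add: yosida_def algebra_simps)

lemma J_unique:
  assumes "x \<in> D" "lam *\<^sub>R x - A x = lam *\<^sub>R y"
  shows "J lam y = x"
proof -
  have "lam *\<^sub>R (J lam y - x) - A (J lam y - x) = 0"
    using assms J_eq[of y] by (simp add: diff[OF J_in_D assms(1)] algebra_simps)
  then have "lam * norm (J lam y - x) \<le> 0"
    using norm_le_resolvent[of "J lam y - x" lam] lam subspace_diff[OF subspace_D J_in_D assms(1)] by simp
  then show ?thesis using lam by (simp add: mult_le_0_iff)
qed

lemma norm_J: "norm (J lam y) \<le> norm y"
  using norm_le_resolvent[OF J_in_D[of y] lam(2)] lam by (simp add: J_eq)

lemma bounded_linear_J: "bounded_linear (J lam)"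
proof (rule bounded_linear_intro[where K=1])
  show "J lam (x + y) = J lam x + J lam y" for x y
    by (rule J_unique)
      (use J_in_D J_eq[of x] J_eq[of y] subspace_add[OF subspace_D] in
        \<open>auto simp: add[OF J_in_D J_in_D] algebra_simps\<close>)
  show "J lam (r *\<^sub>R x) = r *\<^sub>R J lam x" for r x
  proof (rule J_unique)
    have "lam *\<^sub>R r *\<^sub>R J lam x - A (r *\<^sub>R J lam x) = r *\<^sub>R (lam *\<^sub>R J lam x - A (J lam x))"
      by (simp add: scale[OF J_in_D] scaleR_diff_right)
    then show "lam *\<^sub>R r *\<^sub>R J lam x - A (r *\<^sub>R J lam x) = lam *\<^sub>R r *\<^sub>R x" by (simp add: J_eq)
  qed (simp add: subspace_scale[OF subspace_D J_in_D])
qed (simp add: norm_J)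

lemma bounded_linear_yosida: "bounded_linear (yosida lam)"
  unfolding yosida_def
  by (intro bounded_linear_intros bounded_linear_J)

lemma yosida_dissipative: "inner (yosida lam y) (J lam y) \<le> 0" 
  unfolding yosida_eq by (rule dissipative[OF J_in_D])

text \<open>Since \<open>y\<close> is \<open>J lam y\<close> minus
  \<open>yosida lam y / lam\<close>, passing from \<open>J lam y\<close> to \<open>y\<close>
  subtracts a nonnegative multiple of a squared norm.\<close>

lemma yosida_dissipative': "inner (yosida lam y) y \<le> 0"
proof -
  have "y = J lam y - (1 / lam) *\<^sub>R yosida lam y" using lam by (simp add: yosida_def)
  then have "inner (yosida lam y) y = inner (yosida lam y) (J lam y) - (1 / lam) * inner (yosida lam y) (yosida lam y)"
    by (metis inner_diff_right inner_scaleR_right)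
  moreover have "0 \<le> (1 / lam) * inner (yosida lam y) (yosida lam y)" using lam by simp
  ultimately show ?thesis using yosida_dissipative[of y] by linarith
qed

text \<open>On \<open>D\<close> the operator commutes with its resolvent, which is read off from
  uniqueness in the resolvent equation. This bounds the approximations uniformly in
  \<open>lam\<close>.\<close>

lemma yosida_on_D: "x \<in> D \<Longrightarrow> yosida lam x = J lam (A x)"
proof (rule J_unique[symmetric])
  assume x: "x \<in> D"
  then have d: "J lam x - x \<in> D" by (simp add: subspace_diff[OF subspace_D J_in_D])
  then show "yosida lam x \<in> D" by (simp add: yosida_def subspace_scale[OF subspace_D])
  show "lam *\<^sub>R yosida lam x - A (yosida lam x) = lam *\<^sub>R A x"
  proof -
    have "A (yosida lam x) = lam *\<^sub>R (A (J lam x) - A x)"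
      unfolding yosida_def by (simp add: d x scale diff J_in_D)
    then have "A (yosida lam x) = lam *\<^sub>R (yosida lam x - A x)"
      by (simp add: yosida_eq)
    then show ?thesis by (simp add: algebra_simps)
  qed
qed

lemma norm_yosida_on_D: "x \<in> D \<Longrightarrow> norm (yosida lam x) \<le> norm (A x)"
  by (simp add: yosida_on_D norm_J)

lemma norm_J_diff: "x \<in> D \<Longrightarrow> norm (J lam x - x) \<le> norm (A x) / lam"
  using norm_yosida_on_D[of x] lam by (simp add: yosida_def pos_le_divide_eq mult.commute)

lemma yosida_J_commute: "yosida lam (J lam x) = J lam (yosida lam x)"
proof -
  interpret bounded_linear "J lam" by (rule bounded_linear_J)
  show ?thesis by (simp add: yosida_def scaleR diff)
qed

end

lemma J_tendsto:
  assumes "x \<in> D"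
  shows "(\<lambda>n. J (max lam0 0 + Suc n) x) \<longlonglongrightarrow> x"
proof -
  have "norm (J (max lam0 0 + Suc n) x - x) \<le> norm (A x) * (1 / Suc n)" for n
  proof -
    have "norm (J (max lam0 0 + Suc n) x - x) \<le> norm (A x) / (max lam0 0 + Suc n)"
      by (rule norm_J_diff) (use assms in auto)
    also have "\<dots> \<le> norm (A x) / Suc n" by (rule divide_left_mono) auto
    finally show ?thesis by simp
  qed
  moreover have "(\<lambda>n. norm (A x) * (1 / Suc n)) \<longlonglongrightarrow> 0"
    by (rule tendsto_mult_right_zero[OF LIMSEQ_Suc[OF lim_1_over_n]])
  ultimately have "(\<lambda>n. J (max lam0 0 + Suc n) x - x) \<longlonglongrightarrow> 0"
    by (rule Lim_null_comparison[OF always_eventually[OF allI]])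
  then show ?thesis by (simp add: LIM_zero_iff)
qed

text \<open>If \<open>z\<close> is orthogonal to \<open>D\<close>, solve
  \<open>lam x - A x = z\<close>: pairing with \<open>x\<close> gives
  \<open>lam inner x x \<le> 0\<close>, so \<open>x\<close> and \<open>z\<close> vanish.\<close>

lemma dense_D: "closure D = UNIV"
proof (rule dense_subspaceI[OF subspace_D])
  fix z assume orth: "\<And>m. m \<in> D \<Longrightarrow> inner z m = 0"
  define lam where "lam = max lam0 0 + 1"
  have lam: "lam > lam0" "lam > 0" by (auto simp: lam_def)
  obtain x where x: "x \<in> D" "lam *\<^sub>R x - A x = z" using range_eq[OF lam(1)] by blast
  have "lam * inner x x \<le> inner z x" using dissipative[OF x(1)] by (simp add: inner_diff_left flip: x(2))
  then have "inner x x \<le> 0" using orth[OF x(1)] lam by (simp add: mult_le_0_iff)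
  then have "x = 0" by (metis inner_eq_zero_iff inner_ge_zero order_antisym)
  then show "z = 0" using x scale[of 0 0] subspace_0[OF subspace_D] by simp
qed

text \<open>For \<open>x\<close> in \<open>D\<close> the vectors \<open>J lam x\<close> approximate
  \<open>x\<close>, and \<open>A (J lam x) = lam (J lam x - x)\<close> stays in \<open>D\<close>.
  These are the initial states that \<open>evolution_exists\<close> can handle.\<close>

lemma dense_D2: "closure {x \<in> D. A x \<in> D} = UNIV"
proof -
  have "D \<subseteq> closure {x \<in> D. A x \<in> D}"
  proof
    fix x assume x: "x \<in> D"
    have "J (max lam0 0 + Suc n) x \<in> {x \<in> D. A x \<in> D}" for n
    proof -
      have l: "max lam0 0 + Suc n > lam0" "max lam0 0 + Suc n > 0" by auto
      have "yosida (max lam0 0 + Suc n) x \<in> D"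
        using J_in_D[OF l] x by (simp add: yosida_def subspace_scale subspace_diff subspace_D)
      then show ?thesis using J_in_D[OF l] yosida_eq[OF l] by simp
    qed
    then show "x \<in> closure {x \<in> D. A x \<in> D}"
      unfolding closure_sequential
      by (intro exI[of _ "\<lambda>n. J (max lam0 0 + Suc n) x"] conjI allI J_tendsto[OF x])
  qed
  then have "closure D \<subseteq> closure {x \<in> D. A x \<in> D}" by (simp add: closure_minimal)
  then show ?thesis using dense_D by auto
qed

section \<open>Yosida flows and their limit\<close>

lemma yosida_evolution_norm_le:
  assumes lam: "lam > lam0" "lam > 0"
    and u: "\<And>t. (u has_vector_derivative yosida lam (u t)) (at t)" and "t \<ge> 0"
  shows "norm (u t) \<le> norm (u 0)"
proof -
  have "(norm (u t))\<^sup>2 \<le> (norm (u 0))\<^sup>2 + 2 * 0 * t"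
    by (rule norm_growth_bound[where q="\<lambda>t. yosida lam (u t)"])
      (use u yosida_dissipative'[OF lam] \<open>t \<ge> 0\<close> in \<open>auto intro: has_vector_derivative_at_within\<close>)
  then show ?thesis by simp
qed

text \<open>Replacing \<open>u\<close> and \<open>w\<close> by their images under \<open>J\<close>
  makes the inner product nonpositive, by dissipativity of \<open>A\<close>; the error consists of
  velocities divided by \<open>lam\<close> or \<open>mu\<close>. No commutation of the two
  approximations is involved.\<close>

lemma yosida_evolution_compare:
  assumes lam: "lam > lam0" "lam > 0" and mu: "mu > lam0" "mu > 0"
    and u: "\<And>t. (u has_vector_derivative yosida lam (u t)) (at t)"
    and w: "\<And>t. (w has_vector_derivative yosida mu (w t)) (at t)"
    and C: "norm (yosida lam (u 0)) \<le> C" "norm (yosida mu (w 0)) \<le> C" and "t \<ge> 0"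
  shows "(norm (u t - w t))\<^sup>2 \<le> (norm (u 0 - w 0))\<^sup>2 + 4 * C\<^sup>2 * t * (1 / lam + 1 / mu)"
proof -
  have bound: "inner (yosida lam (u t) - yosida mu (w t)) (u t - w t) \<le> 2 * C\<^sup>2 * (1 / lam + 1 / mu)"
    if "t \<ge> 0" for t
  proof -
    let ?a = "yosida lam (u t)" and ?b = "yosida mu (w t)"
    let ?c = "(1 / lam) *\<^sub>R ?a - (1 / mu) *\<^sub>R ?b"
    \<comment> \<open>The velocity of the flow solves the same linear equation, so its norm never
      exceeds the initial one.\<close>
    have a: "norm ?a \<le> C"
      using yosida_evolution_norm_le[OF lam, of "\<lambda>t. yosida lam (u t)" t] that C(1)
        bounded_linear.has_vector_derivative[OF bounded_linear_yosida[OF lam] u] by fastforce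
    have b: "norm ?b \<le> C"
      using yosida_evolution_norm_le[OF mu, of "\<lambda>t. yosida mu (w t)" t] that C(2)
        bounded_linear.has_vector_derivative[OF bounded_linear_yosida[OF mu] w] by fastforce
    have "inner (?a - ?b) (J lam (u t) - J mu (w t)) \<le> 0"
      unfolding yosida_eq[OF lam] yosida_eq[OF mu]
      using dissipative[of "J lam (u t) - J mu (w t)"] J_in_D[OF lam] J_in_D[OF mu]
      by (simp add: diff subspace_diff[OF subspace_D])
    moreover have "u t - w t = (J lam (u t) - J mu (w t)) - ?c"
      using lam mu by (simp add: yosida_def)
    then have "inner (?a - ?b) (u t - w t) = inner (?a - ?b) (J lam (u t) - J mu (w t))
        - inner (?a - ?b) ?c"
      by (simp add: inner_diff_right)
    moreover have "- inner (?a - ?b) ?c \<le> 2 * C * (C * (1 / lam + 1 / mu))"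
    proof -
      have "- inner (?a - ?b) ?c
          \<le> norm (?a - ?b) * norm ?c"
        using Cauchy_Schwarz_ineq2 by (smt (verit))
      also have "\<dots> \<le> (2 * C) * (C * (1 / lam + 1 / mu))"
      proof (rule mult_mono)
        show "norm (?a - ?b) \<le> 2 * C" using norm_triangle_ineq4[of ?a ?b] a b by linarith
        have "norm ((1 / lam) *\<^sub>R ?a) \<le> C * (1 / lam)" "norm ((1 / mu) *\<^sub>R ?b) \<le> C * (1 / mu)"
          using a b lam mu by (simp_all add: divide_right_mono)
        then show "norm ?c \<le> C * (1 / lam + 1 / mu)"
          using norm_triangle_ineq4[of "(1 / lam) *\<^sub>R ?a" "(1 / mu) *\<^sub>R ?b"] by (simp add: distrib_left)
        show "0 \<le> 2 * C" using a norm_ge_zero[of ?a] by linarith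
      qed simp
      finally show ?thesis .
    qed
    ultimately show ?thesis by (simp add: power2_eq_square ac_simps)
  qed
  have "(norm (u t - w t))\<^sup>2 \<le> (norm (u 0 - w 0))\<^sup>2 + 2 * (2 * C\<^sup>2 * (1 / lam + 1 / mu)) * t"
    by (rule norm_growth_bound[where p="\<lambda>t. u t - w t", OF _ bound \<open>t \<ge> 0\<close>])
      (auto intro: has_vector_derivative_diff has_vector_derivative_at_within[OF u]
        has_vector_derivative_at_within[OF w])
  then show ?thesis by (simp add: ac_simps)
qed

text \<open>The Yosida approximations of \<open>A\<close> generate flows converging together with their derivatives.\<close>

lemma evolution_exists:
  assumes x: "x \<in> D" "A x \<in> D"
  obtains u where "u 0 = x" "continuous_on {0..} (\<lambda>t. A (u t))"
    "\<And>t. t \<ge> 0 \<Longrightarrow> u t \<in> D \<and> (u has_vector_derivative A (u t)) (at t within {0..})"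
proof -
  define l where "l n = max lam0 0 + real (Suc n)" for n
  have l: "l n > lam0" "l n > 0" for n by (auto simp: l_def)
  have inv_l: "1 / l n \<le> 1 / Suc n" for n by (rule divide_left_mono) (auto simp: l_def)
  have "\<exists>u. u 0 = x \<and> (\<forall>t. (u has_vector_derivative yosida (l n) (u t)) (at t))" for n
    by (rule bounded_linear_evolution_exists[OF bounded_linear_yosida[OF l]]) blast
  then obtain u where u: "\<And>n. u n 0 = x"
    "\<And>n t. (u n has_vector_derivative yosida (l n) (u n t)) (at t)" by metis
  \<comment> \<open>The velocities are again Yosida flows, starting from
    \<open>J (l n) (A x)\<close>, which tends to \<open>A x\<close>. Their own velocities are
    bounded by the norm of \<open>A (A x)\<close>, which is where \<open>A x \<in> D\<close> is
    needed.\<close>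
  define v where "v n t = yosida (l n) (u n t)" for n t
  have v: "(v n has_vector_derivative yosida (l n) (v n t)) (at t)" for n t
    unfolding v_def
    by (rule bounded_linear.has_vector_derivative[OF bounded_linear_yosida[OF l] u(2)])
  have v0: "v n 0 = J (l n) (A x)" for n by (simp add: v_def u yosida_on_D[OF l x(1)])
  have growth: "(norm (f m t - f n t))\<^sup>2 \<le> (norm (f m 0 - f n 0))\<^sup>2 + (4 * C\<^sup>2) * t * (1 / Suc m + 1 / Suc n)"
    if f: "\<And>n t. (f n has_vector_derivative yosida (l n) (f n t)) (at t)"
      "\<And>n. norm (yosida (l n) (f n 0)) \<le> C" "t \<ge> 0" for f C m n t
  proof -
    have "(norm (f m t - f n t))\<^sup>2 \<le> (norm (f m 0 - f n 0))\<^sup>2 + 4 * C\<^sup>2 * t * (1 / l m + 1 / l n)"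
      by (rule yosida_evolution_compare[OF l l f(1) f(1) f(2) f(2) \<open>t \<ge> 0\<close>])
    also have "4 * C\<^sup>2 * t * (1 / l m + 1 / l n) \<le> 4 * C\<^sup>2 * t * (1 / Suc m + 1 / Suc n)"
      using inv_l[of m] inv_l[of n] \<open>t \<ge> 0\<close> by (intro mult_left_mono add_mono) auto
    finally show ?thesis by simp
  qed
  have "norm (yosida (l n) (u n 0)) \<le> norm (A x)" for n
    unfolding u by (rule norm_yosida_on_D[OF l x(1)])
  from growth[OF u(2) this] obtain U where U: "\<And>R. uniform_limit {0..R} u U sequentially"
    by (rule uniform_limit_of_growth_bound) (auto simp: u convergent_const convergent_Cauchy)
  have "Cauchy (\<lambda>n. v n 0)"
    unfolding v0 l_def using J_tendsto[OF x(2)] by (rule LIMSEQ_imp_Cauchy)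
  moreover have "norm (yosida (l n) (v n 0)) \<le> norm (A (A x))" for n
    unfolding v0 yosida_J_commute[OF l]
    using norm_J[OF l] norm_yosida_on_D[OF l x(2)] by (rule order_trans)
  note growth[OF v this]
  ultimately obtain V where V: "\<And>R. uniform_limit {0..R} v V sequentially"
    by (rule_tac uniform_limit_of_growth_bound[of v "4 * (norm (A (A x)))\<^sup>2"]) auto
  have limU: "(\<lambda>n. u n t) \<longlonglongrightarrow> U t" if "t \<ge> 0" for t
    by (rule tendsto_uniform_limitI[OF U[of t]]) (use that in auto)
  have limV: "(\<lambda>n. v n t) \<longlonglongrightarrow> V t" if "t \<ge> 0" for t
    by (rule tendsto_uniform_limitI[OF V[of t]]) (use that in auto)
  have AU: "U t \<in> D \<and> A (U t) = V t" if "t \<ge> 0" for t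
  proof -
    \<comment> \<open>\<open>J (l n) (u n t)\<close> differs from \<open>u n t\<close> by a velocity
      divided by \<open>l n\<close>, so it has the same limit; its image under \<open>A\<close> is
      \<open>v n t\<close>. Closedness of the graph then applies.\<close>
    have Jv: "J (l n) (u n t) = u n t + (1 / l n) *\<^sub>R v n t" for n
      using l[of n] by (simp add: v_def yosida_def)
    have "(\<lambda>n. 1 / l n) \<longlonglongrightarrow> 0"
      by (rule tendsto_sandwich[OF _ _ tendsto_const LIMSEQ_Suc[OF lim_1_over_n]])
        (use inv_l l in \<open>auto intro!: always_eventually less_imp_le\<close>)
    then have "(\<lambda>n. u n t + (1 / l n) *\<^sub>R v n t) \<longlonglongrightarrow> U t + 0 *\<^sub>R V t"
      by (intro tendsto_intros limU limV that)
    then have "(\<lambda>n. J (l n) (u n t)) \<longlonglongrightarrow> U t" by (simp add: Jv)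
    moreover have "(\<lambda>n. A (J (l n) (u n t))) \<longlonglongrightarrow> V t"
      using limV[OF that] by (simp add: v_def yosida_eq[OF l])
    ultimately show ?thesis using closed_graph[of "\<lambda>n. J (l n) (u n t)"] J_in_D[OF l] by blast
  qed
  have "(U has_vector_derivative V t) (at t within {0..})" if "t \<ge> 0" for t
  proof -
    \<comment> \<open>Uniform convergence is available on bounded intervals only; ending at
      \<open>t + 1\<close> does not change the neighbourhood filter at \<open>t\<close>.\<close>
    have "(U has_vector_derivative V t) (at t within {0..t+1})"
      by (rule has_vector_derivative_uniform_limit[OF _ _ V limU])
        (use that in \<open>auto simp: v_def intro: has_vector_derivative_at_within[OF u(2)]\<close>)
    then show ?thesis by (simp add: at_within_atLeastAtMost_eq)
  qed
  moreover have "continuous_on {0..} V"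
  proof -
    have "continuous_on {0..R} V" for R
      by (rule uniform_limit_theorem[OF _ V])
        (auto intro!: always_eventually continuous_at_imp_continuous_on has_vector_derivative_continuous v)
    then have "continuous (at t within {0..t+1}) V" if "t \<ge> 0" for t
      using that by (simp add: continuous_on_eq_continuous_within)
    then show ?thesis
      by (simp add: continuous_on_eq_continuous_within at_within_atLeastAtMost_eq)
  qed
  then have "continuous_on {0..} (\<lambda>t. A (U t))"
    by (rule continuous_on_eq) (use AU in auto)
  moreover have "U 0 = x" using limU[of 0] u(1) LIMSEQ_unique tendsto_const by fastforce
  ultimately show ?thesis using that[of U] AU by simp
qed

end

section \<open>Strongly continuous semigroups\<close>

instance chilbert_space \<subseteq> banach by standard

text \<open>Sokal's elementary argument: of \<open>x + z\<close> and \<open>x - z\<close>, one has an image at least as large as that of \<open>z\<close>.\<close>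

lemma uniform_boundedness:
  fixes f :: "nat \<Rightarrow> 'a::banach \<Rightarrow> 'b::real_normed_vector"
  assumes lin: "\<And>n. bounded_linear (f n)" and bdd: "\<And>x. \<exists>M. \<forall>n. norm (f n x) \<le> M"
  shows "\<exists>M. \<forall>n x. norm (f n x) \<le> M * norm x"
proof (rule ccontr)
  assume "\<not> ?thesis"
  then have unb: "\<exists>n x. M * norm x < norm (f n x)" for M by (meson not_le)
  have big: "\<exists>n z. norm z \<le> r \<and> norm (f n z) \<ge> C" if "r > 0" for r C
  proof -
    obtain n x where x: "(max C 0 / r) * norm x < norm (f n x)" using unb by blast
    have x0: "x \<noteq> 0" using x linear_0[OF bounded_linear.linear[OF lin]] by auto
    let ?z = "(r / norm x) *\<^sub>R x"
    have "norm (f n ?z) = (r / norm x) * norm (f n x)"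
      using \<open>r > 0\<close> by (simp add: linear_scale[OF bounded_linear.linear[OF lin]])
    also have "\<dots> \<ge> (r / norm x) * ((max C 0 / r) * norm x)"
      using x \<open>r > 0\<close> by (intro mult_left_mono) auto
    finally have "norm (f n ?z) \<ge> max C 0" using x0 \<open>r > 0\<close> by simp
    then show ?thesis using x0 \<open>r > 0\<close> by (intro exI[of _ n] exI[of _ ?z]) auto
  qed
  have step: "\<exists>n x'. norm (x' - x) \<le> r \<and> norm (f n x') \<ge> C" if "r > 0" for x r C
  proof -
    obtain n z where z: "norm z \<le> r" "norm (f n z) \<ge> C" using big[OF \<open>r > 0\<close>] by blast
    interpret f: bounded_linear "f n" by (rule lin)
    have "2 *\<^sub>R f n z = f n (x + z) - f n (x - z)" by (simp add: f.add f.diff scaleR_2)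
    then have "2 * norm (f n z) = norm (f n (x + z) - f n (x - z))"
      by (metis norm_scaleR abs_numeral)
    then have "2 * norm (f n z) \<le> norm (f n (x + z)) + norm (f n (x - z))"
      using norm_triangle_ineq4[of "f n (x + z)" "f n (x - z)"] by simp
    then have "norm (f n (x + z)) \<ge> C \<or> norm (f n (x - z)) \<ge> C" using z(2) by linarith
    moreover have "norm ((x + z) - x) \<le> r" "norm ((x - z) - x) \<le> r" using z(1) by auto
    ultimately show ?thesis by blast
  qed
  \<comment> \<open>A state \<open>q\<close> is a centre, an index and a radius. Stage
    \<open>k\<close> finds a ball on whose double some \<open>f n\<close> has norm at least
    \<open>k - 1\<close>; the doubling leaves room for the limit of the centres, and quartering the
    radii makes the centres converge.\<close>
  define P where "P = (\<lambda>(k::nat) (q :: 'a \<times> nat \<times> real) q'.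
    norm (fst q' - fst q) \<le> snd (snd q) / 4 \<and> norm (f (fst (snd q')) (fst q')) \<ge> real k \<and>
    snd (snd q') > 0 \<and> snd (snd q') \<le> snd (snd q) / 4 \<and>
    (\<forall>y. norm (y - fst q') \<le> 2 * snd (snd q') \<longrightarrow> norm (f (fst (snd q')) y) \<ge> real k - 1))"
  have "\<exists>q'. snd (snd q') > 0 \<and> P k q q'" if q: "snd (snd q) > 0" for k q
  proof -
    obtain n x' where x': "norm (x' - fst q) \<le> snd (snd q) / 4" "norm (f n x') \<ge> real k"
      using step[of "snd (snd q) / 4" "fst q" "real k"] q by auto
    obtain K where K: "K > 0" "\<And>x. norm (f n x) \<le> norm x * K"
      using bounded_linear.pos_bounded[OF lin] by blast
    \<comment> \<open>The entry \<open>1 / (2 K)\<close> ensures that \<open>f n\<close> varies by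
      at most \<open>1\<close> over a distance of \<open>2 r\<close>.\<close>
    define r where "r = min (snd (snd q) / 4) (1 / (2 * K))"
    have "norm (f n y) \<ge> real k - 1" if "norm (y - x') \<le> 2 * r" for y
    proof -
      have "norm (f n (y - x')) \<le> norm (y - x') * K" by (rule K)
      also have "\<dots> \<le> 2 * r * K" using that K by (simp add: mult_right_mono)
      also have "\<dots> \<le> 2 * (1 / (2 * K)) * K"
        using K by (intro mult_right_mono mult_left_mono) (auto simp: r_def)
      finally have "norm (f n (y - x')) \<le> 1" using K by simp
      moreover have "f n x' = f n y - f n (y - x')"
        by (simp add: linear_diff[OF bounded_linear.linear[OF lin]])
      then have "norm (f n x') \<le> norm (f n y) + norm (f n (y - x'))"
        by (metis norm_triangle_ineq4)
      ultimately show ?thesis using x'(2) by linarith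
    qed
    moreover have "r > 0" using q K by (simp add: r_def)
    ultimately show ?thesis
      using x' by (intro exI[of _ "(x', n, r)"]) (auto simp: P_def r_def)
  qed
  from dependent_nat_choice[of "\<lambda>_ q. snd (snd q) > 0" P, OF exI[of _ "(0, 0, 1)"] this]
  obtain q where q: "\<And>k. snd (snd (q k)) > 0" "\<And>k. P k (q k) (q (Suc k))" by auto
  define x r where "x k = fst (q k)" and "r k = snd (snd (q k))" for k
  have r: "r k > 0" "r (Suc k) \<le> r k / 4" "norm (x (Suc k) - x k) \<le> r k / 4" for k
    using q[of k] by (auto simp: P_def r_def x_def)
  have tail: "norm (x (k + j) - x k) \<le> r k * (1 - (1/2) ^ j) \<and> r (k + j) \<le> r k * (1/2) ^ j" for k j
  proof (induction j)
    case (Suc j)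
    have "norm (x (k + Suc j) - x k) \<le> norm (x (k + Suc j) - x (k + j)) + norm (x (k + j) - x k)"
      by (metis norm_triangle_ineq diff_add_cancel add_diff_eq)
    also have "\<dots> \<le> r k * (1/2) ^ j / 2 + r k * (1 - (1/2) ^ j)"
      using r(3)[of "k + j"] r(1)[of "k + j"] Suc by simp
    finally have "norm (x (k + Suc j) - x k) \<le> r k * (1 - (1/2) ^ Suc j)" by (simp add: field_simps)
    moreover have "r (k + Suc j) \<le> r k * (1/2) ^ Suc j"
      using r(2)[of "k + j"] r(1)[of "k + j"] Suc by simp
    ultimately show ?case by blast
  qed simp
  have tail': "norm (x m - x k) \<le> r k" if "k \<le> m" for k m
  proof -
    have "norm (x (k + (m - k)) - x k) \<le> r k * (1 - (1/2) ^ (m - k))" using tail by blast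
    also have "\<dots> \<le> r k * 1" using r(1)[of k] by (intro mult_left_mono) auto
    finally show ?thesis using that by simp
  qed
  have "Cauchy x"
  proof (rule metric_CauchyI)
    fix e :: real assume "e > 0"
    have "(\<lambda>k. r 0 * (1/2) ^ k) \<longlonglongrightarrow> 0"
      by (intro tendsto_mult_right_zero LIMSEQ_power_zero) simp
    then obtain k where "r 0 * (1/2) ^ k < e / 2"
      using \<open>e > 0\<close> by (metis eventually_happens' order_tendstoD(2) half_gt_zero sequentially_bot)
    then have "r k < e / 2" using tail[of 0 k] by simp
    have "dist (x m) (x n) < e" if "m \<ge> k" "n \<ge> k" for m n
    proof -
      have "dist (x m) (x n) \<le> dist (x m) (x k) + dist (x n) (x k)" by (rule dist_triangle2)
      then show ?thesis using tail'[OF that(1)] tail'[OF that(2)] \<open>r k < e / 2\<close> by (simp add: dist_norm)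
    qed
    then show "\<exists>M. \<forall>m\<ge>M. \<forall>n\<ge>M. dist (x m) (x n) < e" by blast
  qed
  then obtain p where p: "x \<longlonglongrightarrow> p" using Cauchy_convergent convergent_def by blast
  have "norm (p - x k) \<le> r k" for k
  proof (rule LIMSEQ_le_const2)
    show "(\<lambda>m. norm (x m - x k)) \<longlonglongrightarrow> norm (p - x k)" by (intro tendsto_intros p)
  qed (use tail' in blast)
  then have "real k - 1 \<le> norm (f (fst (snd (q (Suc k)))) p)" for k
    using q[of k] r(1)[of "Suc k"] by (simp add: P_def x_def r_def) (smt (verit, best) q(1) r_def x_def)
  moreover obtain M where "\<And>n. norm (f n p) \<le> M" using bdd by blast
  moreover obtain k where "M + 1 < real k" using reals_Archimedean2 by blast
  ultimately show False by (smt (verit))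
qed

section \<open>Local boundedness and continuity of a semigroup\<close>

locale strongly_continuous_semigroup =
  fixes T :: "real \<Rightarrow> 'x::chilbert_space \<Rightarrow> 'x"
  assumes c0: "c0_semigroup T"
begin

lemma bounded_linear_T: "t \<ge> 0 \<Longrightarrow> bounded_linear (T t)"
  using c0 by (simp add: c0_semigroup_def bounded_clinear_def)

lemma T_0: "T 0 x = x"
  using c0 by (simp add: c0_semigroup_def)

lemma T_add: "s \<ge> 0 \<Longrightarrow> t \<ge> 0 \<Longrightarrow> T (s + t) x = T s (T t x)"
  using c0 by (simp add: c0_semigroup_def)

lemma T_diff: "t \<ge> 0 \<Longrightarrow> T t (x - y) = T t x - T t y"
  by (simp add: linear_diff bounded_linear.linear bounded_linear_T)

lemma T_scaleR: "t \<ge> 0 \<Longrightarrow> T t (r *\<^sub>R x) = r *\<^sub>R T t x"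
  by (simp add: linear_scale bounded_linear.linear bounded_linear_T)

lemma T_tendsto_at_0: "((\<lambda>t. T t x) \<longlongrightarrow> x) (at_right 0)"
  using c0 by (simp add: c0_semigroup_def)

text \<open>Otherwise there are times \<open>t n\<close> tending to zero at which the operator norm
  exceeds \<open>Suc n\<close>, although strong continuity bounds every sequence
  \<open>T (t n) x\<close>: uniform boundedness is contradicted.\<close>

lemma bounded_near_0: "\<exists>d>0. \<exists>M\<ge>1. \<forall>t\<in>{0..d}. \<forall>x. norm (T t x) \<le> M * norm x"
proof (rule ccontr)
  assume "\<not> ?thesis"
  then have "\<exists>t\<in>{0..1 / Suc n}. \<exists>x. real (Suc n) * norm x < norm (T t x)" for n
    by (metis not_le of_nat_0_less_iff zero_less_Suc zero_less_divide_1_iff of_nat_Suc le_add_same_cancel2 of_nat_0_le_iff add.commute)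
  then obtain t where t: "\<And>n. t n \<in> {0..1 / Suc n}" "\<And>n. \<exists>x. real (Suc n) * norm x < norm (T (t n) x)"
    by metis
  \<comment> \<open>The limit at zero is taken from the right, so \<open>t n = 0\<close> has to be
    excluded; \<open>T 0\<close> is the identity, whose norm is not large.\<close>
  have tpos: "t n > 0" for n
  proof (rule ccontr)
    assume "\<not> t n > 0"
    then have "t n = 0" using t(1)[of n] by simp
    with t(2)[of n] obtain x :: 'x where "real (Suc n) * norm x < norm x" by (auto simp: T_0)
    then show False using mult_right_mono[of 1 "real (Suc n)" "norm x"] by simp
  qed
  have t0: "t \<longlonglongrightarrow> 0"
    by (rule tendsto_sandwich[OF _ _ tendsto_const LIMSEQ_Suc[OF lim_1_over_n]])
      (use t(1) in \<open>auto intro!: always_eventually\<close>)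
  have "\<exists>M. \<forall>n x. norm (T (t n) x) \<le> M * norm x"
  proof (rule uniform_boundedness)
    show "bounded_linear (T (t n))" for n using tpos[of n] by (simp add: bounded_linear_T)
    fix x
    have "filterlim t (at_right 0) sequentially"
      using t0 tpos by (intro filterlim_at_withinI) (auto intro: always_eventually)
    then have "(\<lambda>n. T (t n) x) \<longlonglongrightarrow> x" by (rule filterlim_compose[OF T_tendsto_at_0])
    then have "Bseq (\<lambda>n. T (t n) x)" by (rule convergent_imp_Bseq[OF convergentI])
    then show "\<exists>M. \<forall>n. norm (T (t n) x) \<le> M" by (auto simp: Bseq_def)
  qed
  then obtain M where M: "\<And>n x. norm (T (t n) x) \<le> M * norm x" by blast
  obtain n where n: "M < real n" using reals_Archimedean2 by blast
  obtain x where x: "real (Suc n) * norm x < norm (T (t n) x)" using t(2) by blast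
  also have "\<dots> \<le> M * norm x" by (rule M)
  also have "\<dots> \<le> real (Suc n) * norm x" using n by (intro mult_right_mono) auto
  finally show False by simp
qed

lemma bounded_on_interval:
  obtains M where "M \<ge> 1" "\<And>t x. t \<in> {0..R} \<Longrightarrow> norm (T t x) \<le> M * norm x"
proof -
  obtain d M where d: "d > 0" "M \<ge> 1" and M: "\<And>t x. t \<in> {0..d} \<Longrightarrow> norm (T t x) \<le> M * norm x"
    using bounded_near_0 by blast
  have *: "norm (T t x) \<le> M ^ Suc n * norm x" if "t \<in> {0..real n * d}" for n t x
    using that
  proof (induction n arbitrary: t x)
    case 0
    then show ?case using d by (simp add: T_0 mult_right_mono[of 1 M "norm x", simplified])
  next
    case (Suc n)
    show ?case
    proof (cases "t \<le> d")
      case True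
      then have "norm (T t x) \<le> M * norm x" using M Suc.prems by simp
      also have "\<dots> \<le> M ^ Suc (Suc n) * norm x"
        using d power_increasing[of 1 "Suc (Suc n)" M] by (intro mult_right_mono) auto
      finally show ?thesis .
    next
      case False
      then have "T t x = T d (T (t - d) x)" using T_add[of d "t - d" x] d by simp
      then have "norm (T t x) \<le> M * norm (T (t - d) x)" using M[of d] d by simp
      also have "\<dots> \<le> M * (M ^ Suc n * norm x)"
        using Suc.IH[of "t - d" x] Suc.prems False d by (intro mult_left_mono) (auto simp: algebra_simps)
      finally show ?thesis by (simp add: ac_simps)
    qed
  qed
  obtain n where "R / d < real n" using reals_Archimedean2 by blast
  then have "R \<le> real n * d" using d by (simp add: field_simps)
  then show ?thesis using that[of "M ^ Suc n"] * d one_le_power[of M "Suc n"] by fastforce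
qed

text \<open>The smaller of the two times is factored out of \<open>T s x - T t x\<close>; its
  operator is locally bounded, so right continuity at zero gives continuity from both sides.\<close>

lemma continuous_on_T: "continuous_on {0..} (\<lambda>t. T t x)"
proof -
  have "((\<lambda>s. T s x) \<longlongrightarrow> T t x) (at t within {0..})" if "t \<ge> 0" for t
  proof -
    obtain M where M: "M \<ge> 1" "\<And>s x. s \<in> {0..t+1} \<Longrightarrow> norm (T s x) \<le> M * norm x"
      using bounded_on_interval by blast
    have key: "norm (T s x - T t x) \<le> M * norm (T \<bar>s - t\<bar> x - x)" if s: "s \<in> {0..t+1}" for s
    proof (cases "s \<le> t")
      case True
      have "T s x - T t x = T s (x - T (t - s) x)"
        using T_add[of s "t - s" x] True s by (simp add: T_diff)
      then show ?thesis using M(2)[OF s] True by (simp add: norm_minus_commute)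
    next
      case False
      have "T s x - T t x = T t (T (s - t) x - x)"
        using T_add[of t "s - t" x] False \<open>t \<ge> 0\<close> by (simp add: T_diff)
      then show ?thesis using M(2)[of t] False \<open>t \<ge> 0\<close> by simp
    qed
    have "((\<lambda>s. T \<bar>s - t\<bar> x) \<longlongrightarrow> x) (at t within {0..})"
    proof (rule filterlim_compose[OF T_tendsto_at_0])
      show "filterlim (\<lambda>s. \<bar>s - t\<bar>) (at_right 0) (at t within {0..})"
        by (rule filterlim_at_withinI)
          (auto simp: eventually_at_filter intro!: tendsto_eq_intros)
    qed
    then have "((\<lambda>s. M * norm (T \<bar>s - t\<bar> x - x)) \<longlongrightarrow> M * norm (x - x)) (at t within {0..})"
      by (intro tendsto_intros)
    then have lim: "((\<lambda>s. M * norm (T \<bar>s - t\<bar> x - x)) \<longlongrightarrow> 0) (at t within {0..})" by simp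
    have "\<forall>\<^sub>F s in at t within {0..}. norm (T s x - T t x) \<le> M * norm (T \<bar>s - t\<bar> x - x)"
      using key by (auto simp: eventually_at dist_real_def intro!: exI[of _ 1])
    then have "((\<lambda>s. T s x - T t x) \<longlongrightarrow> 0) (at t within {0..})" using lim by (rule Lim_null_comparison)
    then show ?thesis by (simp add: LIM_zero_iff)
  qed
  then show ?thesis by (simp add: continuous_on_def)
qed

end

lemma has_vector_derivative_iff_difference_quotient:
  fixes f :: "real \<Rightarrow> 'a::real_normed_vector"
  shows "(f has_vector_derivative y) (at t within S) \<longleftrightarrow>
    ((\<lambda>s. (f s - f t) /\<^sub>R (s - t)) \<longlongrightarrow> y) (at t within S)"
proof -
  have "norm ((f s - (f t + (s - t) *\<^sub>R y)) /\<^sub>R norm (s - t)) = norm ((f s - f t) /\<^sub>R (s - t) - y)"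
    if "s \<noteq> t" for s
  proof -
    have "(f s - f t) /\<^sub>R (s - t) - y = (f s - (f t + (s - t) *\<^sub>R y)) /\<^sub>R (s - t)"
      using that by (simp only: diff_diff_eq[symmetric] scaleR_diff_right scaleR_scaleR) simp
    then show ?thesis by simp
  qed
  then have "((\<lambda>s. norm ((f s - (f t + (s - t) *\<^sub>R y)) /\<^sub>R norm (s - t))) \<longlongrightarrow> 0) (at t within S) \<longleftrightarrow>
      ((\<lambda>s. norm ((f s - f t) /\<^sub>R (s - t) - y)) \<longlongrightarrow> 0) (at t within S)"
    by (intro Lim_cong_within) auto
  then show ?thesis
    unfolding has_vector_derivative_def has_derivative_within tendsto_norm_zero_iff
    by (simp add: LIM_zero_iff bounded_linear_scaleR_left inverse_eq_divide)
qed

lemma difference_quotient_at_right_0: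
  fixes f :: "real \<Rightarrow> 'a::real_normed_vector"
  shows "(f has_vector_derivative y) (at 0 within {0..}) \<longleftrightarrow>
    ((\<lambda>h. (f h - f 0) /\<^sub>R h) \<longlongrightarrow> y) (at_right 0)"
proof -
  have "at 0 within {0::real..} = at_right 0"
    unfolding at_within_def by (rule arg_cong[where f="\<lambda>S. inf (nhds 0) (principal S)"]) auto
  then show ?thesis by (simp add: has_vector_derivative_iff_difference_quotient)
qed

section \<open>Orbits and resolvent of a generator\<close>

locale generated_semigroup = strongly_continuous_semigroup T
  for T :: "real \<Rightarrow> 'x::chilbert_space \<Rightarrow> 'x" +
  fixes A :: "('x, 'x) partial_op"
  assumes gen: "generates A T"
begin

lemma generator_tendsto:
  "x \<in> Dom A \<Longrightarrow> ((\<lambda>h. (T h x - x) /\<^sub>R h) \<longlongrightarrow> app A x) (at_right 0)"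
  using gen by (simp add: generates_def)

lemma generatorI:
  assumes "((\<lambda>h. (T h x - x) /\<^sub>R h) \<longlongrightarrow> z) (at_right 0)"
  shows "x \<in> Dom A \<and> app A x = z"
proof -
  have "x \<in> Dom A" using gen assms unfolding generates_def by blast
  then show ?thesis using tendsto_unique[OF _ generator_tendsto assms] by simp
qed

lemma T_in_Dom:
  assumes "x \<in> Dom A" "t \<ge> 0"
  shows "T t x \<in> Dom A \<and> app A (T t x) = T t (app A x)"
proof (rule generatorI)
  have "((\<lambda>h. T t ((T h x - x) /\<^sub>R h)) \<longlongrightarrow> T t (app A x)) (at_right 0)"
    by (rule bounded_linear.tendsto[OF bounded_linear_T[OF assms(2)] generator_tendsto[OF assms(1)]])
  then show "((\<lambda>h. (T h (T t x) - T t x) /\<^sub>R h) \<longlongrightarrow> T t (app A x)) (at_right 0)"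
  proof (rule Lim_transform_eventually)
    show "\<forall>\<^sub>F h in at_right 0. T t ((T h x - x) /\<^sub>R h) = (T h (T t x) - T t x) /\<^sub>R h"
      using eventually_at_right_less[of "0::real"]
    proof eventually_elim
      case (elim h)
      then have "T h (T t x) = T t (T h x)" using T_add[of h t x] T_add[of t h x] assms(2) by (simp add: add.commute)
      then show ?case using assms(2) by (simp add: T_scaleR T_diff)
    qed
  qed
qed

text \<open>Factoring out the smaller time turns the quotients from either side into
  \<open>T (min s t)\<close> applied to the quotient at zero, and local boundedness carries the
  limit through.\<close>

lemma T_has_vector_derivative:
  assumes x: "x \<in> Dom A" and "t \<ge> 0"
  shows "((\<lambda>s. T s x) has_vector_derivative T t (app A x)) (at t within {0..})"
  unfolding has_vector_derivative_iff_difference_quotient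
proof -
  let ?F = "at t within {0..}"
  define Q where "Q h = (T h x - x) /\<^sub>R h" for h
  obtain M where M: "M \<ge> 1" "\<And>s x. s \<in> {0..t} \<Longrightarrow> norm (T s x) \<le> M * norm x"
    using bounded_on_interval by blast
  let ?R = "\<lambda>s. M * norm (Q \<bar>s - t\<bar> - app A x) + norm (T (min s t) (app A x) - T t (app A x))"
  have quot: "(T s x - T t x) /\<^sub>R (s - t) = T (min s t) (Q \<bar>s - t\<bar>)" if "s \<ge> 0" for s
  proof (cases "s \<le> t")
    case True
    then have "T t x = T s (T (t - s) x)" using T_add[of s "t - s" x] that by simp
    moreover have "inverse (s - t) = - inverse (t - s)" by (metis inverse_minus_eq minus_diff_eq)
    ultimately show ?thesis using True that by (simp add: Q_def T_scaleR T_diff scaleR_diff_right)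
  next
    case False
    then have "T s x = T t (T (s - t) x)" using T_add[of t "s - t" x] \<open>t \<ge> 0\<close> by simp
    then show ?thesis using False \<open>t \<ge> 0\<close> by (simp add: Q_def T_scaleR T_diff)
  qed
  have "(Q \<longlongrightarrow> app A x) (at_right 0)" unfolding Q_def by (rule generator_tendsto[OF x])
  moreover have "filterlim (\<lambda>s. \<bar>s - t\<bar>) (at_right 0) ?F"
    by (rule filterlim_at_withinI) (auto simp: eventually_at_filter intro!: tendsto_eq_intros)
  ultimately have lim1: "((\<lambda>s. Q \<bar>s - t\<bar>) \<longlongrightarrow> app A x) ?F" by (rule filterlim_compose)
  have "((\<lambda>s. T s (app A x)) \<longlongrightarrow> T t (app A x)) ?F"
    using continuous_on_T \<open>t \<ge> 0\<close> by (simp add: continuous_on_def)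
  then have "((\<lambda>s. T (min s t) (app A x)) \<longlongrightarrow> T t (app A x)) ?F"
  proof -
    have "continuous_on {0..} (\<lambda>s. T (min s t) (app A x))"
      by (rule continuous_on_compose2[OF continuous_on_T])
        (use \<open>t \<ge> 0\<close> in \<open>auto intro!: continuous_intros\<close>)
    then have "((\<lambda>s. T (min s t) (app A x)) \<longlongrightarrow> T (min t t) (app A x)) ?F"
      using \<open>t \<ge> 0\<close> unfolding continuous_on_def by blast
    then show ?thesis by simp
  qed
  then have "(?R
      \<longlongrightarrow> M * norm (app A x - app A x) + norm (T t (app A x) - T t (app A x))) ?F"
    by (intro tendsto_intros lim1)
  then have lim: "(?R
      \<longlongrightarrow> 0) ?F" by simp
  have "norm ((T s x - T t x) /\<^sub>R (s - t) - T t (app A x))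
      \<le> ?R s"
    if "s \<in> {0..}" for s
  proof -
    let ?m = "min s t"
    have m: "?m \<in> {0..t}" using that \<open>t \<ge> 0\<close> by auto
    have "(T s x - T t x) /\<^sub>R (s - t) - T t (app A x)
        = T ?m (Q \<bar>s - t\<bar> - app A x) + (T ?m (app A x) - T t (app A x))"
      using m quot[of s] that by (simp add: T_diff)
    also have "norm \<dots> \<le> norm (T ?m (Q \<bar>s - t\<bar> - app A x)) + norm (T ?m (app A x) - T t (app A x))"
      by (rule norm_triangle_ineq)
    finally show ?thesis using M(2)[OF m, of "Q \<bar>s - t\<bar> - app A x"] by linarith
  qed
  then have "\<forall>\<^sub>F s in ?F. norm ((T s x - T t x) /\<^sub>R (s - t) - T t (app A x))
      \<le> ?R s"
    by (simp add: eventually_at_filter)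
  from Lim_null_comparison[OF this lim]
  show "((\<lambda>s. (T s x - T t x) /\<^sub>R (s - t)) \<longlongrightarrow> T t (app A x)) ?F" by (simp add: LIM_zero_iff)
qed

text \<open>The resolvent at \<open>lam\<close> comes from integrating over \<open>[0, 1]\<close>, since
  \<open>(lam - A) \<integral>\<^sub>0\<^sup>1 e\<^bsup>-lam s\<^esup> T\<^sub>s x ds = x - e\<^bsup>-lam\<^esup> T\<^sub>1 x\<close>.\<close>

lemma resolvent_range:
  "\<exists>lam0. \<forall>lam>lam0. \<forall>y. \<exists>w\<in>Dom A. lam *\<^sub>R w - app A w = y"
proof -
  obtain M where M: "M \<ge> 1" "\<And>s x. s \<in> {0..1} \<Longrightarrow> norm (T s x) \<le> M * norm x"
    using bounded_on_interval by blast
  have "\<exists>w\<in>Dom A. lam *\<^sub>R w - app A w = y" if lam: "lam > ln M" for lam y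
  proof -
    have c: "exp (- lam) * M < 1"
    proof -
      have "exp (- lam) < exp (- ln M)" using lam by simp
      also have "\<dots> = 1 / M" using M(1) by (simp add: exp_minus inverse_eq_divide)
      finally show ?thesis using M(1) by (simp add: field_simps)
    qed
    \<comment> \<open>Its fixed point solves \<open>x - exp (- lam) T 1 x = y\<close>; it exists
      since \<open>lam > ln M\<close> makes the map a contraction.\<close>
    let ?g = "\<lambda>x. y + exp (- lam) *\<^sub>R T 1 x"
    have "\<exists>!x. ?g x = x"
    proof (rule banach_fix_type[OF _ c])
      show "\<forall>u v. dist (?g u) (?g v) \<le> exp (- lam) * M * dist u v"
      proof (intro allI)
        fix u v
        have "dist (?g u) (?g v) = exp (- lam) * norm (T 1 (u - v))"
          by (simp add: dist_norm T_diff flip: scaleR_diff_right)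
        also have "\<dots> \<le> exp (- lam) * (M * norm (u - v))" using M(2)[of 1 "u - v"] by simp
        finally show "dist (?g u) (?g v) \<le> exp (- lam) * M * dist u v"
          by (simp add: dist_norm ac_simps)
      qed
    qed (use M(1) in auto)
    then obtain x where x: "y + exp (- lam) *\<^sub>R T 1 x = x" by blast
    define F where "F s = exp (- lam * s) *\<^sub>R T s x" for s
    have F: "continuous_on {0..} F"
      unfolding F_def by (intro continuous_intros continuous_on_T)
    have Fi: "F integrable_on {a..b}" if "a \<ge> 0" for a b
      by (rule integrable_continuous_interval, rule continuous_on_subset[OF F]) (use that in auto)
    define G where "G t = integral {0..t} F" for t
    have G: "(G has_vector_derivative F t) (at t within {0..})" if "t \<ge> 0" for t
    proof -
      have "(G has_vector_derivative F t) (at t within {0..t+1})"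
        unfolding G_def using that
        by (intro integral_has_vector_derivative continuous_on_subset[OF F]) auto
      then show ?thesis by (simp add: at_within_atLeastAtMost_eq)
    qed
    define w where "w = G 1"
    \<comment> \<open>Applying \<open>T h\<close> shifts the window of integration to
      \<open>[h, 1 + h]\<close> and multiplies by \<open>exp (lam h)\<close>. The derivative at
      \<open>h = 0\<close> is \<open>lam w + F 1 - F 0\<close>, and
      \<open>F 1 - F 0 = - y\<close>.\<close>
    have Tw: "T h w = exp (lam * h) *\<^sub>R (G (1 + h) - G h)" if "h \<ge> 0" for h
    proof -
      have "T h w = integral {0..1} (T h \<circ> F)"
        unfolding w_def G_def
        by (rule integral_linear[symmetric]) (use that Fi in \<open>auto intro: bounded_linear_T\<close>)
      also have "\<dots> = integral {0..1} (\<lambda>s. exp (lam * h) *\<^sub>R (F \<circ> (\<lambda>s. s + h)) s)"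
      proof (rule integral_cong)
        fix s :: real assume "s \<in> {0..1}"
        then show "(T h \<circ> F) s = exp (lam * h) *\<^sub>R (F \<circ> (\<lambda>s. s + h)) s"
          using that T_add[of h s x]
          by (simp add: F_def T_scaleR add.commute flip: exp_add) (simp add: algebra_simps)
      qed
      also have "\<dots> = exp (lam * h) *\<^sub>R integral {0..1} (F \<circ> (\<lambda>s. s + h))"
        by (rule integral_cmul)
      also have "integral {0..1} (F \<circ> (\<lambda>s. s + h)) = G (1 + h) - G (0 + h)"
      proof (rule integral_unique, rule fundamental_theorem_of_calculus)
        fix s :: real assume s: "s \<in> {0..1}"
        have "((G \<circ> (\<lambda>s. s + h)) has_vector_derivative 1 *\<^sub>R F (s + h)) (at s within {0..1})"
          by (rule vector_diff_chain_within)
            (use s that in \<open>auto intro!: derivative_eq_intros has_vector_derivative_within_subset[OF G]\<close>)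
        then show "((\<lambda>s. G (s + h)) has_vector_derivative (F \<circ> (\<lambda>s. s + h)) s) (at s within {0..1})"
          by (simp add: comp_def)
      qed simp
      also have "G (0 + h) = G h" by simp
      finally show ?thesis .
    qed
    have G1: "((\<lambda>h. G (1 + h)) has_vector_derivative F 1) (at 0 within {0..})"
    proof -
      have "((G \<circ> (\<lambda>h. 1 + h)) has_vector_derivative 1 *\<^sub>R F 1) (at 0 within {0..})"
        by (rule vector_diff_chain_within)
          (auto intro!: derivative_eq_intros has_vector_derivative_within_subset[OF G])
      then show ?thesis by (simp add: comp_def)
    qed
    have "((\<lambda>h. exp (lam * h) *\<^sub>R (G (1 + h) - G h)) has_vector_derivative
        exp (lam * 0) *\<^sub>R (F 1 - F 0) + (lam * exp (lam * 0)) *\<^sub>R (G (1 + 0) - G 0)) (at 0 within {0..})"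
      by (rule has_vector_derivative_scaleR)
        (auto intro!: derivative_eq_intros has_vector_derivative_diff G1 G)
    then have "((\<lambda>h. (exp (lam * h) *\<^sub>R (G (1 + h) - G h) - exp (lam * 0) *\<^sub>R (G (1 + 0) - G 0)) /\<^sub>R h)
        \<longlongrightarrow> F 1 - F 0 + lam *\<^sub>R (G 1 - G 0)) (at_right 0)"
      by (simp add: difference_quotient_at_right_0)
    moreover have "F 1 - F 0 + lam *\<^sub>R (G 1 - G 0) = lam *\<^sub>R w - y"
      using x by (simp add: F_def T_0 G_def w_def algebra_simps)
    ultimately have "((\<lambda>h. (T h w - w) /\<^sub>R h) \<longlongrightarrow> lam *\<^sub>R w - y) (at_right 0)"
    proof (rule_tac Lim_transform_eventually)
      show "\<forall>\<^sub>F h in at_right 0. (exp (lam * h) *\<^sub>R (G (1 + h) - G h) - exp (lam * 0) *\<^sub>R (G (1 + 0) - G 0)) /\<^sub>R h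
          = (T h w - w) /\<^sub>R h"
        using eventually_at_right_less[of "0::real"]
        by eventually_elim (simp add: Tw G_def[of 0] flip: w_def)
    qed auto
    from generatorI[OF this] show ?thesis by (intro bexI[of _ w]) auto
  qed
  then show ?thesis by blast
qed

end

section \<open>Complex scalars\<close>

lemma norm_scaleC: "norm (c *\<^sub>C x) = cmod c * norm (x::'a::chilbert_space)"
proof -
  have "(norm (c *\<^sub>C x))\<^sup>2 = Re (cinner (c *\<^sub>C x) (c *\<^sub>C x))"
    by (simp add: power2_norm_eq_inner Re_cinner)
  also have "\<dots> = Re (c * cnj (c * cinner x x))"
    by (simp add: cinner_scaleC_left cinner_commute[where y=x and x="c *\<^sub>C x"])
  also have "cnj (c * cinner x x) = cnj c * cinner x x"
    by (simp flip: cinner_commute)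
  also have "Re (c * (cnj c * cinner x x)) = (cmod c)\<^sup>2 * Re (cinner x x)"
    by (simp add: mult.assoc[symmetric] complex_norm_square[symmetric] flip: of_real_power)
  also have "\<dots> = (cmod c * norm x)\<^sup>2"
    by (simp add: power2_norm_eq_inner Re_cinner power_mult_distrib)
  finally show ?thesis by (simp add: power2_eq_iff_nonneg)
qed

lemma scaleC_one: "1 *\<^sub>C x = (x::'a::chilbert_space)"
  using scaleC_of_real[of 1 x] by simp

lemma scaleC_minus1: "(-1) *\<^sub>C x = - (x::'a::chilbert_space)"
  using scaleC_of_real[of "-1" x] by simp

lemma bounded_linear_scaleC: "bounded_linear (\<lambda>x::'a::chilbert_space. c *\<^sub>C x)"
proof (rule bounded_linear_intro[where K="cmod c"])
  show "c *\<^sub>C r *\<^sub>R x = r *\<^sub>R c *\<^sub>C x" for r and x :: 'a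
    by (simp add: scaleC_scaleC mult.commute flip: scaleC_of_real)
qed (simp_all add: scaleC_add_right norm_scaleC)

lemma cinner_add_self: "cinner x y + cinner y x = complex_of_real (2 * inner x y)"
  by (simp add: complex_eq_iff cinner_commute[where y=y and x=x] Re_cinner inner_commute)

lemma clinear_on_diff:
  assumes "clinear_on D f" "x \<in> D" "y \<in> D"
  shows "x - y \<in> D" "f (x - y) = f x - f y"
proof -
  have m: "- y \<in> D \<and> f (- y) = - f y"
    using assms unfolding clinear_on_def by (metis scaleC_minus1)
  then have "x + - y \<in> D \<and> f (x + - y) = f x + f (- y)"
    using assms unfolding clinear_on_def by blast
  with m show "x - y \<in> D" "f (x - y) = f x - f y" by simp_all
qed

lemma clinear_on_add:
  assumes "clinear_on D f" "x \<in> D" "y \<in> D"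
  shows "x + y \<in> D" "f (x + y) = f x + f y"
  using assms unfolding clinear_on_def by blast+

lemma clinear_on_scaleC:
  assumes "clinear_on D f" "x \<in> D"
  shows "c *\<^sub>C x \<in> D" "f (c *\<^sub>C x) = c *\<^sub>C f x"
  using assms unfolding clinear_on_def by blast+

lemma clinear_on_scaleR:
  assumes "clinear_on D f" "x \<in> D"
  shows "r *\<^sub>R x \<in> D" "f (r *\<^sub>R x) = r *\<^sub>R f x"
  using clinear_on_scaleC[OF assms, of "complex_of_real r"] by (simp_all add: scaleC_of_real)

lemma closed_sequentiallyI:
  fixes M :: "'a::metric_space set"
  assumes "\<And>h l. (\<And>n. h n \<in> M) \<Longrightarrow> h \<longlonglongrightarrow> l \<Longrightarrow> l \<in> M"
  shows "closed M"
  using assms unfolding closed_sequential_limits by blast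

section \<open>System nodes\<close>

text \<open>The state is \<open>(l - A)^-1 B u\<close>, with the resolvent extended to the
  extrapolation space: \<open>B u\<close> is a limit of \<open>emb (xs n)\<close>, and since
  \<open>emb\<close> and the resolvent have equal norms, the vectors \<open>R (xs n)\<close>
  converge to some \<open>w\<close>. In the limit \<open>Ae w + B u = emb (l w)\<close>, which is
  the criterion for membership in \<open>Dom S\<close>.\<close>

lemma system_node_input_exists:
  assumes "system_node S l emb Ae B"
  shows "\<exists>x. (x, u) \<in> Dom S"
proof -
  let ?A = "semigroup_generator S"
  define R where "R = resolvent ?A l"
  from assms have node: "bounded_clinear Ae" "bounded_clinear B"
    "\<And>x u. (x, u) \<in> Dom S \<Longrightarrow> Ae x + B u = emb (AB S (x, u))"
    "Dom S = {(x, u). Ae x + B u \<in> range emb}" "extrapolation_space ?A l emb"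
    unfolding system_node_def by auto
  then have emb: "clinear_on UNIV emb" "\<And>x. norm (emb x) = norm (R x)" "closure (range emb) = UNIV"
    and bij: "bij_betw (\<lambda>x. l *\<^sub>C x - app ?A x) (Dom ?A) UNIV" and R: "bounded_linear R"
    by (auto simp: extrapolation_space_def resolvent_set_def R_def bounded_clinear_def)
  interpret R: bounded_linear R by (rule R)
  interpret Ae: bounded_linear Ae using node(1) by (simp add: bounded_clinear_def)
  interpret B: bounded_linear B using node(2) by (simp add: bounded_clinear_def)
  obtain K where K: "\<And>x. norm (R x) \<le> norm x * K" using R.bounded by blast
  have emb_lin: "bounded_linear emb"
    by (rule bounded_linear_intro[where K=K])
      (use clinear_on_add[OF emb(1)] clinear_on_scaleR[OF emb(1)] K emb(2) in auto)
  interpret emb: bounded_linear emb by (rule emb_lin)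
  have res: "R x \<in> Dom ?A \<and> l *\<^sub>C R x - app ?A (R x) = x" for x
  proof -
    have "x \<in> (\<lambda>x. l *\<^sub>C x - app ?A x) ` Dom ?A" using bij by (simp add: bij_betw_def)
    then show ?thesis unfolding R_def resolvent_def
      using inv_into_into[of x _ "Dom ?A"] f_inv_into_f[of x _ "Dom ?A"] by fastforce
  qed
  obtain xs where xs: "(\<lambda>n. emb (xs n)) \<longlonglongrightarrow> B u"
  proof -
    have "B u \<in> closure (range emb)" by (simp add: emb(3))
    then obtain z where z: "\<And>n. z n \<in> range emb" "z \<longlonglongrightarrow> B u" unfolding closure_sequential by blast
    then have "\<forall>n. \<exists>x. z n = emb x" by blast
    then obtain xs where "z = (\<lambda>n. emb (xs n))" by metis
    then show ?thesis using that[of xs] z(2) by simp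
  qed
  have "Cauchy (\<lambda>n. R (xs n))"
  proof (rule CauchyI)
    fix e :: real assume "e > 0"
    then obtain M where "\<And>m n. m \<ge> M \<Longrightarrow> n \<ge> M \<Longrightarrow> norm (emb (xs m) - emb (xs n)) < e"
      using CauchyD[OF LIMSEQ_imp_Cauchy[OF xs]] by blast
    then show "\<exists>M. \<forall>m\<ge>M. \<forall>n\<ge>M. norm (R (xs m) - R (xs n)) < e"
      by (metis R.diff emb.diff emb(2))
  qed
  then obtain w where w: "(\<lambda>n. R (xs n)) \<longlonglongrightarrow> w" using Cauchy_convergent convergent_def by blast
  have eq: "Ae (R (xs n)) = emb (l *\<^sub>C R (xs n)) - emb (xs n)" for n
  proof -
    have "(R (xs n), 0) \<in> Dom S" "AB S (R (xs n), 0) = l *\<^sub>C R (xs n) - xs n"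
      using res[of "xs n"] by (simp_all add: semigroup_generator_def algebra_simps)
    then show ?thesis using node(3)[of "R (xs n)" 0] by (simp add: B.zero emb.diff)
  qed
  have "(\<lambda>n. Ae (R (xs n))) \<longlonglongrightarrow> emb (l *\<^sub>C w) - B u"
    unfolding eq
    by (intro tendsto_diff xs bounded_linear.tendsto[OF emb_lin]
        bounded_linear.tendsto[OF bounded_linear_scaleC] w)
  then have "Ae w = emb (l *\<^sub>C w) - B u" using Ae.tendsto[OF w] LIMSEQ_unique by blast
  then have "Ae w + B u \<in> range emb" by simp
  then show ?thesis using node(4) by blast
qed

text \<open>A description of the node inside \<open>X\<close>: \<open>input_exists\<close> records
  what the control operator and the extrapolation space provide, so that the closed loop can be
  constructed from \<open>S\<close> alone.\<close>

locale passive_node =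
  fixes S :: "('x::chilbert_space \<times> 'u::chilbert_space, 'x \<times> 'u) partial_op"
  assumes linear: "clinear_on (Dom S) (app S)"
    and closed: "closed_op S"
    and generates: "\<exists>T. generates (semigroup_generator S) T"
    and input_exists: "\<exists>x. (x, u) \<in> Dom S"
    and impedance_passive: "impedance_passive S"
begin

lemma passive_inner: "w \<in> Dom S \<Longrightarrow> inner (AB S w) (fst w) \<le> inner (CD S w) (snd w)"
  using impedance_passive by (cases w) (auto simp: impedance_passive_def Re_cinner)

lemma closed_graph:
  assumes "\<And>n. w n \<in> Dom S" "w \<longlonglongrightarrow> w0" "(\<lambda>n. AB S (w n)) \<longlonglongrightarrow> z" "(\<lambda>n. CD S (w n)) \<longlonglongrightarrow> y"
  shows "w0 \<in> Dom S \<and> AB S w0 = z \<and> CD S w0 = y"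
proof -
  let ?G = "{(w, app S w) | w. w \<in> Dom S}"
  have "(\<lambda>n. (w n, (AB S (w n), CD S (w n)))) \<longlonglongrightarrow> (w0, (z, y))"
    by (intro tendsto_Pair assms)
  then have "(\<lambda>n. (w n, app S (w n))) \<longlonglongrightarrow> (w0, (z, y))" by simp
  moreover have "(w n, app S (w n)) \<in> ?G" for n using assms(1) by blast
  ultimately have "(w0, (z, y)) \<in> ?G"
    by (rule closed_sequentially[OF closed[unfolded closed_op_def], rotated])
  then have "w0 \<in> Dom S" "app S w0 = (z, y)" by auto
  then show ?thesis by simp
qed

lemma resolvent_range:
  "\<exists>lam0. \<forall>lam>lam0. \<forall>y. \<exists>w. (w, 0) \<in> Dom S \<and> lam *\<^sub>R w - AB S (w, 0) = y"
proof -
  obtain T where T: "generates (semigroup_generator S) T" using generates by blast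
  then interpret generated_semigroup T "semigroup_generator S"
    by unfold_locales (simp_all add: generates_def)
  show ?thesis using resolvent_range by (simp add: semigroup_generator_def Bex_def)
qed

text \<open>Pairs of a state and its closed-loop output \<open>v\<close>, the input being
  \<open>- v\<close>: the graph of the feedback, kept as a linear subspace.\<close>

definition CL :: "('x \<times> 'u) set"
  where "CL = {(x, v). (x, - v) \<in> Dom S \<and> CD S (x, - v) = v}"

lemma CL_D: "(x, v) \<in> CL \<Longrightarrow> (x, - v) \<in> Dom S" "(x, v) \<in> CL \<Longrightarrow> CD S (x, - v) = v"
  by (simp_all add: CL_def)

lemma CL_add:
  assumes "(x, v) \<in> CL" "(x', v') \<in> CL"
  shows "(x + x', v + v') \<in> CL" "AB S (x + x', - (v + v')) = AB S (x, - v) + AB S (x', - v')"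
  using clinear_on_add[OF linear CL_D(1)[OF assms(1)] CL_D(1)[OF assms(2)]] CL_D(2) assms
  by (simp_all add: CL_def)

lemma CL_diff:
  assumes "(x, v) \<in> CL" "(x', v') \<in> CL"
  shows "(x - x', v - v') \<in> CL" "AB S (x - x', - (v - v')) = AB S (x, - v) - AB S (x', - v')"
  using clinear_on_diff[OF linear CL_D(1)[OF assms(1)] CL_D(1)[OF assms(2)]] CL_D(2) assms
  by (simp_all add: CL_def)

lemma CL_scaleR:
  assumes "(x, v) \<in> CL"
  shows "(r *\<^sub>R x, r *\<^sub>R v) \<in> CL" "AB S (r *\<^sub>R x, - (r *\<^sub>R v)) = r *\<^sub>R AB S (x, - v)"
  using clinear_on_scaleR[OF linear CL_D(1)[OF assms(1)], of r] CL_D(2)[OF assms]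
  by (simp_all add: CL_def)

lemma CL_dissipative: "(x, v) \<in> CL \<Longrightarrow> inner (AB S (x, - v)) x \<le> - (norm v)\<^sup>2"
  using passive_inner[of "(x, - v)"] CL_D by (fastforce simp: power2_norm_eq_inner)

text \<open>The difference \<open>v - v'\<close> is a closed-loop output at the state zero, where
  dissipation forces its squared norm to be at most zero.\<close>

lemma CL_unique:
  assumes "(x, v) \<in> CL" "(x, v') \<in> CL"
  shows "v = v'"
proof -
  have "(0, v - v') \<in> CL" using CL_diff(1)[OF assms] by simp
  from CL_dissipative[OF this] show ?thesis by simp
qed

definition K_dom :: "'x set" where "K_dom = fst ` CL"

definition fb :: "'x \<Rightarrow> 'u" where "fb x = (THE v. (x, v) \<in> CL)"

definition K :: "'x \<Rightarrow> 'x" where "K x = AB S (x, - fb x)"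

lemma fb_eq: "(x, v) \<in> CL \<Longrightarrow> fb x = v"
  unfolding fb_def using CL_unique by blast

lemma K_dom_iff: "x \<in> K_dom \<longleftrightarrow> (x, fb x) \<in> CL"
proof
  assume "x \<in> K_dom"
  then obtain v where "(x, v) \<in> CL" by (auto simp: K_dom_def)
  then show "(x, fb x) \<in> CL" by (simp add: fb_eq)
qed (force simp: K_dom_def)

lemma K_diff:
  assumes "x \<in> K_dom" "y \<in> K_dom"
  shows "x - y \<in> K_dom" "fb (x - y) = fb x - fb y" "K (x - y) = K x - K y"
proof -
  have "(x - y, fb x - fb y) \<in> CL" using CL_diff(1) assms by (simp add: K_dom_iff)
  then show 1: "fb (x - y) = fb x - fb y" and "x - y \<in> K_dom" by (auto simp: fb_eq K_dom_iff)
  show "K (x - y) = K x - K y"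
    using CL_diff(2) assms unfolding K_def 1 by (simp add: K_dom_iff)
qed

lemma K_dissipative: "x \<in> K_dom \<Longrightarrow> inner (K x) x \<le> - (norm (fb x))\<^sup>2"
  by (simp add: K_dom_iff K_def CL_dissipative)

text \<open>On \<open>{(x, u). A&B (x, u) = lam x}\<close> the operator \<open>u + C&D (x, u)\<close> is coercive, and
  hence onto.\<close>

lemma transfer_range:
  assumes lam: "lam > 0" and res: "\<And>y. \<exists>w. (w, 0) \<in> Dom S \<and> lam *\<^sub>R w - AB S (w, 0) = y"
  shows "\<exists>w\<in>Dom S. AB S w = lam *\<^sub>R fst w \<and> snd w + CD S w = h"
proof -
  define W where "W = {w \<in> Dom S. AB S w = lam *\<^sub>R fst w}"
  \<comment> \<open>\<open>W\<close> is the graph of the map from \<open>u\<close> to the state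
    \<open>(lam - A)^-1 B u\<close>, and \<open>\<phi>\<close> is \<open>I + G(lam)\<close> read on
    this graph; passivity makes it coercive in \<open>u = snd w\<close>.\<close>
  define \<phi> where "\<phi> w = snd w + CD S w" for w
  have "0 \<in> Dom S" using linear by (simp add: clinear_on_def)
  moreover have "app S 0 = 0" using clinear_on_diff(2)[OF linear calculation calculation] by simp
  ultimately have W0: "0 \<in> W" and \<phi>0: "\<phi> 0 = 0" by (simp_all add: W_def \<phi>_def)
  have Wadd: "v + w \<in> W \<and> \<phi> (v + w) = \<phi> v + \<phi> w" if "v \<in> W" "w \<in> W" for v w
    using that clinear_on_add[OF linear, of v w] by (simp add: W_def \<phi>_def scaleR_add_right)
  have Wdiff: "v - w \<in> W \<and> \<phi> (v - w) = \<phi> v - \<phi> w" if "v \<in> W" "w \<in> W" for v w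
    using that clinear_on_diff[OF linear, of v w] by (simp add: W_def \<phi>_def scaleR_diff_right)
  have Wscale: "r *\<^sub>R w \<in> W \<and> \<phi> (r *\<^sub>R w) = r *\<^sub>R \<phi> w" if "w \<in> W" for r w
    using that clinear_on_scaleR[OF linear, of w r] by (simp add: W_def \<phi>_def scaleR_add_right)
  have coercive: "(norm (snd w))\<^sup>2 + lam * (norm (fst w))\<^sup>2 \<le> inner (\<phi> w) (snd w)" if "w \<in> W" for w
    using passive_inner[of w] that
    by (simp add: W_def \<phi>_def inner_add_left power2_norm_eq_inner)
  have bound: "norm (snd w) \<le> norm (\<phi> w) \<and> lam * (norm (fst w))\<^sup>2 \<le> (norm (\<phi> w))\<^sup>2" if "w \<in> W" for w
  proof -
    have cs: "inner (\<phi> w) (snd w) \<le> norm (\<phi> w) * norm (snd w)" by (rule norm_cauchy_schwarz)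
    have p: "0 \<le> lam * (norm (fst w))\<^sup>2" using lam by simp
    have "norm (snd w) * norm (snd w) \<le> norm (\<phi> w) * norm (snd w)"
      using coercive[OF that] cs p by (simp add: power2_eq_square)
    then have a: "norm (snd w) \<le> norm (\<phi> w)"
      by (metis mult_right_le_imp_le norm_ge_zero order_le_less)
    have "lam * (norm (fst w))\<^sup>2 \<le> norm (\<phi> w) * norm (snd w)"
      using coercive[OF that] cs by (smt (verit) zero_le_power2)
    also have "\<dots> \<le> norm (\<phi> w) * norm (\<phi> w)" using a by (simp add: mult_left_mono)
    finally show ?thesis using a by (simp add: power2_eq_square)
  qed
  have onto: "\<exists>w\<in>W. snd w = u" for u
  proof -
    \<comment> \<open>Any state that goes with \<open>u\<close> is corrected by a resolvent solution
      with zero input.\<close>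
    obtain x1 where x1: "(x1, u) \<in> Dom S" using input_exists by blast
    obtain w where w: "(w, 0) \<in> Dom S" "lam *\<^sub>R w - AB S (w, 0) = AB S (x1, u) - lam *\<^sub>R x1"
      using res by blast
    then have "(x1 + w, u) \<in> W"
      using clinear_on_add[OF linear x1 w(1)] by (simp add: W_def algebra_simps)
    then show ?thesis by force
  qed
  have sub: "subspace (\<phi> ` W)"
  proof (rule subspaceI)
    show "0 \<in> \<phi> ` W" using W0 \<phi>0 by force
    fix x y c assume "x \<in> \<phi> ` W"
    then obtain v where v: "v \<in> W" "x = \<phi> v" by blast
    then have "c *\<^sub>R x = \<phi> (c *\<^sub>R v)" "c *\<^sub>R v \<in> W" using Wscale by auto
    then show "c *\<^sub>R x \<in> \<phi> ` W" by blast
    assume "y \<in> \<phi> ` W"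
    then obtain w where "w \<in> W" "y = \<phi> w" by blast
    then have "x + y = \<phi> (v + w)" "v + w \<in> W" using Wadd v by auto
    then show "x + y \<in> \<phi> ` W" by blast
  qed
  \<comment> \<open>Coercivity bounds both components of \<open>w\<close> by
    \<open>\<phi> w\<close>, so convergent values have convergent preimages, and closedness of
    \<open>S\<close> puts the limit in \<open>W\<close>.\<close>
  have clo: "closed (\<phi> ` W)"
  proof (rule closed_sequentiallyI)
    fix h l assume h: "\<And>n::nat. h n \<in> \<phi> ` W" and hl: "h \<longlonglongrightarrow> l"
    have "\<forall>n. \<exists>w. w \<in> W \<and> \<phi> w = h n"
      using h[unfolded image_iff] by metis
    from choice[OF this] obtain w where "\<forall>n. w n \<in> W \<and> \<phi> (w n) = h n" ..
    then have w: "w n \<in> W" "\<phi> (w n) = h n" for n by simp_all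
    have d: "norm (snd (w m) - snd (w n)) \<le> norm (h m - h n)"
      "sqrt lam * norm (fst (w m) - fst (w n)) \<le> norm (h m - h n)" for m n
    proof -
      have *: "norm (snd (w m - w n)) \<le> norm (h m - h n) \<and> lam * (norm (fst (w m - w n)))\<^sup>2 \<le> (norm (h m - h n))\<^sup>2"
        using bound[of "w m - w n"] Wdiff[OF w(1) w(1)] by (simp add: w(2))
      then show "norm (snd (w m) - snd (w n)) \<le> norm (h m - h n)" by simp
      have "(sqrt lam * norm (fst (w m) - fst (w n)))\<^sup>2 \<le> (norm (h m - h n))\<^sup>2"
        using * lam by (simp add: power_mult_distrib)
      then show "sqrt lam * norm (fst (w m) - fst (w n)) \<le> norm (h m - h n)"
        by (rule power2_le_imp_le) simp
    qed
    have "Cauchy (\<lambda>n. snd (w n))"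
    proof (rule CauchyI)
      fix e :: real assume "e > 0"
      then show "\<exists>M. \<forall>m\<ge>M. \<forall>n\<ge>M. norm (snd (w m) - snd (w n)) < e"
        using CauchyD[OF LIMSEQ_imp_Cauchy[OF hl]] d(1) by (meson order_le_less_trans)
    qed
    then obtain u where u: "(\<lambda>n. snd (w n)) \<longlonglongrightarrow> u" using Cauchy_convergent convergent_def by blast
    have "Cauchy (\<lambda>n. fst (w n))"
    proof (rule CauchyI)
      fix e :: real assume "e > 0"
      then have "sqrt lam * e > 0" using lam by simp
      then obtain M where "\<And>m n. m \<ge> M \<Longrightarrow> n \<ge> M \<Longrightarrow> norm (h m - h n) < sqrt lam * e"
        using CauchyD[OF LIMSEQ_imp_Cauchy[OF hl]] by blast
      then have "\<And>m n. m \<ge> M \<Longrightarrow> n \<ge> M \<Longrightarrow> sqrt lam * norm (fst (w m) - fst (w n)) < sqrt lam * e"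
        using d(2) by (meson order_le_less_trans)
      then show "\<exists>M. \<forall>m\<ge>M. \<forall>n\<ge>M. norm (fst (w m) - fst (w n)) < e"
        using lam by (intro exI[of _ M]) (auto simp: mult_less_cancel_left)
    qed
    then obtain x where x: "(\<lambda>n. fst (w n)) \<longlonglongrightarrow> x" using Cauchy_convergent convergent_def by blast
    have CDw: "CD S (w n) = h n - snd (w n)" for n using w(2)[of n] by (simp add: \<phi>_def algebra_simps)
    have ABw: "AB S (w n) = lam *\<^sub>R fst (w n)" for n using w(1)[of n] by (simp add: W_def)
    have "(x, u) \<in> Dom S \<and> AB S (x, u) = lam *\<^sub>R x \<and> CD S (x, u) = l - u"
    proof (rule closed_graph)
      show "w n \<in> Dom S" for n using w(1)[of n] by (simp add: W_def)
      show "w \<longlonglongrightarrow> (x, u)" using tendsto_Pair[OF x u] by simp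
      show "(\<lambda>n. AB S (w n)) \<longlonglongrightarrow> lam *\<^sub>R x" unfolding ABw by (intro tendsto_intros x)
      show "(\<lambda>n. CD S (w n)) \<longlonglongrightarrow> l - u" unfolding CDw by (intro tendsto_intros hl u)
    qed
    then have "(x, u) \<in> W" "\<phi> (x, u) = l" by (simp_all add: W_def \<phi>_def)
    then show "l \<in> \<phi> ` W" by blast
  qed
  have zero: "z = 0" if orth: "\<And>m. m \<in> \<phi> ` W \<Longrightarrow> inner z m = 0" for z
  proof -
    \<comment> \<open>Choosing the element whose input is \<open>z\<close> itself makes the
      right-hand side of the coercivity estimate vanish.\<close>
    obtain w where w: "w \<in> W" "snd w = z" using onto by blast
    then have "inner (\<phi> w) z = 0" using orth[of "\<phi> w"] by (simp add: inner_commute[of _ z])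
    with coercive[OF w(1)] have "(norm z)\<^sup>2 + lam * (norm (fst w))\<^sup>2 \<le> 0" using w(2) by simp
    moreover have "0 \<le> lam * (norm (fst w))\<^sup>2" using lam by simp
    ultimately have "(norm z)\<^sup>2 \<le> 0" by linarith
    then show ?thesis by simp
  qed
  have "h \<in> \<phi> ` W"
  proof (rule ccontr)
    assume "h \<notin> \<phi> ` W"
    from orthogonal_to_closed_subspace_exists[OF sub clo this] show False
      by (metis zero)
  qed
  then obtain w where "w \<in> W" "\<phi> w = h" by blast
  then show ?thesis unfolding W_def \<phi>_def by blast
qed

text \<open>The substance is the range condition. Take \<open>w = (lam - A)^-1 y\<close> with zero
  input and add an element of the graph of the transfer function whose input plus output cancels the
  output of \<open>w\<close>; then the total output is minus the total input.\<close>

lemma K_maximal_dissipative: "\<exists>lam0. maximal_dissipative K_dom K lam0"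
proof -
  obtain lam0 where res: "\<And>lam y. lam > lam0 \<Longrightarrow> \<exists>w. (w, 0) \<in> Dom S \<and> lam *\<^sub>R w - AB S (w, 0) = y"
    using resolvent_range by blast
  have add: "x + y \<in> K_dom \<and> K (x + y) = K x + K y" if "x \<in> K_dom" "y \<in> K_dom" for x y
  proof -
    have "fb (x + y) = fb x + fb y" using CL_add(1) fb_eq that K_dom_iff by blast
    then show ?thesis using CL_add that by (simp add: K_dom_iff K_def)
  qed
  have scale: "r *\<^sub>R x \<in> K_dom \<and> K (r *\<^sub>R x) = r *\<^sub>R K x" if "x \<in> K_dom" for x r
  proof -
    have "fb (r *\<^sub>R x) = r *\<^sub>R fb x" using CL_scaleR(1) fb_eq that K_dom_iff by blast
    then show ?thesis using CL_scaleR that by (simp add: K_dom_iff K_def)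
  qed
  have range: "\<exists>x\<in>K_dom. lam *\<^sub>R x - K x = y" if lam: "lam > max lam0 0" for lam y
  proof -
    obtain w where w: "(w, 0) \<in> Dom S" "lam *\<^sub>R w - AB S (w, 0) = y" using res[of lam] lam by auto
    obtain p where p: "p \<in> Dom S" "AB S p = lam *\<^sub>R fst p" "snd p + CD S p = - CD S (w, 0)"
      using transfer_range[of lam "- CD S (w, 0)"] res lam by auto
    obtain x u where xu: "p = (x, u)" by (cases p)
    have s: "(w + x, u) \<in> Dom S" "app S (w + x, u) = app S (w, 0) + app S (x, u)"
      using clinear_on_add[OF linear w(1) p(1)] xu by auto
    have "CD S (w + x, u) = - u" using p(3) by (simp add: s(2) xu algebra_simps eq_neg_iff_add_eq_0)
    then have CLx: "(w + x, - u) \<in> CL" using s(1) by (simp add: CL_def)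
    then have "K (w + x) = AB S (w, 0) + lam *\<^sub>R x" using p(2) by (simp add: K_def fb_eq s(2) xu)
    then have "lam *\<^sub>R (w + x) - K (w + x) = y" using w(2) by (simp add: algebra_simps)
    then show ?thesis using CLx fb_eq K_dom_iff by metis
  qed
  obtain x0 where "x0 \<in> K_dom" using range[of "max lam0 0 + 1" 0] by auto
  then have "0 \<in> K_dom" using scale[of x0 0] by simp
  then have "subspace K_dom" using add scale by (auto simp: subspace_def)
  then have "maximal_dissipative K_dom K (max lam0 0)"
  proof (unfold_locales)
    show "inner (K x) x \<le> 0" if "x \<in> K_dom" for x
      using K_dissipative[OF that] by (rule order_trans) simp
    show "\<exists>x\<in>K_dom. lam *\<^sub>R x - K x = y" if "lam > max lam0 0" for lam y
      by (rule range[OF that])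
  qed (simp_all add: add scale)
  then show ?thesis by blast
qed

end

section \<open>Square-integrable functions\<close>

text \<open>The function is sampled at the grid point below \<open>t\<close>, with mesh
  \<open>1 / m\<close> fine enough for uniform continuity on \<open>[0, R]\<close>. Composition with
  the real simple function \<open>q\<close> settles measurability whatever the target space.\<close>

lemma simple_function_approximates_continuous:
  fixes f :: "real \<Rightarrow> 'a::metric_space"
  assumes f: "continuous_on {0..} f" and "e > 0"
  obtains s where "simple_function (lebesgue_on {0..}) s" "\<And>t. 0 \<le> t \<Longrightarrow> t < R \<Longrightarrow> dist (s t) (f t) < e"
proof -
  have "uniformly_continuous_on {0..R} f"
    by (rule compact_uniformly_continuous) (auto intro: continuous_on_subset[OF f])
  then obtain d where d: "d > 0"
    "\<And>s t. s \<in> {0..R} \<Longrightarrow> t \<in> {0..R} \<Longrightarrow> dist s t < d \<Longrightarrow> dist (f s) (f t) < e"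
    using \<open>e > 0\<close> unfolding uniformly_continuous_on_def by metis
  obtain m :: nat where m: "1 / d < real m" using reals_Archimedean2 by blast
  have m0: "real m > 0" using m d(1) by (meson less_trans zero_less_divide_1_iff)
  define q where "q t = (if 0 \<le> t \<and> t < R then real_of_int \<lfloor>t * m\<rfloor> / m else 0)" for t
  have "q \<in> borel_measurable borel" unfolding q_def by measurable
  then have "q \<in> borel_measurable (lebesgue_on {0..})"
    by (intro measurable_restrict_space1 measurable_completion) simp
  moreover have "finite (q ` space (lebesgue_on {0..}))"
  proof (rule finite_subset)
    show "q ` space (lebesgue_on {0..}) \<subseteq> (\<lambda>i. real_of_int i / m) ` {0..\<lfloor>R * m\<rfloor>} \<union> {0}"
    proof
      fix r assume "r \<in> q ` space (lebesgue_on {0..})"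
      then obtain t where t: "r = q t" by blast
      show "r \<in> (\<lambda>i. real_of_int i / m) ` {0..\<lfloor>R * m\<rfloor>} \<union> {0}"
      proof (cases "0 \<le> t \<and> t < R")
        case True
        then have "0 \<le> \<lfloor>t * m\<rfloor>" "\<lfloor>t * m\<rfloor> \<le> \<lfloor>R * m\<rfloor>"
          by (auto intro!: floor_mono mult_right_mono)
        then show ?thesis using True by (auto simp: t q_def)
      qed (simp only: t q_def, simp)
    qed
  qed simp
  ultimately have "simple_function (lebesgue_on {0..}) q" by (rule simple_function_borel_measurable)
  then have "simple_function (lebesgue_on {0..}) (f \<circ> q)" by (rule simple_function_compose)
  moreover have "dist ((f \<circ> q) t) (f t) < e" if t: "0 \<le> t" "t < R" for t
  proof -
    have b: "real_of_int \<lfloor>t * m\<rfloor> \<le> t * m" "t * m < real_of_int \<lfloor>t * m\<rfloor> + 1" by linarith+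
    have "0 \<le> real_of_int \<lfloor>t * m\<rfloor>" using t by simp
    then have "0 \<le> q t" using t by (simp add: q_def)
    moreover have "q t \<le> t" using b(1) m0 t by (simp add: q_def field_simps)
    moreover have "(t - q t) * m = t * m - real_of_int \<lfloor>t * m\<rfloor>"
      using m0 t by (simp add: q_def left_diff_distrib)
    then have "(t - q t) * m < 1" using b(2) by linarith
    then have "t - q t < 1 / m" using m0 by (simp add: pos_less_divide_eq)
    moreover have "1 / m < d" using m m0 d(1) by (simp add: field_simps)
    ultimately show ?thesis using t by (auto intro!: d(2) simp: dist_real_def)
  qed
  ultimately show ?thesis using that by blast
qed

text \<open>A diagonal choice: the \<open>n\<close>-th simple function is within
  \<open>1 / Suc n\<close> of \<open>f n\<close> on \<open>[0, n)\<close>, and every fixed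
  \<open>t\<close> eventually lies there.\<close>

lemma strongly_measurable_limit_continuous:
  assumes f: "\<And>n. continuous_on {0..} (f n)"
    and lim: "AE t in lebesgue_on {0..}. (\<lambda>n. f n t) \<longlonglongrightarrow> g t"
  shows "strongly_measurable g"
proof -
  have "\<exists>s. simple_function (lebesgue_on {0..}) s \<and>
      (\<forall>t. 0 \<le> t \<longrightarrow> t < real n \<longrightarrow> dist (s t) (f n t) < 1 / Suc n)" for n
    by (rule simple_function_approximates_continuous[OF f, where e="1 / real (Suc n)" and R="real n"]) auto
  then obtain s where s: "\<And>n. simple_function (lebesgue_on {0..}) (s n)"
    "\<And>n t. 0 \<le> t \<Longrightarrow> t < real n \<Longrightarrow> dist (s n t) (f n t) < 1 / Suc n" by metis
  have "(\<lambda>n. s n t) \<longlonglongrightarrow> g t" if "0 \<le> t" and ft: "(\<lambda>n. f n t) \<longlonglongrightarrow> g t" for t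
  proof -
    obtain N where N: "t < real N" using reals_Archimedean2 by blast
    have "dist (s n t) (f n t) \<le> 1 / Suc n" if "n \<ge> N" for n
      using s(2)[OF \<open>0 \<le> t\<close>, of n] that N by simp
    then have "\<forall>\<^sub>F n in sequentially. norm (dist (s n t) (f n t)) \<le> 1 / Suc n"
      unfolding eventually_sequentially by (intro exI[of _ N]) simp
    then have "(\<lambda>n. dist (s n t) (f n t)) \<longlonglongrightarrow> 0"
      by (rule Lim_null_comparison) (rule LIMSEQ_Suc[OF lim_1_over_n])
    moreover have "(\<lambda>n. dist (f n t) (g t)) \<longlonglongrightarrow> 0" using ft by (simp add: tendsto_dist_iff[symmetric])
    ultimately have "(\<lambda>n. dist (s n t) (f n t) + dist (f n t) (g t)) \<longlonglongrightarrow> 0"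
      using tendsto_add[of _ 0 _ _ 0] by fastforce
    then have "(\<lambda>n. dist (s n t) (g t)) \<longlonglongrightarrow> 0"
      by (rule tendsto_sandwich[OF _ _ tendsto_const, rotated 2]) (auto simp: dist_triangle)
    then show ?thesis by (simp add: tendsto_dist_iff[symmetric])
  qed
  then have "AE t in lebesgue_on {0..}. (\<lambda>n. s n t) \<longlonglongrightarrow> g t"
    using lim by (auto simp: AE_restrict_space_iff)
  then show ?thesis using s(1) unfolding strongly_measurable_def by blast
qed

lemma strongly_measurable_continuous: "continuous_on {0..} f \<Longrightarrow> strongly_measurable f"
  by (rule strongly_measurable_limit_continuous[of "\<lambda>_. f"]) auto

lemma strongly_measurable_map2:
  assumes "strongly_measurable f" "strongly_measurable g"
    and h: "\<And>a b s t. a \<longlonglongrightarrow> s \<Longrightarrow> b \<longlonglongrightarrow> t \<Longrightarrow> (\<lambda>n. h (a n) (b n)) \<longlonglongrightarrow> h s t"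
  shows "strongly_measurable (\<lambda>t. h (f t) (g t))"
proof -
  obtain a b where ab: "\<And>n. simple_function (lebesgue_on {0..}) (a n)"
    "\<And>n. simple_function (lebesgue_on {0..}) (b n)"
    "AE t in lebesgue_on {0..}. (\<lambda>n. a n t) \<longlonglongrightarrow> f t" "AE t in lebesgue_on {0..}. (\<lambda>n. b n t) \<longlonglongrightarrow> g t"
    using assms(1,2) unfolding strongly_measurable_def by blast
  have "simple_function (lebesgue_on {0..}) (\<lambda>t. h (a n t) (b n t))" for n
    by (rule simple_function_compose2[OF ab(1,2)])
  moreover have "AE t in lebesgue_on {0..}. (\<lambda>n. h (a n t) (b n t)) \<longlonglongrightarrow> h (f t) (g t)"
    using ab(3,4) by eventually_elim (rule h)
  ultimately show ?thesis unfolding strongly_measurable_def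
    by (intro exI[of _ "\<lambda>n t. h (a n t) (b n t)"]) blast
qed

lemma strongly_measurable_add:
  "strongly_measurable f \<Longrightarrow> strongly_measurable g \<Longrightarrow> strongly_measurable (\<lambda>t. f t + g t)"
  by (rule strongly_measurable_map2) (auto intro: tendsto_add)

lemma strongly_measurable_diff:
  "strongly_measurable f \<Longrightarrow> strongly_measurable g \<Longrightarrow> strongly_measurable (\<lambda>t. f t - g t)"
  by (rule strongly_measurable_map2) (auto intro: tendsto_diff)

lemma strongly_measurable_scaleC:
  "strongly_measurable f \<Longrightarrow> strongly_measurable (\<lambda>t. c *\<^sub>C f t)"
  by (rule strongly_measurable_map2[where h="\<lambda>a _. c *\<^sub>C a"])
    (auto intro: bounded_linear.tendsto[OF bounded_linear_scaleC])

section \<open>Squared L^2 norms with extended nonnegative values\<close>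

definition energy :: "real set \<Rightarrow> (real \<Rightarrow> 'a::chilbert_space) \<Rightarrow> ennreal"
  where "energy A f = (\<integral>\<^sup>+t\<in>A. ennreal ((norm (f t))\<^sup>2) \<partial>lebesgue)"

text \<open>Strong measurability says nothing about negative times, hence the indicator. The norm is
  an almost everywhere limit of real simple functions, and completeness of Lebesgue measure absorbs
  the null set.\<close>

lemma borel_measurable_norm:
  assumes "strongly_measurable f"
  shows "(\<lambda>t. norm (f t) * indicator {0..} t) \<in> borel_measurable lebesgue"
proof -
  obtain s where s: "\<And>n. simple_function (lebesgue_on {0..}) (s n)"
    "AE t in lebesgue_on {0..}. (\<lambda>n. s n t) \<longlonglongrightarrow> f t"
    using assms unfolding strongly_measurable_def by blast
  define h where "h n t = norm (s n t) * indicator {0..} t" for n t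
  have h: "h n \<in> borel_measurable lebesgue" for n
  proof -
    have "(\<lambda>t. norm (s n t)) \<in> borel_measurable (lebesgue_on {0..})"
      by (intro borel_measurable_simple_function simple_function_compose1[OF s(1)])
    then show ?thesis
      unfolding h_def by (subst (asm) borel_measurable_restrict_space_iff) (auto simp: mult.commute)
  qed
  have "(\<lambda>t. lim (\<lambda>n. h n t)) \<in> borel_measurable lebesgue" by (intro borel_measurable_lim_metric h)
  then show ?thesis
  proof (rule borel_measurable_AE)
    have "AE t in lebesgue. t \<in> {0..} \<longrightarrow> (\<lambda>n. s n t) \<longlonglongrightarrow> f t"
      using s(2) by (simp add: AE_restrict_space_iff)
    then show "AE t in lebesgue. lim (\<lambda>n. h n t) = norm (f t) * indicator {0..} t"
      by eventually_elim (auto simp: h_def indicator_def intro!: limI tendsto_norm)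
  qed
qed

lemma borel_measurable_energy:
  assumes "strongly_measurable f" "A \<in> sets lebesgue" "A \<subseteq> {0..}"
  shows "(\<lambda>t. ennreal ((norm (f t))\<^sup>2) * indicator A t) \<in> borel_measurable lebesgue"
proof -
  have "(\<lambda>t. ennreal ((norm (f t) * indicator {0..} t)\<^sup>2) * indicator A t) \<in> borel_measurable lebesgue"
    using borel_measurable_norm[OF assms(1)] assms(2) by measurable
  also have "(\<lambda>t. ennreal ((norm (f t) * indicator {0..} t)\<^sup>2) * indicator A t)
      = (\<lambda>t. ennreal ((norm (f t))\<^sup>2) * indicator A t)"
    using assms(3) by (auto simp: indicator_def fun_eq_iff)
  finally show ?thesis .
qed

lemma energy_le_sum:
  assumes f: "strongly_measurable f" "strongly_measurable g" and A: "A \<in> sets lebesgue" "A \<subseteq> {0..}"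
    and c: "c \<ge> 0" "d \<ge> 0"
    and le: "\<And>t. t \<in> A \<Longrightarrow> (norm (h t))\<^sup>2 \<le> c * (norm (f t))\<^sup>2 + d * (norm (g t))\<^sup>2"
  shows "energy A h \<le> ennreal c * energy A f + ennreal d * energy A g"
proof -
  let ?F = "\<lambda>t. ennreal ((norm (f t))\<^sup>2) * indicator A t"
  let ?G = "\<lambda>t. ennreal ((norm (g t))\<^sup>2) * indicator A t"
  note [measurable] = borel_measurable_energy[OF f(1) A] borel_measurable_energy[OF f(2) A]
  have "energy A h \<le> (\<integral>\<^sup>+t. ennreal c * ?F t
      + ennreal d * ?G t \<partial>lebesgue)"
    unfolding energy_def
  proof (rule nn_integral_mono)
    fix t
    show "ennreal ((norm (h t))\<^sup>2) * indicator A t \<le> ennreal c * ?F t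
      + ennreal d * ?G t"
    proof (cases "t \<in> A")
      case True
      then show ?thesis using ennreal_leI[OF le[OF True]] c by (simp add: ennreal_plus ennreal_mult)
    qed simp
  qed
  also have "\<dots> = ennreal c * energy A f + ennreal d * energy A g"
    unfolding energy_def by (simp add: nn_integral_add nn_integral_cmult)
  finally show ?thesis .
qed

lemma energy_eq_sum:
  assumes f: "strongly_measurable f" "strongly_measurable g"
    "strongly_measurable h" "strongly_measurable k" and A: "A \<in> sets lebesgue" "A \<subseteq> {0..}"
    and eq: "\<And>t. t \<in> A \<Longrightarrow> (norm (h t))\<^sup>2 + (norm (k t))\<^sup>2 = c * (norm (f t))\<^sup>2 + d * (norm (g t))\<^sup>2"
    and c: "c \<ge> 0" "d \<ge> 0"
  shows "energy A h + energy A k = ennreal c * energy A f + ennreal d * energy A g"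
proof -
  let ?F = "\<lambda>t. ennreal ((norm (f t))\<^sup>2) * indicator A t"
  let ?G = "\<lambda>t. ennreal ((norm (g t))\<^sup>2) * indicator A t"
  note [measurable] = borel_measurable_energy[OF f(1) A] borel_measurable_energy[OF f(2) A]
  have "energy A h + energy A k = (\<integral>\<^sup>+t. ennreal ((norm (h t))\<^sup>2) * indicator A t
      + ennreal ((norm (k t))\<^sup>2) * indicator A t \<partial>lebesgue)"
    unfolding energy_def using f A by (simp add: nn_integral_add borel_measurable_energy)
  also have "\<dots> = (\<integral>\<^sup>+t. ennreal c * ?F t
      + ennreal d * ?G t \<partial>lebesgue)"
  proof (rule nn_integral_cong)
    fix t
    show "ennreal ((norm (h t))\<^sup>2) * indicator A t + ennreal ((norm (k t))\<^sup>2) * indicator A t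
      = ennreal c * ?F t
      + ennreal d * ?G t"
    proof (cases "t \<in> A")
      case True
      then show ?thesis using arg_cong[OF eq[OF True], of ennreal] c by (simp add: ennreal_plus ennreal_mult)
    qed simp
  qed
  also have "\<dots> = ennreal c * energy A f + ennreal d * energy A g"
    unfolding energy_def by (simp add: nn_integral_add nn_integral_cmult)
  finally show ?thesis .
qed

lemma energy_parallelogram:
  assumes "strongly_measurable f" "strongly_measurable g" "A \<in> sets lebesgue" "A \<subseteq> {0..}"
  shows "energy A (\<lambda>t. f t + g t) + energy A (\<lambda>t. f t - g t) = 2 * energy A f + 2 * energy A g"
proof -
  have "energy A (\<lambda>t. f t + g t) + energy A (\<lambda>t. f t - g t) = ennreal 2 * energy A f + ennreal 2 * energy A g"
    by (rule energy_eq_sum)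
      (use assms in \<open>auto simp: strongly_measurable_add strongly_measurable_diff power2_norm_eq_inner
        inner_add_left inner_add_right inner_diff_left inner_diff_right inner_commute\<close>)
  then show ?thesis by simp
qed

lemma energy_scaleC:
  assumes "strongly_measurable f" "A \<in> sets lebesgue" "A \<subseteq> {0..}"
  shows "energy A (\<lambda>t. c *\<^sub>C f t) = ennreal ((cmod c)\<^sup>2) * energy A f"
proof -
  have "energy A (\<lambda>t. c *\<^sub>C f t) = (\<integral>\<^sup>+t. ennreal ((cmod c)\<^sup>2) * (ennreal ((norm (f t))\<^sup>2) * indicator A t) \<partial>lebesgue)"
    unfolding energy_def
    by (intro nn_integral_cong) (simp add: norm_scaleC power_mult_distrib ennreal_mult mult.assoc)
  also have "\<dots> = ennreal ((cmod c)\<^sup>2) * energy A f"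
    unfolding energy_def by (intro nn_integral_cmult borel_measurable_energy assms)
  finally show ?thesis .
qed

lemma energy_add_le:
  assumes "strongly_measurable f" "strongly_measurable g" "A \<in> sets lebesgue" "A \<subseteq> {0..}"
  shows "energy A (\<lambda>t. f t + g t) \<le> 2 * energy A f + 2 * energy A g"
  unfolding energy_parallelogram[OF assms, symmetric] by simp

lemma energy_mono: "A \<subseteq> B \<Longrightarrow> energy A f \<le> energy B f"
  unfolding energy_def by (intro nn_integral_mono) (auto simp: indicator_def)

lemma L2_loc_iff: "f \<in> L2_loc \<longleftrightarrow> strongly_measurable f \<and> (\<forall>\<tau>\<ge>0. energy {0..\<tau>} f < \<infinity>)"
  by (simp add: L2_loc_def energy_def)

lemma L2_iff: "f \<in> L2 \<longleftrightarrow> strongly_measurable f \<and> energy {0..} f < \<infinity>"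
  by (simp add: L2_def energy_def)

lemma L2_loc_converges_iff:
  "L2_loc_converges fs f \<longleftrightarrow> (\<forall>\<tau>\<ge>0. (\<lambda>k. energy {0..\<tau>} (\<lambda>t. fs k t - f t)) \<longlonglongrightarrow> 0)"
  by (simp add: L2_loc_converges_def energy_def)

lemma L2_loc_add: "f \<in> L2_loc \<Longrightarrow> g \<in> L2_loc \<Longrightarrow> (\<lambda>t. f t + g t) \<in> L2_loc"
  unfolding L2_loc_iff
  by (auto simp: strongly_measurable_add ennreal_mult_less_top intro: le_less_trans[OF energy_add_le])

lemma L2_loc_scaleC: "f \<in> L2_loc \<Longrightarrow> (\<lambda>t. c *\<^sub>C f t) \<in> L2_loc"
  unfolding L2_loc_iff
  by (auto simp: strongly_measurable_scaleC energy_scaleC ennreal_mult_less_top)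

lemma L2_loc_diff: "f \<in> L2_loc \<Longrightarrow> g \<in> L2_loc \<Longrightarrow> (\<lambda>t. f t - g t) \<in> L2_loc"
  using L2_loc_add[of f "\<lambda>t. (-1) *\<^sub>C g t"] L2_loc_scaleC[of g "-1"] by (simp add: scaleC_minus1)

lemma energy_continuous:
  assumes "continuous_on {0..} f"
  shows "energy {0..\<tau>} f = ennreal (integral {0..\<tau>} (\<lambda>t. (norm (f t))\<^sup>2))"
proof -
  have "continuous_on {0..\<tau>} (\<lambda>t. (norm (f t))\<^sup>2)"
    by (intro continuous_intros continuous_on_subset[OF assms]) auto
  then have "((\<lambda>t. (norm (f t))\<^sup>2) has_integral integral {0..\<tau>} (\<lambda>t. (norm (f t))\<^sup>2)) {0..\<tau>}"
    by (intro integrable_integral integrable_continuous_interval)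
  then show ?thesis
    unfolding energy_def nn_integral_completion
    by (intro nn_integral_has_integral_lebesgue') auto
qed

lemma L2_loc_continuous: "continuous_on {0..} f \<Longrightarrow> f \<in> L2_loc"
  by (simp add: L2_loc_iff strongly_measurable_continuous energy_continuous)

lemma L2_loc_converges_add:
  assumes "L2_loc_converges fs f" "L2_loc_converges gs g"
    and "\<And>k. fs k \<in> L2_loc" "\<And>k. gs k \<in> L2_loc" "f \<in> L2_loc" "g \<in> L2_loc"
  shows "L2_loc_converges (\<lambda>k t. fs k t + gs k t) (\<lambda>t. f t + g t)"
  unfolding L2_loc_converges_iff
proof (intro allI impI)
  fix \<tau> :: real assume "\<tau> \<ge> 0"
  let ?E = "\<lambda>k. 2 * energy {0..\<tau>} (\<lambda>t. fs k t - f t) + 2 * energy {0..\<tau>} (\<lambda>t. gs k t - g t)"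
  have le: "energy {0..\<tau>} (\<lambda>t. fs k t + gs k t - (f t + g t))
      \<le> ?E k" for k
  proof -
    have "energy {0..\<tau>} (\<lambda>t. (fs k t - f t) + (gs k t - g t))
      \<le> ?E k"
      by (rule energy_add_le) (use assms in \<open>auto simp: L2_loc_iff strongly_measurable_diff\<close>)
    then show ?thesis by (simp add: algebra_simps)
  qed
  have "?E \<longlonglongrightarrow> 2 * 0 + 2 * 0"
    using assms(1,2) \<open>\<tau> \<ge> 0\<close> unfolding L2_loc_converges_iff
    by (intro tendsto_add ennreal_tendsto_cmult) auto
  then have "?E \<longlonglongrightarrow> 0"
    by simp
  then show "(\<lambda>k. energy {0..\<tau>} (\<lambda>t. fs k t + gs k t - (f t + g t))) \<longlonglongrightarrow> 0"
    by (rule tendsto_sandwich[OF _ _ tendsto_const, rotated 2]) (use le in \<open>auto intro: always_eventually\<close>)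
qed

lemma L2_loc_converges_scaleC:
  assumes "L2_loc_converges fs f" "\<And>k. fs k \<in> L2_loc" "f \<in> L2_loc"
  shows "L2_loc_converges (\<lambda>k t. c *\<^sub>C fs k t) (\<lambda>t. c *\<^sub>C f t)"
  unfolding L2_loc_converges_iff
proof (intro allI impI)
  fix \<tau> :: real assume "\<tau> \<ge> 0"
  have "energy {0..\<tau>} (\<lambda>t. c *\<^sub>C fs k t - c *\<^sub>C f t) = ennreal ((cmod c)\<^sup>2) * energy {0..\<tau>} (\<lambda>t. fs k t - f t)" for k
    unfolding linear_diff[OF bounded_linear.linear[OF bounded_linear_scaleC], symmetric]
    by (rule energy_scaleC) (use assms in \<open>auto simp: L2_loc_iff strongly_measurable_diff\<close>)
  moreover have "(\<lambda>k. ennreal ((cmod c)\<^sup>2) * energy {0..\<tau>} (\<lambda>t. fs k t - f t)) \<longlonglongrightarrow> ennreal ((cmod c)\<^sup>2) * 0"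
    using assms(1) \<open>\<tau> \<ge> 0\<close> unfolding L2_loc_converges_iff by (intro ennreal_tendsto_cmult) auto
  ultimately show "(\<lambda>k. energy {0..\<tau>} (\<lambda>t. c *\<^sub>C fs k t - c *\<^sub>C f t)) \<longlonglongrightarrow> 0" by simp
qed

text \<open>Young's inequality with a free parameter: a factor \<open>1 + e\<close> close to one is
  what makes energies converge later, in place of the triangle inequality in L^2.\<close>

lemma norm_square_le_weighted:
  fixes a b :: "'a::real_inner"
  assumes "e > 0"
  shows "(norm a)\<^sup>2 \<le> (1 + e) * (norm b)\<^sup>2 + (1 + 1 / e) * (norm (a - b))\<^sup>2"
proof -
  have "norm a \<le> norm b + norm (a - b)" by (metis norm_triangle_ineq add.commute diff_add_cancel)
  then have "(norm a)\<^sup>2 \<le> (norm b + norm (a - b))\<^sup>2" by (simp add: power_mono)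
  also have "\<dots> = (1 + e) * (norm b)\<^sup>2 + (1 + 1 / e) * (norm (a - b))\<^sup>2 - (e * norm b - norm (a - b))\<^sup>2 / e"
    using assms by (simp add: field_simps power2_eq_square)
  also have "\<dots> \<le> (1 + e) * (norm b)\<^sup>2 + (1 + 1 / e) * (norm (a - b))\<^sup>2" using assms by simp
  finally show ?thesis .
qed

lemma energy_tendsto:
  assumes conv: "L2_loc_converges fs f" and fs: "\<And>k. fs k \<in> L2_loc" and f: "f \<in> L2_loc" and "\<tau> \<ge> 0"
  shows "(\<lambda>k. energy {0..\<tau>} (fs k)) \<longlonglongrightarrow> energy {0..\<tau>} f"
proof -
  define a where "a k = enn2real (energy {0..\<tau>} (fs k))" for k
  define b where "b = enn2real (energy {0..\<tau>} f)"
  define d where "d k = enn2real (energy {0..\<tau>} (\<lambda>t. fs k t - f t))" for k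
  have fin: "energy {0..\<tau>} g < \<infinity>" if "g \<in> L2_loc" for g :: "real \<Rightarrow> 'a"
    using that \<open>\<tau> \<ge> 0\<close> by (simp add: L2_loc_iff)
  have a: "energy {0..\<tau>} (fs k) = ennreal (a k)" and b: "energy {0..\<tau>} f = ennreal b"
    and d: "energy {0..\<tau>} (\<lambda>t. fs k t - f t) = ennreal (d k)" for k
    using fin[OF fs] fin[OF f] fin[OF L2_loc_diff[OF fs f]] by (auto simp: a_def b_def d_def)
  have nn: "a k \<ge> 0" "b \<ge> 0" "d k \<ge> 0" for k by (auto simp: a_def b_def d_def)
  have le: "a k \<le> (1 + e) * b + (1 + 1 / e) * d k \<and> b \<le> (1 + e) * a k + (1 + 1 / e) * d k" if "e > 0" for e k
  proof -
    have sm: "strongly_measurable (fs k)" "strongly_measurable f" "strongly_measurable (\<lambda>t. fs k t - f t)"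
      using fs f L2_loc_diff[OF fs f] by (auto simp: L2_loc_iff)
    have "energy {0..\<tau>} (fs k) \<le> ennreal (1 + e) * energy {0..\<tau>} f + ennreal (1 + 1 / e) * energy {0..\<tau>} (\<lambda>t. fs k t - f t)"
      by (rule energy_le_sum) (use that sm norm_square_le_weighted[OF that] in auto)
    moreover have "energy {0..\<tau>} f \<le> ennreal (1 + e) * energy {0..\<tau>} (fs k) + ennreal (1 + 1 / e) * energy {0..\<tau>} (\<lambda>t. fs k t - f t)"
      by (rule energy_le_sum)
        (use that sm norm_square_le_weighted[OF that] in \<open>auto simp: norm_minus_commute\<close>)
    ultimately show ?thesis
      using that nn by (simp add: a b d flip: ennreal_mult ennreal_plus)
  qed
  have "(\<lambda>k. ennreal (d k)) \<longlonglongrightarrow> 0"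
    using conv \<open>\<tau> \<ge> 0\<close> by (simp add: L2_loc_converges_iff flip: d)
  then have "d \<longlonglongrightarrow> 0" by (rule iffD1[OF ennreal_tendsto_0_iff[OF nn(3)]])
  have "a \<longlonglongrightarrow> b"
  proof (rule LIMSEQ_I)
    fix r :: real assume "r > 0"
    \<comment> \<open>By this choice \<open>2 e b < r / 2\<close>. The coefficient
      \<open>3 + 1 / e\<close> below collects \<open>1 + 1 / e\<close> from the weighted inequality
      and \<open>2\<close> from the crude bound \<open>a k \<le> 2 b + 2 d k\<close>, which gets
      multiplied by \<open>e \<le> 1\<close>.\<close>
    define e where "e = min 1 (r / (4 * b + 4))"
    have "e \<le> r / (4 * b + 4)" by (simp add: e_def)
    then have e: "e * (4 * b + 4) \<le> r" using nn(2) by (subst (asm) pos_le_divide_eq) auto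
    have e: "e > 0" "e \<le> 1" "e * (4 * b + 4) \<le> r"
      using \<open>r > 0\<close> nn(2) e by (simp_all add: e_def)
    have "(\<lambda>k. (3 + 1 / e) * d k) \<longlonglongrightarrow> (3 + 1 / e) * 0" by (intro tendsto_intros \<open>d \<longlonglongrightarrow> 0\<close>)
    then obtain N where N: "\<And>k. k \<ge> N \<Longrightarrow> (3 + 1 / e) * d k < r / 2"
      using order_tendstoD(2)[of _ _ _ "r / 2"] \<open>r > 0\<close> by (fastforce simp: eventually_sequentially)
    have "norm (a k - b) < r" if "k \<ge> N" for k
    proof -
      have 1: "a k - b \<le> e * b + (1 + 1 / e) * d k" "b - a k \<le> e * a k + (1 + 1 / e) * d k"
        using le[OF e(1), of k] by (auto simp: algebra_simps)
      have "a k \<le> 2 * b + 2 * d k" using le[of 1 k] by simp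
      then have "e * a k \<le> e * (2 * b + 2 * d k)" using e(1) by (intro mult_left_mono) auto
      then have "e * a k \<le> 2 * (e * b) + e * (2 * d k)" by (simp only: distrib_left mult.left_commute)
      moreover have "e * (2 * d k) \<le> 1 * (2 * d k)" using e nn(3)[of k] by (intro mult_right_mono) auto
      moreover have "0 \<le> e * b" using e nn by simp
      moreover have "2 * (e * b) < r / 2"  using e by (simp add: algebra_simps)
      moreover have "(3 + 1 / e) * d k = 2 * d k + (1 + 1 / e) * d k" by (simp add: algebra_simps)
      ultimately have "\<bar>a k - b\<bar> < r" using 1 N[OF that] nn(3)[of k] by (simp add: abs_less_iff)
      then show ?thesis by simp
    qed
    then show "\<exists>no. \<forall>n\<ge>no. norm (a n - b) < r" by blast
  qed
  then show ?thesis unfolding a b using nn by simp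
qed

lemma two_mult_le_ennreal_iff: "2 * a \<le> ennreal r \<longleftrightarrow> a \<le> ennreal (r / 2)"
proof -
  have "ennreal r = 2 * ennreal (r / 2)"
    using ennreal_mult'[of 2 "r / 2"] by simp
  then show ?thesis by (simp add: ennreal_mult_le_mult_iff)
qed

lemma energy_half_line_le:
  assumes f: "strongly_measurable f" and le: "\<And>n::nat. energy {0..real n} f \<le> c"
  shows "energy {0..} f \<le> c"
proof -
  have "ennreal ((norm (f t))\<^sup>2) * indicator {0..} t
      = (SUP n. ennreal ((norm (f t))\<^sup>2) * indicator {0..real n} t)" for t
  proof (cases "t \<ge> 0")
    case True
    obtain N where N: "t \<le> real N" using real_arch_simple by blast
    show ?thesis
    proof (rule antisym)
      show "ennreal ((norm (f t))\<^sup>2) * indicator {0..} t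
          \<le> (SUP n. ennreal ((norm (f t))\<^sup>2) * indicator {0..real n} t)"
        by (rule SUP_upper2[of N]) (use True N in auto)
    qed (auto intro!: SUP_least simp: indicator_def)
  qed (simp add: indicator_def)
  then have "energy {0..} f = (\<integral>\<^sup>+t. (SUP n. ennreal ((norm (f t))\<^sup>2) * indicator {0..real n} t) \<partial>lebesgue)"
    unfolding energy_def by (intro nn_integral_cong) blast
  also have "\<dots> = (SUP n. energy {0..real n} f)"
    unfolding energy_def
    by (intro nn_integral_monotone_convergence_SUP borel_measurable_energy f)
      (auto simp: incseq_def le_fun_def indicator_def intro: order_trans)
  also have "\<dots> \<le> c" by (intro SUP_least le)
  finally show ?thesis .
qed

lemma energy_minus_commute: "energy A (\<lambda>t. f t - g t) = energy A (\<lambda>t. g t - f t)"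
  by (simp add: energy_def norm_minus_commute)

lemma energy_fatou:
  assumes f: "\<And>m. strongly_measurable (f m)" and A: "A \<in> sets lebesgue" "A \<subseteq> {0..}"
    and lim: "AE t in lebesgue. t \<in> {0..} \<longrightarrow> (\<lambda>m. f m t) \<longlonglongrightarrow> g t"
    and c: "c \<longlonglongrightarrow> c0" and le: "\<forall>\<^sub>F m in sequentially. energy A (f m) \<le> c m"
  shows "energy A g \<le> c0"
proof -
  have "energy A g \<le> (\<integral>\<^sup>+t. liminf (\<lambda>m. ennreal ((norm (f m t))\<^sup>2) * indicator A t) \<partial>lebesgue)"
    unfolding energy_def
  proof (rule nn_integral_mono_AE, use lim in eventually_elim)
    fix t assume t: "t \<in> {0..} \<longrightarrow> (\<lambda>m. f m t) \<longlonglongrightarrow> g t"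
    show "ennreal ((norm (g t))\<^sup>2) * indicator A t
        \<le> liminf (\<lambda>m. ennreal ((norm (f m t))\<^sup>2) * indicator A t)"
    proof (cases "t \<in> A")
      case True
      then have "(\<lambda>m. ennreal ((norm (f m t))\<^sup>2)) \<longlonglongrightarrow> ennreal ((norm (g t))\<^sup>2)"
        using t A(2) by (intro tendsto_intros) auto
      then show ?thesis using True lim_imp_Liminf[OF sequentially_bot] by fastforce
    qed simp
  qed
  also have "\<dots> \<le> liminf (\<lambda>m. energy A (f m))"
    unfolding energy_def by (intro nn_integral_liminf borel_measurable_energy f A)
  also have "\<dots> \<le> liminf c" by (rule Liminf_mono[OF le])
  also have "\<dots> = c0" by (rule lim_imp_Liminf[OF sequentially_bot c])
  finally show ?thesis .
qed

text \<open>\<open>\<Sum>n. 2\<^sup>n \<parallel>f (Suc n) t - f n t\<parallel>\<^sup>2\<close> is integrable, hence finite for almost every \<open>t\<close>.\<close>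

lemma L2_geometric_Cauchy_converges:
  fixes f :: "nat \<Rightarrow> real \<Rightarrow> 'a::chilbert_space"
  assumes f: "\<And>n. continuous_on {0..} (f n)"
    and le: "\<And>n m. n \<le> m \<Longrightarrow> energy {0..} (\<lambda>t. f m t - f n t) \<le> ennreal (C * (1/4) ^ n)"
    and "C \<ge> 0"
  obtains g where "strongly_measurable g" "\<And>n. energy {0..} (\<lambda>t. f n t - g t) \<le> ennreal (C * (1/4) ^ n)"
    "AE t in lebesgue. t \<in> {0..} \<longrightarrow> (\<lambda>n. f n t) \<longlonglongrightarrow> g t"
proof -
  define d where "d n t = f (Suc n) t - f n t" for n t
  define h where "h n t = ennreal (2 ^ n) * (ennreal ((norm (d n t))\<^sup>2) * indicator {0..} t)" for n t
  have sm: "strongly_measurable (\<lambda>t. f m t - f n t)" for m n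
    by (intro strongly_measurable_diff strongly_measurable_continuous f)
  have md: "(\<lambda>t. ennreal ((norm (d n t))\<^sup>2) * indicator {0..} t) \<in> borel_measurable lebesgue" for n
    unfolding d_def by (intro borel_measurable_energy sm) auto
  then have mh: "h n \<in> borel_measurable lebesgue" for n
    unfolding h_def by measurable
  have ih: "(\<integral>\<^sup>+t. h n t \<partial>lebesgue) \<le> ennreal (C * (1/2) ^ n)" for n
  proof -
    have "(\<integral>\<^sup>+t. h n t \<partial>lebesgue) = ennreal (2 ^ n) * energy {0..} (d n)"
      unfolding h_def energy_def by (rule nn_integral_cmult[OF md])
    also have "\<dots> \<le> ennreal (2 ^ n) * ennreal (C * (1/4) ^ n)"
      unfolding d_def by (intro mult_left_mono le) auto
    also have "\<dots> = ennreal (C * (2 ^ n * (1/4) ^ n))" using \<open>C \<ge> 0\<close> by (simp add: ac_simps flip: ennreal_mult)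
    also have "2 ^ n * (1/4) ^ n = (1/2::real) ^ n" by (simp flip: power_mult_distrib)
    finally show ?thesis .
  qed
  have "(\<integral>\<^sup>+t. (\<Sum>n. h n t) \<partial>lebesgue) = (\<Sum>n. \<integral>\<^sup>+t. h n t \<partial>lebesgue)"
    by (rule nn_integral_suminf[OF mh])
  also have "\<dots> \<le> (\<Sum>n. ennreal (C * (1/2) ^ n))" by (intro suminf_le ih) auto
  also have "\<dots> = ennreal (\<Sum>n. C * (1/2) ^ n)"
    using \<open>C \<ge> 0\<close> by (intro suminf_ennreal2 summable_mult summable_geometric) auto
  finally have "(\<integral>\<^sup>+t. (\<Sum>n. h n t) \<partial>lebesgue) \<noteq> \<infinity>"
    by (metis ennreal_less_top infinity_ennreal_def le_less_trans less_irrefl)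
  then have "AE t in lebesgue. (\<Sum>n. h n t) \<noteq> \<infinity>"
    using mh by (intro nn_integral_PInf_AE) measurable
  then have conv: "AE t in lebesgue. t \<in> {0..} \<longrightarrow> convergent (\<lambda>n. f n t)"
  proof eventually_elim
    case (elim t)
    show ?case
    proof
      assume t: "t \<in> {0..}"
      obtain r where r: "(\<Sum>n. h n t) = ennreal r" "r \<ge> 0" using elim by (cases "\<Sum>n. h n t") auto
      \<comment> \<open>Each term of the finite sum \<open>r\<close> contains a squared increment
        with weight \<open>2^n\<close>, so the increments decay geometrically with ratio
        \<open>1 / sqrt 2\<close>.\<close>
      have "norm (d n t) \<le> sqrt r * (1 / sqrt 2) ^ n" for n
      proof -
        have "h n t \<le> (\<Sum>n. h n t)" using sum_le_suminf[of "\<lambda>n. h n t" "{n}"] by simp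
        then have "ennreal (2 ^ n * (norm (d n t))\<^sup>2) \<le> ennreal r"
          unfolding r(1) using t by (simp add: h_def ennreal_mult)
        then have "2 ^ n * (norm (d n t))\<^sup>2 \<le> r" using r(2) by simp
        then have "(norm (d n t))\<^sup>2 \<le> r * (1/2) ^ n" by (simp add: power_one_over field_simps)
        then have "norm (d n t) \<le> sqrt (r * (1/2) ^ n)" by (rule real_le_rsqrt)
        then show ?thesis by (simp add: real_sqrt_mult real_sqrt_power real_sqrt_divide)
      qed
      moreover have "summable (\<lambda>n. sqrt r * (1 / sqrt 2) ^ n)"
        by (intro summable_mult summable_geometric) simp
      ultimately have "summable (\<lambda>n. d n t)" by (rule summable_comparison_test'[rotated])
      then have "(\<lambda>n. (\<Sum>k<n. d k t) + f 0 t) \<longlonglongrightarrow> (\<Sum>k. d k t) + f 0 t"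
        by (intro tendsto_intros summable_LIMSEQ)
      moreover have "(\<Sum>k<n. d k t) + f 0 t = f n t" for n
        unfolding d_def using sum_lessThan_telescope[of "\<lambda>n. f n t" n] by simp
      ultimately show "convergent (\<lambda>n. f n t)" unfolding convergent_def by auto
    qed
  qed
  define g where "g t = lim (\<lambda>n. f n t)" for t
  have lim: "AE t in lebesgue. t \<in> {0..} \<longrightarrow> (\<lambda>n. f n t) \<longlonglongrightarrow> g t"
    using conv by eventually_elim (simp add: g_def convergent_LIMSEQ_iff)
  have "strongly_measurable g"
    by (rule strongly_measurable_limit_continuous[OF f]) (use lim in \<open>simp add: AE_restrict_space_iff\<close>)
  \<comment> \<open>Fatou's lemma in \<open>m\<close>, with \<open>n\<close> fixed, preserves the
    rate.\<close>
  moreover have "energy {0..} (\<lambda>t. f n t - g t) \<le> ennreal (C * (1/4) ^ n)" for n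
  proof (rule energy_fatou[OF sm[of n]])
    show "AE t in lebesgue. t \<in> {0..} \<longrightarrow> (\<lambda>m. f n t - f m t) \<longlonglongrightarrow> f n t - g t"
      using lim by eventually_elim (auto intro: tendsto_intros)
    show "\<forall>\<^sub>F m in sequentially. energy {0..} (\<lambda>t. f n t - f m t) \<le> ennreal (C * (1/4) ^ n)"
      unfolding eventually_sequentially
      using le by (intro exI[of _ n] allI impI) (subst energy_minus_commute, blast)
  qed auto
  ultimately show ?thesis using that lim by blast
qed

section \<open>Generalized solutions\<close>

lemma classical_solution_lincomb:
  assumes "clinear_on (Dom S) (app S)" "classical_solution S x u y" "classical_solution S x' u' y'"
  shows "classical_solution S (\<lambda>t. x t + c *\<^sub>C x' t) (\<lambda>t. u t + c *\<^sub>C u' t) (\<lambda>t. y t + c *\<^sub>C y' t)"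
proof -
  let ?sol = "\<lambda>x u y z t. (x has_vector_derivative z t) (at t within {0..}) \<and>
    (x t, u t) \<in> Dom S \<and> (z t, y t) = app S (x t, u t)"
  from assms(2) obtain z where z: "continuous_on {0..} z" "\<And>t. t \<ge> 0 \<Longrightarrow> ?sol x u y z t"
    unfolding classical_solution_def by blast
  from assms(3) obtain z' where z': "continuous_on {0..} z'" "\<And>t. t \<ge> 0 \<Longrightarrow> ?sol x' u' y' z' t"
    unfolding classical_solution_def by blast
  show ?thesis
    unfolding classical_solution_def
  proof (intro conjI exI[of _ "\<lambda>t. z t + c *\<^sub>C z' t"] allI impI)
    fix t :: real assume t: "t \<ge> 0"
    show "((\<lambda>t. x t + c *\<^sub>C x' t) has_vector_derivative z t + c *\<^sub>C z' t) (at t within {0..})"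
      using z(2)[OF t] z'(2)[OF t]
      by (intro has_vector_derivative_add bounded_linear.has_vector_derivative[OF bounded_linear_scaleC]) auto
    have w: "c *\<^sub>C (x' t, u' t) \<in> Dom S" "app S (c *\<^sub>C (x' t, u' t)) = c *\<^sub>C (z' t, y' t)"
      using z'(2)[OF t] clinear_on_scaleC[OF assms(1)] by metis+
    then have "(x t, u t) + c *\<^sub>C (x' t, u' t) \<in> Dom S \<and>
        app S ((x t, u t) + c *\<^sub>C (x' t, u' t)) = (z t, y t) + c *\<^sub>C (z' t, y' t)"
      using z(2)[OF t] clinear_on_add[OF assms(1) _ w(1)] by metis
    then show "(x t + c *\<^sub>C x' t, u t + c *\<^sub>C u' t) \<in> Dom S"
      "(z t + c *\<^sub>C z' t, y t + c *\<^sub>C y' t) = app S (x t + c *\<^sub>C x' t, u t + c *\<^sub>C u' t)"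
      by (auto simp: scaleC_prod_def)
  qed (use assms z z' in \<open>auto simp: classical_solution_def intro!: continuous_on_add
      intro: continuous_on_compose2[OF linear_continuous_on[OF bounded_linear_scaleC, of UNIV]]\<close>)
qed

lemma classical_solution_L2_loc:
  assumes "classical_solution S x u y"
  shows "u \<in> L2_loc" "y \<in> L2_loc"
  using assms by (auto simp: classical_solution_def intro: L2_loc_continuous)

text \<open>A single coefficient covers all operations: \<open>c = 1\<close> and
  \<open>c = -1\<close> give sums and differences, and scaling arises from the same solution taken
  twice with \<open>c - 1\<close>.\<close>

lemma generalized_solution_lincomb:
  assumes S: "clinear_on (Dom S) (app S)"
    and g: "generalized_solution S x u y" "generalized_solution S x' u' y'"
  shows "generalized_solution S (\<lambda>t. x t + c *\<^sub>C x' t) (\<lambda>t. u t + c *\<^sub>C u' t) (\<lambda>t. y t + c *\<^sub>C y' t)"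
proof -
  obtain xs us ys where s: "\<And>k. classical_solution S (xs k) (us k) (ys k)"
    "\<And>\<tau>. \<tau> \<ge> 0 \<Longrightarrow> uniform_limit {0..\<tau>} xs x sequentially"
    "L2_loc_converges us u" "L2_loc_converges ys y"
    using g(1) unfolding generalized_solution_def by blast
  obtain xs' us' ys' where s': "\<And>k. classical_solution S (xs' k) (us' k) (ys' k)"
    "\<And>\<tau>. \<tau> \<ge> 0 \<Longrightarrow> uniform_limit {0..\<tau>} xs' x' sequentially"
    "L2_loc_converges us' u'" "L2_loc_converges ys' y'"
    using g(2) unfolding generalized_solution_def by blast
  have L: "u \<in> L2_loc" "y \<in> L2_loc" "u' \<in> L2_loc" "y' \<in> L2_loc"
    using g by (auto simp: generalized_solution_def)
  note L' = classical_solution_L2_loc[OF s(1)] classical_solution_L2_loc[OF s'(1)]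
  show ?thesis
    unfolding generalized_solution_def
  proof (intro conjI exI[of _ "\<lambda>k t. xs k t + c *\<^sub>C xs' k t"] exI[of _ "\<lambda>k t. us k t + c *\<^sub>C us' k t"]
      exI[of _ "\<lambda>k t. ys k t + c *\<^sub>C ys' k t"] allI impI)
    show "L2_loc_converges (\<lambda>k t. us k t + c *\<^sub>C us' k t) (\<lambda>t. u t + c *\<^sub>C u' t)"
      by (intro L2_loc_converges_add L2_loc_converges_scaleC L2_loc_scaleC s s' L L')
    show "L2_loc_converges (\<lambda>k t. ys k t + c *\<^sub>C ys' k t) (\<lambda>t. y t + c *\<^sub>C y' t)"
      by (intro L2_loc_converges_add L2_loc_converges_scaleC L2_loc_scaleC s s' L L')
  qed (use g L in \<open>auto simp: generalized_solution_def intro!: continuous_on_add L2_loc_add L2_loc_scaleC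
      classical_solution_lincomb[OF S s(1) s'(1)] uniform_limit_add s(2)
      bounded_linear.uniform_limit[OF bounded_linear_scaleC s'(2)]
      intro: continuous_on_compose2[OF linear_continuous_on[OF bounded_linear_scaleC, of UNIV]]\<close>)
qed

lemma generalized_solution_add:
  assumes "clinear_on (Dom S) (app S)"
    and "generalized_solution S x u y" "generalized_solution S x' u' y'"
  shows "generalized_solution S (\<lambda>t. x t + x' t) (\<lambda>t. u t + u' t) (\<lambda>t. y t + y' t)"
  using generalized_solution_lincomb[OF assms, of 1] by (simp add: scaleC_one)

lemma generalized_solution_diff:
  assumes "clinear_on (Dom S) (app S)"
    and "generalized_solution S x u y" "generalized_solution S x' u' y'"
  shows "generalized_solution S (\<lambda>t. x t - x' t) (\<lambda>t. u t - u' t) (\<lambda>t. y t - y' t)"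
  using generalized_solution_lincomb[OF assms, of "-1"] by (simp add: scaleC_minus1)

lemma generalized_solution_scaleC:
  assumes "clinear_on (Dom S) (app S)" and g: "generalized_solution S x u y"
  shows "generalized_solution S (\<lambda>t. c *\<^sub>C x t) (\<lambda>t. c *\<^sub>C u t) (\<lambda>t. c *\<^sub>C y t)"
  using generalized_solution_lincomb[OF assms(1) g g, of "c - 1"]
  by (simp add: scaleC_one flip: scaleC_add_left[of 1, unfolded scaleC_one])

section \<open>Closed-loop trajectories\<close>

context passive_node
begin

definition closed_loop_trajectory :: "(real \<Rightarrow> 'x) \<Rightarrow> bool"
  where "closed_loop_trajectory x \<longleftrightarrow>
    (\<forall>t\<ge>0. x t \<in> K_dom \<and> (x has_vector_derivative K (x t)) (at t within {0..})) \<and>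
    continuous_on {0..} (\<lambda>t. K (x t))"

lemma closed_loop_trajectoryD:
  assumes "closed_loop_trajectory x"
  shows "t \<ge> 0 \<Longrightarrow> x t \<in> K_dom" "t \<ge> 0 \<Longrightarrow> (x has_vector_derivative K (x t)) (at t within {0..})"
    "continuous_on {0..} (\<lambda>t. K (x t))" "continuous_on {0..} x"
  using assms by (auto simp: closed_loop_trajectory_def continuous_on_eq_continuous_within
      intro: has_vector_derivative_continuous)

lemma closed_loop_trajectory_diff:
  assumes "closed_loop_trajectory x" "closed_loop_trajectory x'"
  shows "closed_loop_trajectory (\<lambda>t. x t - x' t)"
proof -
  note x = closed_loop_trajectoryD[OF assms(1)] and x' = closed_loop_trajectoryD[OF assms(2)]
  have "continuous_on {0..} (\<lambda>t. K (x t - x' t))"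
    by (rule continuous_on_eq[OF continuous_on_diff[OF x(3) x'(3)]]) (simp add: K_diff x x')
  then show ?thesis
    using x x' by (auto simp: closed_loop_trajectory_def K_diff intro: has_vector_derivative_diff)
qed

lemma closed_loop_trajectory_norm_le:
  assumes "closed_loop_trajectory x" "t \<ge> 0"
  shows "norm (x t) \<le> norm (x 0)"
proof -
  have "inner (K (x s)) (x s) \<le> 0" if "s \<ge> 0" for s
    using K_dissipative[OF closed_loop_trajectoryD(1)[OF assms(1) that]] by (rule order_trans) simp
  then have "(norm (x t))\<^sup>2 \<le> (norm (x 0))\<^sup>2 + 2 * 0 * t"
    by (intro norm_growth_bound[where q="\<lambda>s. K (x s)"])
      (use closed_loop_trajectoryD[OF assms(1)] assms(2) in auto)
  then show ?thesis by simp
qed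

text \<open>Dissipation applied to \<open>x s - x t\<close> bounds the squared increment of the
  output by the product of the increments of \<open>K x\<close> and of \<open>x\<close>, which are
  both continuous in time.\<close>

lemma continuous_on_fb:
  assumes x: "closed_loop_trajectory x"
  shows "continuous_on {0..} (\<lambda>t. fb (x t))"
  unfolding continuous_on_def
proof
  fix t :: real assume t: "t \<in> {0..}"
  note x = closed_loop_trajectoryD[OF x]
  let ?F = "at t within {0..}"
  have le: "(norm (fb (x s) - fb (x t)))\<^sup>2 \<le> norm (K (x s) - K (x t)) * norm (x s - x t)" if "s \<in> {0..}" for s
  proof -
    have "x s \<in> K_dom" "x t \<in> K_dom" using t that x(1) by auto
    then have "(norm (fb (x s) - fb (x t)))\<^sup>2 \<le> - inner (K (x s) - K (x t)) (x s - x t)"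
      using K_dissipative[of "x s - x t"] K_diff by simp
    also have "\<dots> \<le> norm (K (x s) - K (x t)) * norm (x s - x t)"
      using Cauchy_Schwarz_ineq2[of "K (x s) - K (x t)" "x s - x t"] by linarith
    finally show ?thesis .
  qed
  have "((\<lambda>s. norm (K (x s) - K (x t)) * norm (x s - x t)) \<longlongrightarrow> norm (K (x t) - K (x t)) * norm (x t - x t)) ?F"
    using x(3,4) t by (intro tendsto_intros) (auto simp: continuous_on_def)
  then have lim: "((\<lambda>s. norm (K (x s) - K (x t)) * norm (x s - x t)) \<longlongrightarrow> 0) ?F" by simp
  have "\<forall>\<^sub>F s in ?F. norm ((norm (fb (x s) - fb (x t)))\<^sup>2) \<le> norm (K (x s) - K (x t)) * norm (x s - x t)"
    unfolding eventually_at_filter by (rule always_eventually) (use le in simp)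
  then have "((\<lambda>s. (norm (fb (x s) - fb (x t)))\<^sup>2) \<longlongrightarrow> 0) ?F"
    using lim by (rule Lim_null_comparison)
  then have "((\<lambda>s. sqrt ((norm (fb (x s) - fb (x t)))\<^sup>2)) \<longlongrightarrow> sqrt 0) ?F" by (rule tendsto_real_sqrt)
  then show "((\<lambda>s. fb (x s)) \<longlongrightarrow> fb (x t)) ?F" by (simp add: tendsto_norm_zero_iff LIM_zero_iff)
qed

lemma closed_loop_trajectory_classical:
  assumes "closed_loop_trajectory x"
  shows "classical_solution S x (\<lambda>t. - fb (x t)) (\<lambda>t. fb (x t))"
proof -
  have "app S (x t, - fb (x t)) = (K (x t), fb (x t)) \<and> (x t, - fb (x t)) \<in> Dom S" if "t \<ge> 0" for t
    using closed_loop_trajectoryD(1)[OF assms that] CL_D by (auto simp: K_dom_iff K_def prod_eq_iff)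
  then show ?thesis
    using closed_loop_trajectoryD[OF assms] continuous_on_fb[OF assms]
    unfolding classical_solution_def
    by (intro conjI exI[of _ "\<lambda>t. K (x t)"] continuous_on_minus allI impI) auto
qed

text \<open>Integrate the dissipation inequality and drop the final squared norm. The factor two
  makes the left side the whole cost: input \<open>- fb x\<close> and output \<open>fb x\<close>
  have equal energy.\<close>

lemma closed_loop_energy_le:
  assumes "closed_loop_trajectory x"
  shows "2 * energy {0..} (\<lambda>t. fb (x t)) \<le> ennreal ((norm (x 0))\<^sup>2)"
proof -
  note x = closed_loop_trajectoryD[OF assms]
  have "energy {0..\<tau>} (\<lambda>t. fb (x t)) \<le> ennreal ((norm (x 0))\<^sup>2 / 2)" if "\<tau> \<ge> 0" for \<tau>
  proof -
    have cfb: "continuous_on {0..\<tau>} (\<lambda>t. (norm (fb (x t)))\<^sup>2)"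
      by (intro continuous_intros continuous_on_subset[OF continuous_on_fb[OF assms]]) auto
    have "((\<lambda>t. inner (K (x t)) (x t) + inner (x t) (K (x t))) has_integral
        (inner (x \<tau>) (x \<tau>) - inner (x 0) (x 0))) {0..\<tau>}"
    proof (rule fundamental_theorem_of_calculus[OF that])
      fix t assume t: "t \<in> {0..\<tau>}"
      have "(x has_vector_derivative K (x t)) (at t within {0..\<tau>})"
        by (rule has_vector_derivative_within_subset[OF x(2)]) (use t in auto)
      from bounded_bilinear.has_vector_derivative[OF bounded_bilinear_inner this this]
      show "((\<lambda>t. inner (x t) (x t)) has_vector_derivative inner (K (x t)) (x t) + inner (x t) (K (x t)))
          (at t within {0..\<tau>})" by (simp add: add.commute)
    qed
    from has_integral_mult_right[OF this, of "- 1/2"]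
    have I: "((\<lambda>t. - inner (K (x t)) (x t)) has_integral ((norm (x 0))\<^sup>2 - (norm (x \<tau>))\<^sup>2) / 2) {0..\<tau>}"
    proof (rule has_integral_eq_rhs[OF has_integral_eq, rotated 1])
      show "- 1/2 * (inner (K (x t)) (x t) + inner (x t) (K (x t))) = - inner (K (x t)) (x t)" for t
        by (simp add: inner_commute)
    qed (simp add: power2_norm_eq_inner field_simps)
    have "integral {0..\<tau>} (\<lambda>t. (norm (fb (x t)))\<^sup>2) \<le> ((norm (x 0))\<^sup>2 - (norm (x \<tau>))\<^sup>2) / 2"
      unfolding integral_unique[OF I, symmetric]
    proof (rule integral_le)
      show "(\<lambda>t. (norm (fb (x t)))\<^sup>2) integrable_on {0..\<tau>}" by (rule integrable_continuous_interval[OF cfb])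
      show "(norm (fb (x t)))\<^sup>2 \<le> - inner (K (x t)) (x t)" if "t \<in> {0..\<tau>}" for t
        using K_dissipative[OF x(1)[of t]] that by simp
    qed (use I in blast)
    also have "\<dots> \<le> (norm (x 0))\<^sup>2 / 2" by simp
    finally show ?thesis by (simp add: energy_continuous[OF continuous_on_fb[OF assms]] ennreal_leI)
  qed
  then have "energy {0..} (\<lambda>t. fb (x t)) \<le> ennreal ((norm (x 0))\<^sup>2 / 2)"
    by (intro energy_half_line_le strongly_measurable_continuous continuous_on_fb assms) auto
  then show ?thesis by (simp add: two_mult_le_ennreal_iff)
qed

lemma closed_loop_trajectory_dense:
  assumes "e > 0"
  obtains x where "closed_loop_trajectory x" "norm (x 0 - x0) < e"
proof -
  obtain lam0 where "maximal_dissipative K_dom K lam0" using K_maximal_dissipative by blast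
  then interpret K: maximal_dissipative K_dom K lam0 .
  have "x0 \<in> closure {x \<in> K_dom. K x \<in> K_dom}" by (simp add: K.dense_D2)
  then obtain z where z: "z \<in> K_dom" "K z \<in> K_dom" "dist z x0 < e"
    using \<open>e > 0\<close> by (auto simp: closure_approachable)
  obtain u where "u 0 = z" "continuous_on {0..} (\<lambda>t. K (u t))"
    "\<And>t. t \<ge> 0 \<Longrightarrow> u t \<in> K_dom \<and> (u has_vector_derivative K (u t)) (at t within {0..})"
    using K.evolution_exists[OF z(1,2)] by blast
  then show ?thesis using that[of u] z(3) by (simp add: closed_loop_trajectory_def dist_norm)
qed

text \<open>Contraction is uniform in time, so classical trajectories with converging initial states
  converge uniformly on the whole half-line. The last conclusion keeps this on record, because decay
  at infinity is later inherited from the approximants.\<close>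

lemma closed_loop_solution_exists:
  obtains x v where "generalized_solution S x (\<lambda>t. - v t) v" "x 0 = x0"
    "2 * energy {0..} v \<le> ennreal ((norm x0)\<^sup>2)"
    "\<And>e. e > 0 \<Longrightarrow> \<exists>z. closed_loop_trajectory z \<and> (\<forall>t\<ge>0. norm (x t - z t) \<le> e)"
proof -
  have "\<exists>z. closed_loop_trajectory z \<and> norm (z 0 - x0) < (1/2) ^ n" for n
    by (rule closed_loop_trajectory_dense[of "(1/2) ^ n" x0]) auto
  then obtain z where z: "\<And>n. closed_loop_trajectory (z n)" "\<And>n. norm (z n 0 - x0) < (1/2) ^ n" by metis
  have z0: "norm (z m 0 - z n 0) \<le> 2 * (1/2) ^ n" if "n \<le> m" for m n
  proof -
    have "norm (z m 0 - z n 0) \<le> norm (z m 0 - x0) + norm (z n 0 - x0)"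
      using norm_triangle_ineq4[of "z m 0 - x0" "z n 0 - x0"] by simp
    moreover have "(1/2::real) ^ m \<le> (1/2) ^ n" using that by (intro power_decreasing) auto
    ultimately show ?thesis using z(2)[of m] z(2)[of n] by linarith
  qed
  have zt: "norm (z m t - z n t) \<le> 2 * (1/2) ^ n" if "n \<le> m" "t \<ge> 0" for m n t
    using closed_loop_trajectory_norm_le[OF closed_loop_trajectory_diff[OF z(1) z(1)] that(2), of m n]
      z0[OF that(1)] by linarith
  have half0: "(\<lambda>n. 2 * (1/2::real) ^ n) \<longlonglongrightarrow> 0"
    by (intro tendsto_mult_right_zero LIMSEQ_power_zero) simp
  have "uniformly_Cauchy_on {0..} z"
  proof (rule uniformly_Cauchy_onI')
    fix e :: real assume "e > 0"
    then obtain M where M: "2 * (1/2::real) ^ M < e"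
      using order_tendstoD(2)[OF half0] by (force simp: eventually_sequentially)
    have "dist (z m t) (z n t) < e" if "t \<in> {0..}" "m \<ge> M" "n > m" for t m n
    proof -
      have "dist (z m t) (z n t) \<le> 2 * (1/2) ^ m" using zt[of m n t] that by (simp add: dist_norm norm_minus_commute)
      also have "\<dots> \<le> 2 * (1/2) ^ M" using that by (intro mult_left_mono power_decreasing) auto
      finally show ?thesis using M by simp
    qed
    then show "\<exists>M. \<forall>x\<in>{0..}. \<forall>m\<ge>M. \<forall>n>m. dist (z m x) (z n x) < e" by blast
  qed
  then obtain x where x: "uniform_limit {0..} z x sequentially"
    using Cauchy_uniformly_convergent uniformly_convergent_on_def by blast
  have xt: "(\<lambda>n. z n t) \<longlonglongrightarrow> x t" if "t \<ge> 0" for t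
    by (rule tendsto_uniform_limitI[OF x]) (use that in simp)
  have near: "norm (x t - z n t) \<le> 2 * (1/2) ^ n" if "t \<ge> 0" for t n
  proof (rule LIMSEQ_le_const2)
    show "(\<lambda>m. norm (z m t - z n t)) \<longlonglongrightarrow> norm (x t - z n t)" by (intro tendsto_intros xt that)
  qed (use zt that in blast)
  have z0x0: "(\<lambda>n. z n 0) \<longlonglongrightarrow> x0"
  proof (rule LIM_zero_cancel, rule Lim_null_comparison)
    show "\<forall>\<^sub>F n in sequentially. norm (z n 0 - x0) \<le> (1/2) ^ n"
      using z(2) by (auto intro: always_eventually less_imp_le)
    show "(\<lambda>n. (1/2::real) ^ n) \<longlonglongrightarrow> 0" by (intro LIMSEQ_power_zero) simp
  qed
  have x0: "x 0 = x0" by (rule LIMSEQ_unique[OF xt z0x0]) simp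
  define V where "V n t = fb (z n t)" for n t
  have V: "continuous_on {0..} (V n)" for n unfolding V_def by (rule continuous_on_fb[OF z(1)])
  \<comment> \<open>The initial states differ by at most \<open>2 (1/2)^n\<close>; the square is
    \<open>4 (1/4)^n\<close>, and the factor two in the energy estimate leaves
    \<open>2 (1/4)^n\<close>.\<close>
  have VC: "energy {0..} (\<lambda>t. V m t - V n t) \<le> ennreal (2 * (1/4) ^ n)" if "n \<le> m" for m n
  proof -
    have "energy {0..} (\<lambda>t. V m t - V n t) = energy {0..} (\<lambda>t. fb (z m t - z n t))"
      unfolding energy_def V_def
      by (intro nn_integral_cong) (auto simp: indicator_def K_diff closed_loop_trajectoryD(1)[OF z(1)])
    then have "2 * energy {0..} (\<lambda>t. V m t - V n t) \<le> ennreal ((norm (z m 0 - z n 0))\<^sup>2)"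
      using closed_loop_energy_le[OF closed_loop_trajectory_diff[OF z(1) z(1)], of m n] by simp
    also have "\<dots> \<le> ennreal ((2 * (1/2) ^ n)\<^sup>2)"
      using z0[OF that] by (intro ennreal_leI power_mono) auto
    also have "(2 * (1/2::real) ^ n)\<^sup>2 = 4 * ((1/2) ^ n)\<^sup>2" by (simp only: power_mult_distrib) simp
    also have "((1/2::real) ^ n)\<^sup>2 = (1/4) ^ n"
      by (simp add: power2_eq_square flip: power_mult_distrib)
    finally have "2 * energy {0..} (\<lambda>t. V m t - V n t) \<le> ennreal (4 * (1/4) ^ n)" .
    then show ?thesis by (simp add: two_mult_le_ennreal_iff)
  qed
  obtain v where v: "strongly_measurable v" "\<And>n. energy {0..} (\<lambda>t. V n t - v t) \<le> ennreal (2 * (1/4) ^ n)"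
    "AE t in lebesgue. t \<in> {0..} \<longrightarrow> (\<lambda>n. V n t) \<longlonglongrightarrow> v t"
    by (rule L2_geometric_Cauchy_converges[OF V VC]) auto
  have ev: "2 * energy {0..} v \<le> ennreal ((norm x0)\<^sup>2)"
  proof -
    have "energy {0..} v \<le> ennreal ((norm x0)\<^sup>2 / 2)"
    proof (rule energy_fatou[OF strongly_measurable_continuous[OF V] _ _ v(3)])
      show "(\<lambda>n. ennreal ((norm (z n 0))\<^sup>2 / 2)) \<longlonglongrightarrow> ennreal ((norm x0)\<^sup>2 / 2)"
        by (intro tendsto_intros z0x0) simp
      have "energy {0..} (V n) \<le> ennreal ((norm (z n 0))\<^sup>2 / 2)" for n
        using closed_loop_energy_le[OF z(1), of n] unfolding V_def two_mult_le_ennreal_iff .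
      then show "\<forall>\<^sub>F n in sequentially. energy {0..} (V n) \<le> ennreal ((norm (z n 0))\<^sup>2 / 2)" by simp
    qed auto
    then show ?thesis by (simp add: two_mult_le_ennreal_iff)
  qed
  have vL: "v \<in> L2_loc"
  proof -
    have "energy {0..} v < \<infinity>"
      using ev by (cases "energy {0..} v") (auto simp: ennreal_mult_top top_unique)
    then show ?thesis using v(1) energy_mono[of "{0..\<tau>}" "{0..}" v for \<tau>]
      by (auto simp: L2_loc_iff intro: le_less_trans)
  qed
  have Vv: "L2_loc_converges V v"
    unfolding L2_loc_converges_iff
  proof (intro allI impI)
    fix \<tau> :: real assume "\<tau> \<ge> 0"
    have le: "energy {0..\<tau>} (\<lambda>t. V n t - v t) \<le> ennreal (2 * (1/4) ^ n)" for n
      by (rule order_trans[OF energy_mono v(2)]) auto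
    have lim: "(\<lambda>n. ennreal (2 * (1/4) ^ n)) \<longlonglongrightarrow> ennreal 0"
      by (intro tendsto_ennrealI tendsto_mult_right_zero LIMSEQ_power_zero) simp
    show "(\<lambda>n. energy {0..\<tau>} (\<lambda>t. V n t - v t)) \<longlonglongrightarrow> 0"
      by (rule tendsto_sandwich[OF _ always_eventually tendsto_const lim[unfolded ennreal_0]])
        (use le in simp_all)
  qed
  have approx: "\<exists>xs us ys. (\<forall>k. classical_solution S (xs k) (us k) (ys k)) \<and>
      (\<forall>\<tau>\<ge>0. uniform_limit {0..\<tau>} xs x sequentially) \<and>
      L2_loc_converges us (\<lambda>t. - v t) \<and> L2_loc_converges ys v"
  proof (rule exI[of _ z], rule exI[of _ "\<lambda>n t. - V n t"], rule exI[of _ V], intro conjI allI impI)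
    show "L2_loc_converges (\<lambda>n t. - V n t) (\<lambda>t. - v t)"
      using L2_loc_converges_scaleC[OF Vv L2_loc_continuous[OF V] vL, of "-1"] by (simp add: scaleC_minus1)
    show "classical_solution S (z k) (\<lambda>t. - V k t) (V k)" for k
      unfolding V_def by (rule closed_loop_trajectory_classical[OF z(1)])
    show "uniform_limit {0..\<tau>} z x sequentially" for \<tau>
      by (rule uniform_limit_on_subset[OF x]) auto
  qed (rule Vv)
  moreover have "continuous_on {0..} x"
    by (rule uniform_limit_theorem[OF _ x])
      (auto intro: always_eventually closed_loop_trajectoryD(4)[OF z(1)])
  moreover have "(\<lambda>t. - v t) \<in> L2_loc"
    using L2_loc_scaleC[OF vL, of "-1"] by (simp add: scaleC_minus1)
  ultimately have "generalized_solution S x (\<lambda>t. - v t) v"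
    unfolding generalized_solution_def using vL by blast
  moreover have "\<exists>z. closed_loop_trajectory z \<and> (\<forall>t\<ge>0. norm (x t - z t) \<le> e)" if e: "e > 0" for e
  proof -
    obtain n where "2 * (1/2::real) ^ n < e"
      using order_tendstoD(2)[OF half0 e] by (force simp: eventually_sequentially)
    then show ?thesis using z(1)[of n] near[of _ n] by (meson less_imp_le order_trans)
  qed
  ultimately show ?thesis using that x0 ev by blast
qed

end

section \<open>Quadratic forms on a Hilbert space\<close>

locale bounded_quadratic_form =
  fixes Q :: "'a::chilbert_space \<Rightarrow> real"
  assumes nonneg: "0 \<le> Q x" and le: "Q x \<le> (norm x)\<^sup>2"
    and parallelogram: "Q (x + y) + Q (x - y) = 2 * Q x + 2 * Q y"
    and scaleC: "Q (c *\<^sub>C x) = (cmod c)\<^sup>2 * Q x"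
begin

definition b :: "'a \<Rightarrow> 'a \<Rightarrow> real" where "b x y = (Q (x + y) - Q (x - y)) / 4"

lemma Q_minus: "Q (- x) = Q x"
  using scaleC[of "-1" x] by (simp add: scaleC_minus1)

lemma Q_0: "Q 0 = 0"
  using le[of 0] nonneg[of 0] by simp

lemma b_commute: "b x y = b y x"
  using Q_minus[of "x - y"] by (simp add: b_def add.commute)

lemma b_0: "b 0 y = 0"
  using Q_minus[of y] by (simp add: b_def)

lemma b_self: "b x x = Q x"
proof -
  have "Q (x + x) = 4 * Q x" using parallelogram[of x x] Q_0 by simp
  then show ?thesis by (simp add: b_def Q_0)
qed

text \<open>The parallelogram law at \<open>x + z\<close>, \<open>y + z\<close> and at
  \<open>x - z\<close>, \<open>y - z\<close> shows that \<open>b x z + b y z\<close> depends on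
  \<open>x + y\<close> and \<open>z\<close> only; compare with the pair \<open>x + y\<close>,
  \<open>0\<close>.\<close>

lemma b_add: "b (x + y) z = b x z + b y z"
proof -
  have half: "2 * (b x z + b y z) = b (x + y) (z + z)" for x y z
  proof -
    have "Q ((x + y) + (z + z)) + Q (x - y) = 2 * Q (x + z) + 2 * Q (y + z)"
      using parallelogram[of "x + z" "y + z"] by (simp add: algebra_simps)
    moreover have "Q ((x + y) - (z + z)) + Q (x - y) = 2 * Q (x - z) + 2 * Q (y - z)"
      using parallelogram[of "x - z" "y - z"] by (simp add: algebra_simps)
    ultimately show ?thesis unfolding b_def by (simp add: field_simps)
  qed
  show ?thesis using half[of x z y] half[of "x + y" z 0] by (simp add: b_0)
qed

lemma b_le_squares: "\<bar>b x y\<bar> \<le> ((norm x)\<^sup>2 + (norm y)\<^sup>2) / 2"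
  using parallelogram[of x y] nonneg[of "x + y"] nonneg[of "x - y"] le[of x] le[of y]
  unfolding b_def by (simp add: abs_le_iff field_simps)

text \<open>An additive function of \<open>r\<close> that vanishes at \<open>1\<close> is periodic; being bounded on \<open>[0, 1)\<close>
  it is bounded, and hence zero.\<close>

lemma b_scaleR: "b (r *\<^sub>R x) y = r * b x y"
proof -
  define f where "f r = b (r *\<^sub>R x) y - r * b x y" for r
  have add: "f (r + s) = f r + f s" for r s
    by (simp add: f_def scaleR_add_left b_add algebra_simps)
  have f0: "f 0 = 0" and f1: "f 1 = 0" by (simp_all add: f_def b_0)
  have nat: "f (real n * r) = real n * f r" for n r
    by (induction n) (simp_all add: f0 add distrib_right)
  have minus: "f (- r) = - f r" for r using add[of r "- r"] f0 by simp
  have int: "f (of_int k) = 0" for k :: int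
  proof (cases "k \<ge> 0")
    case True
    then show ?thesis using nat[of "nat k" 1] f1 by simp
  next
    case False
    then show ?thesis using nat[of "nat (- k)" 1] minus[of "of_int (- k)"] f1 by simp
  qed
  define M where "M = ((norm x)\<^sup>2 + (norm y)\<^sup>2) / 2 + \<bar>b x y\<bar>"
  have unit: "\<bar>f r\<bar> \<le> M" if r: "0 \<le> r" "r < 1" for r
  proof -
    have "(norm (r *\<^sub>R x))\<^sup>2 \<le> (norm x)\<^sup>2"
      using r by (intro power_mono) (auto simp: mult_left_le_one_le)
    then have "((norm (r *\<^sub>R x))\<^sup>2 + (norm y)\<^sup>2) / 2 \<le> ((norm x)\<^sup>2 + (norm y)\<^sup>2) / 2"
      by (intro divide_right_mono add_right_mono) auto
    with b_le_squares have "\<bar>b (r *\<^sub>R x) y\<bar> \<le> ((norm x)\<^sup>2 + (norm y)\<^sup>2) / 2" by (rule order_trans)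
    moreover have "\<bar>r * b x y\<bar> \<le> \<bar>b x y\<bar>" using r by (simp add: abs_mult mult_left_le_one_le)
    ultimately show ?thesis unfolding f_def M_def by linarith
  qed
  have bound: "\<bar>f r\<bar> \<le> M" for r
  proof -
    have "f r = f (frac r) + f (of_int \<lfloor>r\<rfloor>)" using add[of "frac r" "of_int \<lfloor>r\<rfloor>"] by (simp add: frac_def)
    then show ?thesis using unit[of "frac r"] int frac_ge_0[of r] frac_lt_1[of r] by simp
  qed
  have "f r = 0"
  proof (rule ccontr)
    assume "f r \<noteq> 0"
    then obtain n where "M < real n * \<bar>f r\<bar>" using reals_Archimedean3[of "\<bar>f r\<bar>"] by auto
    then show False using bound[of "real n * r"] by (simp add: nat abs_mult)
  qed
  then show ?thesis by (simp add: f_def)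
qed

text \<open>\<open>b_le_squares\<close> on unit vectors, transported by homogeneity.\<close>

lemma b_bound: "\<bar>b x y\<bar> \<le> norm x * norm y"
proof (cases "x = 0 \<or> y = 0")
  case True
  then show ?thesis using b_0 b_commute by (metis abs_zero norm_ge_zero mult_nonneg_nonneg)
next
  case False
  let ?x = "(1 / norm x) *\<^sub>R x" and ?y = "(1 / norm y) *\<^sub>R y"
  have "x = norm x *\<^sub>R ?x" "y = norm y *\<^sub>R ?y" using False by simp_all
  then have "b x y = norm x * (norm y * b ?y ?x)" by (metis b_scaleR b_commute)
  moreover have "\<bar>b ?y ?x\<bar> \<le> 1" using b_le_squares[of ?y ?x] False by simp
  then have "norm x * norm y * \<bar>b ?y ?x\<bar> \<le> norm x * norm y * 1" by (intro mult_left_mono) auto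
  ultimately show ?thesis by (simp add: abs_mult mult.assoc)
qed

lemma b_scaleC: "b (c *\<^sub>C x) (c *\<^sub>C y) = (cmod c)\<^sup>2 * b x y"
proof -
  have "c *\<^sub>C x - c *\<^sub>C y = c *\<^sub>C (x - y)"
    by (rule linear_diff[OF bounded_linear.linear[OF bounded_linear_scaleC], symmetric])
  then have "Q (c *\<^sub>C x - c *\<^sub>C y) = (cmod c)\<^sup>2 * Q (x - y)" by (simp add: scaleC)
  moreover have "Q (c *\<^sub>C x + c *\<^sub>C y) = (cmod c)\<^sup>2 * Q (x + y)"
    by (simp add: scaleC flip: scaleC_add_right)
  ultimately show ?thesis unfolding b_def by (simp add: right_diff_distrib)
qed

text \<open>Riesz yields \<open>P\<close> for the real form \<open>b\<close>. Complex linearity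
  comes from \<open>b (c x) (c y) = |c|^2 b x y\<close>: the inner product obeys the same rule, and
  every \<open>y\<close> is a multiple by \<open>c\<close> if \<open>c\<close> is nonzero.\<close>

lemma operator_exists: "\<exists>P. self_adjoint P \<and> (\<forall>x. Re (cinner x (P x)) = Q x)"
proof -
  have "bounded_linear (b x)" for x
    by (rule bounded_linear_intro[where K="norm x"])
      (use b_add b_scaleR b_commute b_bound in \<open>auto simp: mult.commute\<close>)
  then have "\<forall>x. \<exists>p. \<forall>y. b x y = inner p y" by (meson riesz_representation)
  then obtain P where P: "\<And>x y. b x y = inner (P x) y" by metis
  have eqI: "p = q" if "\<And>y. inner p y = inner q y" for p q :: 'a
  proof -
    have "inner (p - q) (p - q) = 0" using that[of "p - q"] by (simp add: inner_diff_left)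
    then show ?thesis by simp
  qed
  have "bounded_linear P"
  proof (rule bounded_linear_intro[where K=1])
    show "P (x + y) = P x + P y" for x y
      by (rule eqI) (simp add: inner_add_left b_add flip: P)
    show "P (r *\<^sub>R x) = r *\<^sub>R P x" for r x
      by (rule eqI) (simp add: b_scaleR flip: P)
    show "norm (P x) \<le> norm x * 1" for x
    proof (cases "P x = 0")
      case False
      have "norm (P x) * norm (P x) = b x (P x)" by (simp add: P norm_eq_sqrt_inner)
      also have "\<dots> \<le> norm x * norm (P x)" using b_bound[of x "P x"] by simp
      finally show ?thesis using False by simp
    qed simp
  qed
  moreover have Pc: "P (c *\<^sub>C x) = c *\<^sub>C P x" for c x
  proof (rule eqI)
    fix y
    have in_scaleC: "inner (c *\<^sub>C p) (c *\<^sub>C q) = (cmod c)\<^sup>2 * inner p q" for p q :: 'a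
    proof -
      have "cinner (c *\<^sub>C p) (c *\<^sub>C q) = c * cnj (c * cinner q p)"
        by (simp add: cinner_scaleC_left cinner_commute[where y=p and x="c *\<^sub>C q"])
      also have "\<dots> = (c * cnj c) * cinner p q" by (simp add: cinner_commute[where y=p and x=q])
      also have "c * cnj c = complex_of_real ((cmod c)\<^sup>2)" by (simp only: complex_norm_square)
      finally show ?thesis by (simp flip: Re_cinner)
    qed
    show "inner (P (c *\<^sub>C x)) y = inner (c *\<^sub>C P x) y"
    proof (cases "c = 0")
      case True
      have "0 *\<^sub>C z = 0" for z :: 'a using scaleC_of_real[of 0 z] by simp
      then show ?thesis using True by (simp add: b_0 flip: P)
    next
      case False
      have y: "y = c *\<^sub>C (1 / c) *\<^sub>C y" using False by (simp add: scaleC_scaleC scaleC_one)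
      have "inner (P (c *\<^sub>C x)) (c *\<^sub>C (1 / c) *\<^sub>C y) = inner (c *\<^sub>C P x) (c *\<^sub>C (1 / c) *\<^sub>C y)"
        by (simp only: in_scaleC b_scaleC flip: P)
      then show ?thesis by (simp only: y[symmetric])
    qed
  qed
  moreover have "cinner (P x) y = cinner x (P y)" for x y
  proof -
    \<comment> \<open>Imaginary parts are real inner products with \<open>- i p\<close>, so complex
      linearity of \<open>P\<close> carries the real symmetry over to \<open>cinner\<close>.\<close>
    have Im: "Im (cinner p q) = inner ((- \<i>) *\<^sub>C p) q" for p q :: 'a
      by (simp add: cinner_scaleC_left flip: Re_cinner)
    have sym: "inner (P x) y = inner x (P y)" for x y
      using b_commute[of x y] by (simp add: P inner_commute)
    show ?thesis by (rule complex_eqI) (simp_all add: Re_cinner sym Im flip: Pc)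
  qed
  moreover have "Re (cinner x (P x)) = Q x" for x
    by (simp add: Re_cinner inner_commute[of x] b_self flip: P)
  ultimately show ?thesis unfolding self_adjoint_def bounded_clinear_def by blast
qed

end

text \<open>Polarization: comparing the forms at \<open>x + y\<close>, \<open>x\<close> and
  \<open>y\<close> isolates \<open>2 inner y (P x)\<close>, by symmetry.\<close>

lemma self_adjoint_eqI:
  assumes "self_adjoint P" "self_adjoint R" "\<And>x. Re (cinner x (P x)) = Re (cinner x (R x))"
  shows "P = R"
proof
  fix x
  interpret P: bounded_linear P using assms(1) by (simp add: self_adjoint_def bounded_clinear_def)
  interpret R: bounded_linear R using assms(2) by (simp add: self_adjoint_def bounded_clinear_def)
  have sP: "inner (P x) y = inner x (P y)" for x y
    using assms(1) by (metis self_adjoint_def Re_cinner)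
  have sR: "inner (R x) y = inner x (R y)" for x y
    using assms(2) by (metis self_adjoint_def Re_cinner)
  have eq: "inner x (P x) = inner x (R x)" for x using assms(3) by (simp add: Re_cinner)
  have "inner y (P x) = inner y (R x)" for y
  proof -
    have "inner (x + y) (P (x + y)) = inner x (P x) + inner y (P y) + 2 * inner y (P x)"
      using sP[of x y] by (simp add: P.add inner_add_left inner_add_right inner_commute)
    moreover have "inner (x + y) (R (x + y)) = inner x (R x) + inner y (R y) + 2 * inner y (R x)"
      using sR[of x y] by (simp add: R.add inner_add_left inner_add_right inner_commute)
    ultimately show ?thesis using eq[of "x + y"] eq[of x] eq[of y] by simp
  qed
  from this[of "P x - R x"] show "P x = R x"
    by (metis inner_diff_right eq_iff_diff_eq_0 inner_eq_zero_iff)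
qed

section \<open>Optimal cost\<close>

lemma cost_eq:
  "cost S x0 u = (INF (x, y)\<in>{(x, y). generalized_solution S x u y \<and> x 0 = x0}.
    energy {0..} u + energy {0..} y)"
  unfolding cost_def
proof (intro INF_cong refl, clarify)
  fix x y assume "generalized_solution S x u y"
  then have sm: "strongly_measurable u" "strongly_measurable y"
    by (auto simp: generalized_solution_def L2_loc_iff)
  have "(\<integral>\<^sup>+t\<in>{0..}. ennreal ((norm (u t))\<^sup>2 + (norm (y t))\<^sup>2) \<partial>lebesgue)
      = (\<integral>\<^sup>+t. ennreal ((norm (u t))\<^sup>2) * indicator {0..} t + ennreal ((norm (y t))\<^sup>2) * indicator {0..} t \<partial>lebesgue)"
    by (intro nn_integral_cong) (simp add: indicator_def)
  also have "\<dots> = energy {0..} u + energy {0..} y"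
    unfolding energy_def by (intro nn_integral_add borel_measurable_energy sm) auto
  finally show "(\<integral>\<^sup>+t\<in>{0..}. ennreal ((norm (u t))\<^sup>2 + (norm (y t))\<^sup>2) \<partial>lebesgue)
      = energy {0..} u + energy {0..} y" .
qed

lemma cost_le:
  assumes "generalized_solution S x u y" "x 0 = x0"
  shows "cost S x0 u \<le> energy {0..} u + energy {0..} y"
  unfolding cost_eq by (rule INF_lower2[of "(x, y)"]) (use assms in auto)

text \<open>The infimum ranges over inputs in \<open>L2\<close>, yet the bound holds along every
  generalized solution: an input outside \<open>L2\<close> has infinite energy.\<close>

lemma optimal_cost_le:
  assumes g: "generalized_solution S x u y" "x 0 = x0"
  shows "optimal_cost S x0 \<le> energy {0..} u + energy {0..} y"
proof (cases "u \<in> L2")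
  case True
  then have "optimal_cost S x0 \<le> cost S x0 u" unfolding optimal_cost_def by (rule INF_lower)
  then show ?thesis using cost_le[OF g] by (rule order_trans)
next
  case False
  then have "\<not> energy {0..} u < \<infinity>"
    using g(1) by (auto simp: L2_iff generalized_solution_def L2_loc_iff)
  then have "energy {0..} u = \<infinity>" by (simp add: top.not_eq_extremum[symmetric])
  then show ?thesis by simp
qed

lemma optimal_cost_geI:
  assumes "\<And>x u y. generalized_solution S x u y \<Longrightarrow> x 0 = x0 \<Longrightarrow> c \<le> energy {0..} u + energy {0..} y"
  shows "c \<le> optimal_cost S x0"
  unfolding optimal_cost_def cost_eq by (intro INF_greatest) (auto intro: assms)

lemma optimal_cost_approx:
  assumes "optimal_cost S x0 < c"
  obtains x u y where "generalized_solution S x u y" "x 0 = x0" "energy {0..} u + energy {0..} y < c"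
proof -
  obtain u where "cost S x0 u < c" using assms by (auto simp: optimal_cost_def INF_less_iff)
  then show ?thesis using that by (auto simp: cost_eq INF_less_iff)
qed

lemma ennreal_double_add:
  "0 \<le> r \<Longrightarrow> 0 \<le> s \<Longrightarrow> 2 * ennreal r + 2 * ennreal s = ennreal (2 * r + 2 * s)"
  by (simp add: ennreal_mult')

lemma energy_uminus [simp]: "energy A (\<lambda>t. - f t) = energy A f"
  by (simp add: energy_def)

section \<open>The optimal cost as a quadratic form\<close>

context passive_node
begin

lemma optimal_cost_le_norm: "optimal_cost S x0 \<le> ennreal ((norm x0)\<^sup>2)"
proof -
  obtain x v where "generalized_solution S x (\<lambda>t. - v t) v" "x 0 = x0"
    "2 * energy {0..} v \<le> ennreal ((norm x0)\<^sup>2)"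
    by (rule closed_loop_solution_exists) blast
  then show ?thesis using optimal_cost_le[of S x "\<lambda>t. - v t" v x0] by (simp flip: mult_2)
qed

text \<open>The value function as a real number; nothing is lost, since
  \<open>optimal_cost_le_norm\<close> makes the optimal cost finite.\<close>

definition V :: "'x \<Rightarrow> real" where "V x0 = enn2real (optimal_cost S x0)"

lemma V_nonneg: "0 \<le> V x0"
  by (simp add: V_def)

lemma optimal_cost_eq_V: "optimal_cost S x0 = ennreal (V x0)"
  unfolding V_def using optimal_cost_le_norm[of x0]
  by (metis ennreal_enn2real ennreal_less_top order_le_less_trans)

lemma V_le_norm: "V x0 \<le> (norm x0)\<^sup>2"
  using optimal_cost_le_norm[of x0] by (simp add: optimal_cost_eq_V)

lemma V_approx:
  assumes "e > 0"
  obtains x u y where "generalized_solution S x u y" "x 0 = x0"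
    "energy {0..} u + energy {0..} y \<le> ennreal (V x0 + e)"
proof -
  have "optimal_cost S x0 < ennreal (V x0 + e)"
    using assms V_nonneg[of x0] by (simp add: optimal_cost_eq_V ennreal_less_iff)
  then show ?thesis by (rule optimal_cost_approx) (use that in \<open>auto intro: less_imp_le\<close>)
qed

lemma generalized_solution_measurable:
  assumes "generalized_solution S x u y"
  shows "strongly_measurable u" "strongly_measurable y"
  using assms by (auto simp: generalized_solution_def L2_loc_iff)

lemma V_scaleC_le: "V (c *\<^sub>C x0) \<le> (cmod c)\<^sup>2 * V x0"
proof (rule field_le_epsilon)
  fix e :: real assume "e > 0"
  \<comment> \<open>The summand \<open>1\<close> keeps the denominator positive for
    \<open>c = 0\<close>.\<close>
  define d where "d = e / ((cmod c)\<^sup>2 + 1)"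
  have "(cmod c)\<^sup>2 + 1 > 0" by (simp add: add_nonneg_pos)
  then have d: "d > 0" "(cmod c)\<^sup>2 * d \<le> e" using \<open>e > 0\<close> by (simp_all add: d_def field_simps)
  obtain x u y where g: "generalized_solution S x u y" "x 0 = x0"
    and le: "energy {0..} u + energy {0..} y \<le> ennreal (V x0 + d)"
    using V_approx[OF d(1)] by blast
  note sm = generalized_solution_measurable[OF g(1)]
  have "optimal_cost S (c *\<^sub>C x0) \<le> energy {0..} (\<lambda>t. c *\<^sub>C u t) + energy {0..} (\<lambda>t. c *\<^sub>C y t)"
    by (rule optimal_cost_le[OF generalized_solution_scaleC[OF linear g(1)]]) (simp add: g(2))
  also have "\<dots> = ennreal ((cmod c)\<^sup>2) * (energy {0..} u + energy {0..} y)"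
    by (simp add: energy_scaleC sm distrib_left)
  also have "\<dots> \<le> ennreal ((cmod c)\<^sup>2) * ennreal (V x0 + d)" by (rule mult_left_mono[OF le]) simp
  also have "\<dots> = ennreal ((cmod c)\<^sup>2 * (V x0 + d))" by (simp add: ennreal_mult')
  finally have "V (c *\<^sub>C x0) \<le> (cmod c)\<^sup>2 * (V x0 + d)"
    using V_nonneg[of x0] d(1) by (simp add: optimal_cost_eq_V)
  then show "V (c *\<^sub>C x0) \<le> (cmod c)\<^sup>2 * V x0 + e" using d(2) by (simp add: distrib_left)
qed

lemma V_scaleC: "V (c *\<^sub>C x0) = (cmod c)\<^sup>2 * V x0"
proof (cases "c = 0")
  case True
  then show ?thesis using V_scaleC_le[of 0 x0] V_nonneg[of "0 *\<^sub>C x0"] by simp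
next
  case False
  have "V x0 = V ((1 / c) *\<^sub>C c *\<^sub>C x0)" using False by (simp add: scaleC_scaleC scaleC_one)
  also have "\<dots> \<le> (cmod (1 / c))\<^sup>2 * V (c *\<^sub>C x0)" by (rule V_scaleC_le)
  finally have "(cmod c)\<^sup>2 * V x0 \<le> V (c *\<^sub>C x0)"
    using False by (simp add: norm_divide power_divide field_simps)
  then show ?thesis using V_scaleC_le[of c x0] by simp
qed

text \<open>Sum and difference of nearly optimal solutions are admissible for \<open>a + b\<close>
  and \<open>a - b\<close>, and energies obey the parallelogram law. Two errors of
  \<open>e / 4\<close>, each doubled, add up to \<open>e\<close>.\<close>

lemma V_parallelogram_le: "V (a + b) + V (a - b) \<le> 2 * V a + 2 * V b"
proof (rule field_le_epsilon)
  fix e :: real assume "e > 0"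
  then have d: "e / 4 > 0" by simp
  let ?J = "energy {0..}"
  obtain x u y where g: "generalized_solution S x u y" "x 0 = a"
    and le: "?J u + ?J y \<le> ennreal (V a + e / 4)"
    using V_approx[OF d] by blast
  obtain x' u' y' where g': "generalized_solution S x' u' y'" "x' 0 = b"
    and le': "?J u' + ?J y' \<le> ennreal (V b + e / 4)"
    using V_approx[OF d] by blast
  note sm = generalized_solution_measurable[OF g(1)] generalized_solution_measurable[OF g'(1)]
  let ?up = "\<lambda>t. u t + u' t" and ?um = "\<lambda>t. u t - u' t"
  let ?yp = "\<lambda>t. y t + y' t" and ?ym = "\<lambda>t. y t - y' t"
  have "ennreal (V (a + b)) \<le> ?J ?up + ?J ?yp"
    unfolding optimal_cost_eq_V[symmetric]
    by (rule optimal_cost_le[OF generalized_solution_add[OF linear g(1) g'(1)]]) (simp add: g g')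
  moreover have "ennreal (V (a - b)) \<le> ?J ?um + ?J ?ym"
    unfolding optimal_cost_eq_V[symmetric]
    by (rule optimal_cost_le[OF generalized_solution_diff[OF linear g(1) g'(1)]]) (simp add: g g')
  ultimately have "ennreal (V (a + b)) + ennreal (V (a - b))
      \<le> (?J ?up + ?J ?yp) +
        (?J ?um + ?J ?ym)"
    by (rule add_mono)
  also have "\<dots> = (?J ?up + ?J ?um) +
        (?J ?yp + ?J ?ym)"
    by (simp only: ac_simps)
  also have "\<dots> = (2 * ?J u + 2 * ?J u') + (2 * ?J y + 2 * ?J y')"
    by (simp add: energy_parallelogram sm)
  also have "\<dots> = 2 * (?J u + ?J y) + 2 * (?J u' + ?J y')"
    by (simp only: distrib_left ac_simps)
  also have "\<dots> \<le> 2 * ennreal (V a + e / 4) + 2 * ennreal (V b + e / 4)"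
    by (intro add_mono mult_left_mono le le') auto
  also have "\<dots> = ennreal (2 * (V a + e / 4) + 2 * (V b + e / 4))"
    using V_nonneg[of a] V_nonneg[of b] \<open>e > 0\<close> by (intro ennreal_double_add) auto
  finally have "V (a + b) + V (a - b) \<le> 2 * (V a + e / 4) + 2 * (V b + e / 4)"
    using V_nonneg[of a] V_nonneg[of b] V_nonneg[of "a + b"] V_nonneg[of "a - b"] \<open>e > 0\<close>
    by (simp flip: ennreal_plus)
  then show "V (a + b) + V (a - b) \<le> 2 * V a + 2 * V b + e" by simp
qed

text \<open>The reverse of the parallelogram inequality is the same inequality for
  \<open>x + y\<close> and \<open>x - y\<close>, whose sum and difference are \<open>2 x\<close> and
  \<open>2 y\<close>.\<close>

lemma V_quadratic_form: "bounded_quadratic_form V"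
proof
  fix x y :: 'x
  have two: "V (2 *\<^sub>R z) = 4 * V z" for z
    using V_scaleC[of "complex_of_real 2" z] by (simp only: scaleC_of_real) simp
  have s: "(x + y) + (x - y) = 2 *\<^sub>R x" "(x + y) - (x - y) = 2 *\<^sub>R y" by (simp_all add: scaleR_2 algebra_simps)
  have "V (2 *\<^sub>R x) + V (2 *\<^sub>R y) \<le> 2 * V (x + y) + 2 * V (x - y)"
    using V_parallelogram_le[of "x + y" "x - y"] unfolding s .
  then have "2 * V x + 2 * V y \<le> V (x + y) + V (x - y)" by (simp add: two)
  then show "V (x + y) + V (x - y) = 2 * V x + 2 * V y" using V_parallelogram_le[of x y] by linarith
qed (rule V_nonneg V_le_norm V_scaleC)+

lemma optimal_cost_operator_iff:
  "optimal_cost_operator S P \<longleftrightarrow> self_adjoint P \<and> (\<forall>x0. Re (cinner x0 (P x0)) = V x0)"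
  by (simp add: optimal_cost_operator_def optimal_cost_eq_V enn2ereal_ennreal V_nonneg)

lemma optimal_cost_operator_exists: "\<exists>P. optimal_cost_operator S P"
  unfolding optimal_cost_operator_iff
  by (rule bounded_quadratic_form.operator_exists[OF V_quadratic_form])

lemma optimal_cost_operator_unique:
  "optimal_cost_operator S P \<Longrightarrow> optimal_cost_operator S P' \<Longrightarrow> P = P'"
  unfolding optimal_cost_operator_iff by (rule self_adjoint_eqI) auto

lemma finite_cost_condition: "finite_cost_condition S"
  unfolding finite_cost_condition_def
proof
  fix x0
  obtain x v where g: "generalized_solution S x (\<lambda>t. - v t) v" "x 0 = x0"
    and le: "2 * energy {0..} v \<le> ennreal ((norm x0)\<^sup>2)"
    by (rule closed_loop_solution_exists) blast
  have "cost S x0 (\<lambda>t. - v t) \<le> ennreal ((norm x0)\<^sup>2)"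
    using cost_le[OF g] le by (simp flip: mult_2)
  then show "\<exists>u. cost S x0 u < \<infinity>" using le_less_trans[OF _ ennreal_less_top] by auto
qed

section \<open>Strongly stable closed loop\<close>

lemma closed_loop_trajectory_unique:
  assumes "closed_loop_trajectory x" "closed_loop_trajectory x'" "x 0 = x' 0" "t \<ge> 0"
  shows "x t = x' t"
  using closed_loop_trajectory_norm_le[OF closed_loop_trajectory_diff[OF assms(1,2)] assms(4)] assms(3)
  by simp

lemma generated_closed_loop_trajectory:
  assumes gen: "generates \<lparr>Dom = K_dom, app = K\<rparr> TK" and z: "z \<in> K_dom"
  shows "closed_loop_trajectory (\<lambda>t. TK t z)"
proof -
  interpret generated_semigroup TK "\<lparr>Dom = K_dom, app = K\<rparr>"
    using gen by unfold_locales (simp_all add: generates_def)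
  have T: "TK t z \<in> K_dom \<and> K (TK t z) = TK t (K z)" if "t \<ge> 0" for t
    using T_in_Dom[of z t] z that by simp
  have "continuous_on {0..} (\<lambda>t. K (TK t z))"
    by (rule continuous_on_eq[OF continuous_on_T[of "K z"]]) (use T in auto)
  then show ?thesis
    using T T_has_vector_derivative[of z] z by (simp add: closed_loop_trajectory_def)
qed

text \<open>The nearby classical trajectories are orbits of \<open>TK\<close>, by uniqueness, and so
  decay; an error of \<open>e / 2\<close>, uniform in time, lets \<open>x\<close> inherit the
  decay.\<close>

lemma strongly_stable_limit:
  assumes gen: "generates \<lparr>Dom = K_dom, app = K\<rparr> TK" and st: "strongly_stable TK"
    and x: "\<And>e. e > 0 \<Longrightarrow> \<exists>z. closed_loop_trajectory z \<and> (\<forall>t\<ge>0. norm (x t - z t) \<le> e)"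
  shows "((\<lambda>t. norm (x t)) \<longlongrightarrow> 0) at_top"
proof (rule tendstoI)
  fix e :: real assume "e > 0"
  then obtain z where z: "closed_loop_trajectory z" "\<And>t. t \<ge> 0 \<Longrightarrow> norm (x t - z t) \<le> e / 2"
    using x[of "e / 2"] by auto
  have z0: "z 0 \<in> K_dom" using closed_loop_trajectoryD(1)[OF z(1)] by simp
  have "TK 0 = id" using gen by (simp add: generates_def c0_semigroup_def)
  then have eq: "z t = TK t (z 0)" if "t \<ge> 0" for t
    using closed_loop_trajectory_unique[OF z(1) generated_closed_loop_trajectory[OF gen z0] _ that] by simp
  have "((\<lambda>t. norm (TK t (z 0))) \<longlongrightarrow> 0) at_top" using st by (simp add: strongly_stable_def)
  then have "\<forall>\<^sub>F t in at_top. norm (TK t (z 0)) < e / 2"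
    using \<open>e > 0\<close> by (intro order_tendstoD(2)) auto
  then show "\<forall>\<^sub>F t in at_top. dist (norm (x t)) 0 < e"
    using eventually_ge_at_top[of 0]
  proof eventually_elim
    case (elim t)
    have "norm (x t) \<le> norm (x t - z t) + norm (z t)" by (metis norm_triangle_ineq diff_add_cancel)
    then show ?case using z(2)[of t] elim eq[of t] by simp
  qed
qed

text \<open>The derivative of the squared norm of \<open>x\<close> is twice the inner product of
  \<open>y\<close> and \<open>u\<close>, that is, the square of \<open>u + y\<close> minus the
  squares of \<open>u\<close> and \<open>y\<close>. The subtracted terms are moved to the left
  because subtraction in \<open>ennreal\<close> truncates.\<close>

lemma classical_energy_identity:
  assumes pres: "impedance_energy_preserving S" and c: "classical_solution S x u y" and "\<tau> \<ge> 0"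
  shows "ennreal ((norm (x \<tau>))\<^sup>2) + (energy {0..\<tau>} u + energy {0..\<tau>} y)
    = ennreal ((norm (x 0))\<^sup>2) + energy {0..\<tau>} (\<lambda>t. u t + y t)"
proof -
  obtain z where z: "\<And>t. t \<ge> 0 \<Longrightarrow> (x has_vector_derivative z t) (at t within {0..})"
    "\<And>t. t \<ge> 0 \<Longrightarrow> (x t, u t) \<in> Dom S \<and> (z t, y t) = app S (x t, u t)"
    and uy: "continuous_on {0..} u" "continuous_on {0..} y"
    using c unfolding classical_solution_def by blast
  let ?I = "\<lambda>f. integral {0..\<tau>} (\<lambda>t. (norm (f t))\<^sup>2)"
  have ci: "((\<lambda>t. (norm (f t))\<^sup>2) has_integral ?I f) {0..\<tau>}" if "continuous_on {0..} f"
    for f :: "real \<Rightarrow> 'u"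
    by (intro integrable_integral integrable_continuous_interval continuous_intros
        continuous_on_subset[OF that]) auto
  have I0: "0 \<le> ?I f" if "continuous_on {0..} f" for f :: "real \<Rightarrow> 'u"
    by (rule has_integral_nonneg[OF ci[OF that]]) simp
  have 1: "((\<lambda>t. (norm (u t + y t))\<^sup>2 - ((norm (u t))\<^sup>2 + (norm (y t))\<^sup>2)) has_integral
      (inner (x \<tau>) (x \<tau>) - inner (x 0) (x 0))) {0..\<tau>}"
  proof (rule fundamental_theorem_of_calculus[OF \<open>\<tau> \<ge> 0\<close>])
    fix t assume t: "t \<in> {0..\<tau>}"
    have "(x has_vector_derivative z t) (at t within {0..\<tau>})"
      by (rule has_vector_derivative_within_subset[OF z(1)]) (use t in auto)
    from bounded_bilinear.has_vector_derivative[OF bounded_bilinear_inner this this]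
    have "((\<lambda>t. inner (x t) (x t)) has_vector_derivative 2 * inner (z t) (x t)) (at t within {0..\<tau>})"
      by (simp add: inner_commute)
    moreover have "AB S (x t, u t) = z t" "CD S (x t, u t) = y t" "(x t, u t) \<in> Dom S"
      using z(2)[of t] t by (auto simp: prod_eq_iff)
    then have "inner (z t) (x t) = inner (y t) (u t)"
      using pres by (auto simp: impedance_energy_preserving_def Re_cinner)
    ultimately show "((\<lambda>t. inner (x t) (x t)) has_vector_derivative
        (norm (u t + y t))\<^sup>2 - ((norm (u t))\<^sup>2 + (norm (y t))\<^sup>2)) (at t within {0..\<tau>})"
      by (simp add: power2_norm_eq_inner inner_add_left inner_add_right inner_commute)
  qed
  have 2: "((\<lambda>t. (norm (u t + y t))\<^sup>2 - ((norm (u t))\<^sup>2 + (norm (y t))\<^sup>2)) has_integral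
      (?I (\<lambda>t. u t + y t) - (?I u + ?I y))) {0..\<tau>}"
    by (intro has_integral_diff has_integral_add ci uy continuous_on_add)
  have "(norm (x \<tau>))\<^sup>2 + (?I u + ?I y) = (norm (x 0))\<^sup>2 + ?I (\<lambda>t. u t + y t)"
    using has_integral_unique[OF 1 2] by (simp add: power2_norm_eq_inner)
  from arg_cong[OF this, of ennreal] show ?thesis
    by (simp add: energy_continuous I0 uy continuous_on_add)
qed

lemma generalized_energy_identity:
  assumes pres: "impedance_energy_preserving S" and g: "generalized_solution S x u y" and "\<tau> \<ge> 0"
  shows "ennreal ((norm (x \<tau>))\<^sup>2) + (energy {0..\<tau>} u + energy {0..\<tau>} y)
    = ennreal ((norm (x 0))\<^sup>2) + energy {0..\<tau>} (\<lambda>t. u t + y t)"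
proof -
  obtain xs us ys where s: "\<And>k. classical_solution S (xs k) (us k) (ys k)"
    "\<And>\<tau>. \<tau> \<ge> 0 \<Longrightarrow> uniform_limit {0..\<tau>} xs x sequentially"
    "L2_loc_converges us u" "L2_loc_converges ys y"
    and uy: "u \<in> L2_loc" "y \<in> L2_loc"
    using g unfolding generalized_solution_def by blast
  note L = classical_solution_L2_loc[OF s(1)]
  have xt: "(\<lambda>k. xs k t) \<longlonglongrightarrow> x t" if "t \<in> {0..\<tau>}" for t
    by (rule tendsto_uniform_limitI[OF s(2)[OF \<open>\<tau> \<ge> 0\<close>] that])
  have "(\<lambda>k. ennreal ((norm (xs k \<tau>))\<^sup>2) + (energy {0..\<tau>} (us k) + energy {0..\<tau>} (ys k)))
      \<longlonglongrightarrow> ennreal ((norm (x \<tau>))\<^sup>2) + (energy {0..\<tau>} u + energy {0..\<tau>} y)"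
    by (intro tendsto_add tendsto_ennrealI tendsto_power tendsto_norm xt energy_tendsto s(3,4) L uy \<open>\<tau> \<ge> 0\<close>)
      (use \<open>\<tau> \<ge> 0\<close> in simp)
  moreover have "(\<lambda>k. ennreal ((norm (xs k 0))\<^sup>2) + energy {0..\<tau>} (\<lambda>t. us k t + ys k t))
      \<longlonglongrightarrow> ennreal ((norm (x 0))\<^sup>2) + energy {0..\<tau>} (\<lambda>t. u t + y t)"
    by (intro tendsto_add tendsto_ennrealI tendsto_power tendsto_norm xt energy_tendsto
        L2_loc_converges_add s(3,4) L2_loc_add L uy \<open>\<tau> \<ge> 0\<close>)
      (use \<open>\<tau> \<ge> 0\<close> in simp)
  ultimately show ?thesis
    unfolding classical_energy_identity[OF pres s(1) \<open>\<tau> \<ge> 0\<close>] by (rule LIMSEQ_unique)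
qed

text \<open>Completion of squares around the closed-loop solution \<open>(xK, -v, v)\<close>: the energy identities
  of \<open>x\<close> and \<open>x - xK\<close> have the same right-hand side up to the initial value, because
  \<open>(u + v) + (y - v) = u + y\<close>.\<close>

lemma closed_loop_cost_excess:
  assumes pres: "impedance_energy_preserving S"
    and g: "generalized_solution S x u y" "x 0 = x0"
    and K: "generalized_solution S xK (\<lambda>t. - v t) v" "xK 0 = x0" "((\<lambda>t. norm (xK t)) \<longlongrightarrow> 0) at_top"
    and "s \<ge> 0"
  shows "ennreal ((norm x0)\<^sup>2) + energy {0..s} (\<lambda>t. u t + v t) \<le> energy {0..} u + energy {0..} y"
proof (cases "energy {0..} u + energy {0..} y < \<infinity>")
  case True
  define C where "C = enn2real (energy {0..} u + energy {0..} y)"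
  have C: "energy {0..} u + energy {0..} y = ennreal C" "C \<ge> 0"
    using True by (simp_all add: C_def)
  let ?p = "\<lambda>t. u t + v t" and ?q = "\<lambda>t. y t - v t"
  have d: "generalized_solution S (\<lambda>t. x t - xK t) ?p ?q"
    using generalized_solution_diff[OF linear g(1) K(1)] by simp
  have L: "u \<in> L2_loc" "y \<in> L2_loc" "?p \<in> L2_loc" "?q \<in> L2_loc"
    using g(1) d by (auto simp: generalized_solution_def)
  have real: "energy {0..t} f = ennreal (enn2real (energy {0..t} f))" if "f \<in> L2_loc" "t \<ge> 0" for f :: "real \<Rightarrow> 'u" and t
    using that by (simp add: L2_loc_iff)
  define E where "E t f = enn2real (energy {0..t} f)" for t and f :: "real \<Rightarrow> 'u"
  have E0: "E t f \<ge> 0" for t f by (simp add: E_def)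
  \<comment> \<open>A bound for \<open>norm (x t)\<close> independent of \<open>t\<close>, valid
    because the cost is finite; it lets the cross term with \<open>xK t\<close> die out as
    \<open>t\<close> grows.\<close>
  let ?c = "sqrt ((norm x0)\<^sup>2 + 2 * C)"
  have le: "(norm x0)\<^sup>2 + E s ?p \<le> C + 2 * ?c * norm (xK t)"
    if t: "t \<ge> s" for t
  proof -
    have "t \<ge> 0" using t \<open>s \<ge> 0\<close> by simp
    note real = real[OF _ \<open>t \<ge> 0\<close>, folded E_def]
    let ?w = "\<lambda>t. u t + y t"
    have Lw: "?w \<in> L2_loc" by (intro L2_loc_add L)
    have "ennreal ((norm (x t))\<^sup>2) + (energy {0..t} u + energy {0..t} y) = ennreal ((norm x0)\<^sup>2) + energy {0..t} ?w"
      using generalized_energy_identity[OF pres g(1) \<open>t \<ge> 0\<close>] g(2) by simp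
    then have 1: "(norm (x t))\<^sup>2 + (E t u + E t y) = (norm x0)\<^sup>2 + E t ?w"
      using E0 by (simp add: real L Lw flip: ennreal_plus)
    have "ennreal ((norm (x t - xK t))\<^sup>2) + (energy {0..t} ?p + energy {0..t} ?q) = energy {0..t} ?w"
      using generalized_energy_identity[OF pres d \<open>t \<ge> 0\<close>] g(2) K(2) by simp
    then have 2: "(norm (x t - xK t))\<^sup>2 + (E t ?p + E t ?q) = E t ?w"
      using E0 by (simp add: real L Lw flip: ennreal_plus)
    have 3: "E t u + E t y \<le> C"
    proof -
      have "energy {0..t} u + energy {0..t} y \<le> ennreal C"
        unfolding C(1)[symmetric] by (intro add_mono energy_mono) auto
      then show ?thesis using E0 C(2) by (simp add: real L flip: ennreal_plus)
    qed
    have 4: "E t ?w \<le> 2 * (E t u + E t y)"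
    proof -
      have "energy {0..t} ?w \<le> 2 * energy {0..t} u + 2 * energy {0..t} y"
        by (rule energy_add_le) (use L in \<open>auto simp: L2_loc_iff\<close>)
      then have "ennreal (E t ?w) \<le> ennreal (2 * E t u + 2 * E t y)"
        unfolding real[OF L(1)] real[OF L(2)] real[OF Lw] ennreal_double_add[OF E0 E0] .
      then show ?thesis using E0[of t u] E0[of t y] by (subst (asm) ennreal_le_iff) auto
    qed
    \<comment> \<open>The window \<open>[0, s]\<close> stays fixed while \<open>t\<close> tends to
      infinity.\<close>
    have 5: "E s ?p \<le> E t ?p"
    proof -
      have "energy {0..s} ?p \<le> energy {0..t} ?p"
        using t by (intro energy_mono) auto
      then show ?thesis
        unfolding E_def using L(3) \<open>t \<ge> 0\<close> by (intro enn2real_mono) (auto simp: L2_loc_iff)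
    qed
    have "(norm (x t))\<^sup>2 = (norm x0)\<^sup>2 + E t ?w - (E t u + E t y)" using 1 by simp
    also have "\<dots> \<le> (norm x0)\<^sup>2 + 2 * (E t u + E t y) - (E t u + E t y)" using 4 by simp
    also have "\<dots> \<le> (norm x0)\<^sup>2 + 2 * C" using 3 C(2) by simp
    finally have "(norm (x t))\<^sup>2 \<le> (norm x0)\<^sup>2 + 2 * C" .
    then have "norm (x t) \<le> ?c" by (rule real_le_rsqrt)
    then have "norm (x t) * norm (xK t) \<le> ?c * norm (xK t)"
      by (rule mult_right_mono) simp
    moreover have "(norm (x t))\<^sup>2 - (norm (x t - xK t))\<^sup>2 \<le> 2 * (norm (x t) * norm (xK t))"
    proof -
      have "(norm (x t))\<^sup>2 - (norm (x t - xK t))\<^sup>2 = 2 * inner (x t) (xK t) - (norm (xK t))\<^sup>2"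
        by (simp add: power2_norm_eq_inner inner_diff_left inner_diff_right inner_commute)
      also have "\<dots> \<le> 2 * inner (x t) (xK t)" by simp
      also have "inner (x t) (xK t) \<le> norm (x t) * norm (xK t)" by (rule norm_cauchy_schwarz)
      finally show ?thesis by simp
    qed
    \<comment> \<open>Subtracting identity 2 from identity 1 removes the energy of
      \<open>u + y\<close>; the initial value, the cost up to \<open>t\<close>, the energies of
      \<open>?p\<close> and \<open>?q\<close> and the cross term remain.\<close>
    ultimately show ?thesis using 1 2 3 5 E0[of t "?q"] by linarith
  qed
  have "((\<lambda>t. C + 2 * ?c * norm (xK t)) \<longlongrightarrow> C + 2 * ?c * 0) at_top"
    by (intro tendsto_intros K(3))
  then have "(norm x0)\<^sup>2 + E s ?p \<le> C + 2 * ?c * 0"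
    by (rule tendsto_lowerbound) (use le in \<open>auto simp: eventually_at_top_linorder\<close>)
  then have "ennreal ((norm x0)\<^sup>2 + E s ?p) \<le> ennreal C" by (intro ennreal_leI) simp
  then show ?thesis
    using real[OF L(3) \<open>s \<ge> 0\<close>, folded E_def] E0 by (simp add: C(1) ennreal_plus)
next
  case False
  then have "energy {0..} u + energy {0..} y = \<infinity>" using False
    by (simp only: infinity_ennreal_def top.not_eq_extremum[symmetric] not_not)
  then show ?thesis by (subst \<open>_ = \<infinity>\<close>) simp
qed

text \<open>Energy preservation turns the two terms with \<open>AB S\<close> into twice the real
  inner product of output and input, which completes the square of their sum.\<close>

lemma energy_preserving_riccati:
  assumes "impedance_energy_preserving S"
  shows "riccati_solution S id (\<lambda>(x, u). CD S (x, u) + u)"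
proof -
  have eq: "cinner (AB S (x, u)) x + cinner x (AB S (x, u)) +
      complex_of_real ((norm (CD S (x, u)))\<^sup>2) + complex_of_real ((norm u)\<^sup>2)
      = complex_of_real ((norm (CD S (x, u) + u))\<^sup>2)" if "(x, u) \<in> Dom S" for x u
  proof -
    have "inner (AB S (x, u)) x = inner (CD S (x, u)) u"
      using assms that by (auto simp: impedance_energy_preserving_def Re_cinner)
    then have "2 * inner (AB S (x, u)) x + (norm (CD S (x, u)))\<^sup>2 + (norm u)\<^sup>2 = (norm (CD S (x, u) + u))\<^sup>2"
      by (simp add: power2_norm_eq_inner inner_add_left inner_add_right inner_commute)
    then show ?thesis unfolding cinner_add_self of_real_add[symmetric] by simp
  qed
  have "bounded_clinear id" unfolding bounded_clinear_def id_def by (simp add: bounded_linear_ident)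
  then have "self_adjoint id" by (simp add: self_adjoint_def)
  moreover have "clinear_on (Dom S) (\<lambda>(x, u). CD S (x, u) + u)"
    unfolding clinear_on_def
  proof (intro conjI ballI allI)
    show "0 \<in> Dom S" using linear by (simp add: clinear_on_def)
  qed (use clinear_on_add[OF linear] clinear_on_scaleC[OF linear] in
      \<open>auto simp: case_prod_beta scaleC_prod_def scaleC_add_right\<close>)
  ultimately show ?thesis unfolding riccati_solution_def using eq by auto
qed

lemma strongly_stable_optimal_control:
  assumes pres: "impedance_energy_preserving S"
    and gen: "generates \<lparr>Dom = K_dom, app = K\<rparr> TK" and st: "strongly_stable TK"
  shows "\<exists>x u y. generalized_solution S x u y \<and> x 0 = x0 \<and>
      (AE t in lebesgue_on {0..}. u t = - y t) \<and>
      optimal_control S x0 u \<and> stabilizing_control S x0 u \<and>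
      (\<forall>w. optimal_control S x0 w \<and> stabilizing_control S x0 w \<longrightarrow>
        (AE t in lebesgue_on {0..}. w t = u t))" (is ?control)
    and "V x0 = (norm x0)\<^sup>2"
proof -
  obtain x v where K: "generalized_solution S x (\<lambda>t. - v t) v" "x 0 = x0"
    and ev: "2 * energy {0..} v \<le> ennreal ((norm x0)\<^sup>2)"
    and app: "\<And>e. e > 0 \<Longrightarrow> \<exists>z. closed_loop_trajectory z \<and> (\<forall>t\<ge>0. norm (x t - z t) \<le> e)"
    by (rule closed_loop_solution_exists) blast
  have lim: "((\<lambda>t. norm (x t)) \<longlongrightarrow> 0) at_top" by (rule strongly_stable_limit[OF gen st app])
  note excess = closed_loop_cost_excess[OF pres _ _ K lim]
  have ge: "ennreal ((norm x0)\<^sup>2) \<le> optimal_cost S x0"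
  proof (rule optimal_cost_geI)
    fix x' u y assume g: "generalized_solution S x' u y" "x' 0 = x0"
    have "ennreal ((norm x0)\<^sup>2) \<le> ennreal ((norm x0)\<^sup>2) + energy {0..0} (\<lambda>t. u t + v t)" by simp
    then show "ennreal ((norm x0)\<^sup>2) \<le> energy {0..} u + energy {0..} y"
      using excess[OF g, of 0] by (meson order_refl order_trans)
  qed
  then have oc: "optimal_cost S x0 = ennreal ((norm x0)\<^sup>2)" using optimal_cost_le_norm by (intro antisym)
  then show "V x0 = (norm x0)\<^sup>2" by (simp add: V_def)
  have sm: "strongly_measurable v" by (rule generalized_solution_measurable[OF K(1)])
  have "energy {0..} v < \<infinity>"
    using ev by (cases "energy {0..} v") (auto simp: ennreal_mult_top top_unique)
  then have uL2: "(\<lambda>t. - v t) \<in> L2"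
    using generalized_solution_measurable[OF K(1)] by (simp add: L2_iff)
  have "cost S x0 (\<lambda>t. - v t) \<le> ennreal ((norm x0)\<^sup>2)"
    using cost_le[OF K] ev by (simp flip: mult_2)
  moreover have "optimal_cost S x0 \<le> cost S x0 (\<lambda>t. - v t)"
    unfolding optimal_cost_def using uL2 by (rule INF_lower)
  ultimately have opt: "optimal_control S x0 (\<lambda>t. - v t)"
    using uL2 oc by (auto simp: optimal_control_def intro: antisym)
  have unique: "AE t in lebesgue_on {0..}. w t = - v t" if w: "optimal_control S x0 w" for w
  proof -
    have swm: "strongly_measurable w" using w by (simp add: optimal_control_def L2_iff)
    then have sms: "strongly_measurable (\<lambda>t. w t + v t)" by (intro strongly_measurable_add sm)
    \<comment> \<open>The cost of \<open>w\<close> is an infimum, so it is approached by solutions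
      with cost below the squared norm of \<open>x0\<close> plus \<open>e\<close>; the finite
      initial term cancels, and the excess is at most \<open>e\<close>.\<close>
    have "energy {0..s} (\<lambda>t. w t + v t) \<le> 0" if "s \<ge> 0" for s
    proof (rule ennreal_le_epsilon)
      fix e :: real assume "e > 0"
      then have "cost S x0 w < ennreal ((norm x0)\<^sup>2 + e)"
        using w oc by (simp add: optimal_control_def ennreal_less_iff)
      then obtain x' y where g: "generalized_solution S x' w y" "x' 0 = x0"
        "energy {0..} w + energy {0..} y < ennreal ((norm x0)\<^sup>2 + e)"
        by (auto simp: cost_eq INF_less_iff)
      note excess[OF g(1,2) that]
      also note less_imp_le[OF g(3)]
      also have "ennreal ((norm x0)\<^sup>2 + e) = ennreal ((norm x0)\<^sup>2) + ennreal e"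
        using \<open>e > 0\<close> by (simp add: ennreal_plus)
      finally have "ennreal ((norm x0)\<^sup>2) + energy {0..s} (\<lambda>t. w t + v t) \<le> ennreal ((norm x0)\<^sup>2) + ennreal e" .
      then show "energy {0..s} (\<lambda>t. w t + v t) \<le> 0 + ennreal e"
        by (simp add: ennreal_add_left_cancel_le)
    qed
    then have "energy {0..} (\<lambda>t. w t + v t) \<le> 0"
      by (intro energy_half_line_le sms) auto
    then have "(\<integral>\<^sup>+t. ennreal ((norm (w t + v t))\<^sup>2) * indicator {0..} t \<partial>lebesgue) = 0"
      by (simp add: energy_def)
    then have "AE t in lebesgue. ennreal ((norm (w t + v t))\<^sup>2) * indicator {0..} t = 0"
      by (subst (asm) nn_integral_0_iff_AE) (auto intro: borel_measurable_energy sms)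
    then have "AE t in lebesgue. t \<in> {0..} \<longrightarrow> w t = - v t"
      by eventually_elim (auto simp: indicator_def eq_neg_iff_add_eq_0 split: if_splits)
    then show ?thesis by (simp add: AE_restrict_space_iff)
  qed
  have "stabilizing_control S x0 (\<lambda>t. - v t)"
    unfolding stabilizing_control_def using K lim by blast
  then show ?control
    using K opt unique by (intro exI[of _ x] exI[of _ "\<lambda>t. - v t"] exI[of _ v]) auto
qed

end

section \<open>Passage from the system node to \<open>passive_node\<close>\<close>

lemma system_node_passive_node:
  assumes "system_node S l emb Ae B" "impedance_passive S"
  shows "passive_node S"
  by unfold_locales (use assms system_node_input_exists[OF assms(1)] in \<open>auto simp: system_node_def\<close>)

text \<open>The feedback condition formulated in the extrapolation space is membership in
  \<open>CL\<close>. Agreement of the two operators on the domain is enough, since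
  \<open>generates\<close> evaluates them only there.\<close>

lemma generates_closed_loop_generator:
  assumes node: "system_node S l emb Ae B" and pass: "impedance_passive S"
    and gen: "generates (closed_loop_generator S emb Ae B) TK"
  shows "generates \<lparr>Dom = passive_node.K_dom S, app = passive_node.K S\<rparr> TK"
proof -
  interpret passive_node S by (rule system_node_passive_node[OF node pass])
  have lin: "bounded_linear B" and dom: "Dom S = {(x, u). Ae x + B u \<in> range emb}"
    and AB: "\<And>x u. (x, u) \<in> Dom S \<Longrightarrow> Ae x + B u = emb (AB S (x, u))"
    and ext: "extrapolation_space (semigroup_generator S) l emb"
    using node by (auto simp: system_node_def bounded_clinear_def)
  have neg: "Ae x - B v = Ae x + B (- v)" for x v
    using linear_neg[OF bounded_linear.linear[OF lin]] by simp
  have fb_iff: "(Ae x - B v \<in> range emb \<and> v = CD S (x, - v)) \<longleftrightarrow> (x, v) \<in> CL" for x v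
    unfolding neg CL_def dom by auto
  \<comment> \<open>This lets \<open>inv emb\<close> undo \<open>emb\<close>: the norms of
    \<open>emb x\<close> and of the resolvent at \<open>x\<close> agree, and the resolvent is
    injective.\<close>
  have "inj emb"
  proof (rule injI)
    let ?A = "semigroup_generator S"
    fix p q assume eq: "emb p = emb q"
    have l: "l \<in> resolvent_set ?A" and "clinear_on UNIV emb" and nm: "\<And>x. norm (emb x) = norm (resolvent ?A l x)"
      using ext by (auto simp: extrapolation_space_def)
    then have "emb (p - q) = 0" using clinear_on_diff(2)[of UNIV emb p q] eq by simp
    then have "resolvent ?A l (p - q) = 0" using nm[of "p - q"] by simp
    moreover have bl: "bounded_linear (resolvent ?A l)" and bij: "bij_betw (\<lambda>x. l *\<^sub>C x - app ?A x) (Dom ?A) UNIV"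
      using l by (auto simp: resolvent_set_def bounded_clinear_def)
    ultimately have "resolvent ?A l p = resolvent ?A l q"
      using linear_diff[OF bounded_linear.linear[OF bl], of p q] by simp
    moreover have "inj_on (resolvent ?A l) UNIV"
      unfolding resolvent_def using bij by (metis bij_betw_def inj_on_inv_into order_refl)
    ultimately show "p = q" by (simp add: inj_eq)
  qed
  have D: "Dom (closed_loop_generator S emb Ae B) = K_dom"
    unfolding closed_loop_generator_def Let_def fb_iff by (force simp: K_dom_def)
  have "app (closed_loop_generator S emb Ae B) x = K x" if "x \<in> K_dom" for x
  proof -
    have "(x, fb x) \<in> CL" using that K_dom_iff by blast
    then have "Ae x - B (fb x) = emb (K x)" using AB CL_D(1) by (simp add: neg K_def)
    then show ?thesis using \<open>inj emb\<close>
      unfolding closed_loop_generator_def Let_def fb_iff by (simp add: inv_f_f flip: fb_def)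
  qed
  then show ?thesis using gen by (auto simp: generates_def D)
qed

theorem theorem1:
  fixes S :: "('x::chilbert_space \<times> 'u::chilbert_space, 'x \<times> 'u) partial_op"
    and l :: complex
    and emb :: "'x \<Rightarrow> 'z::chilbert_space"
    and Ae :: "'x \<Rightarrow> 'z"
    and B :: "'u \<Rightarrow> 'z"
  assumes "system_node S l emb Ae B"
    and "impedance_passive S"
  shows "finite_cost_condition S \<and>
    (\<exists>!P. optimal_cost_operator S P) \<and>
    (\<forall>P. optimal_cost_operator S P \<longrightarrow>
      (\<forall>x0. Re (cinner x0 (P x0)) \<le> (norm x0)\<^sup>2)) \<and>
    (\<forall>TK. impedance_energy_preserving S \<and>
        generates (closed_loop_generator S emb Ae B) TK \<and> strongly_stable TK \<longrightarrow>
      (\<forall>x0. \<exists>x u y.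
        generalized_solution S x u y \<and> x 0 = x0 \<and>
        (AE t in lebesgue_on {0..}. u t = - y t) \<and>
        optimal_control S x0 u \<and> stabilizing_control S x0 u \<and>
        (\<forall>v. optimal_control S x0 v \<and> stabilizing_control S x0 v \<longrightarrow>
          (AE t in lebesgue_on {0..}. v t = u t))) \<and>
      (\<forall>P. optimal_cost_operator S P \<longrightarrow>
        P = id \<and> riccati_solution S P (\<lambda>(x, u). CD S (x, u) + u)))"
proof -
  interpret passive_node S by (rule system_node_passive_node[OF assms])
  show ?thesis
  proof (intro conjI allI impI; (elim conjE)?)
    show "finite_cost_condition S" by (rule finite_cost_condition)
    show "\<exists>!P. optimal_cost_operator S P"
      using optimal_cost_operator_exists optimal_cost_operator_unique by blast
    show "Re (cinner x0 (P x0)) \<le> (norm x0)\<^sup>2" if "optimal_cost_operator S P" for P x0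
      using that V_le_norm by (simp add: optimal_cost_operator_iff)
  next
    fix TK assume pres: "impedance_energy_preserving S" and st: "strongly_stable TK"
      and "generates (closed_loop_generator S emb Ae B) TK"
    then have gen: "generates \<lparr>Dom = K_dom, app = K\<rparr> TK"
      using generates_closed_loop_generator[OF assms] by blast
    note strongly_stable = strongly_stable_optimal_control[OF pres gen st]
    show "\<exists>x u y. generalized_solution S x u y \<and> x 0 = x0 \<and>
        (AE t in lebesgue_on {0..}. u t = - y t) \<and>
        optimal_control S x0 u \<and> stabilizing_control S x0 u \<and>
        (\<forall>v. optimal_control S x0 v \<and> stabilizing_control S x0 v \<longrightarrow>
          (AE t in lebesgue_on {0..}. v t = u t))" for x0
      by (rule strongly_stable(1))
    fix P assume P: "optimal_cost_operator S P"
    have "optimal_cost_operator S id"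
      using energy_preserving_riccati[OF pres]
      by (simp add: optimal_cost_operator_iff riccati_solution_def strongly_stable(2) Re_cinner power2_norm_eq_inner)
    then show "P = id" by (rule optimal_cost_operator_unique[OF P])
    then show "riccati_solution S P (\<lambda>(x, u). CD S (x, u) + u)"
      using energy_preserving_riccati[OF pres] by simp
  qed
qed

end
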